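(* Let $d\in\mathbb N$, $\alpha\ge0$, and let $f$ be a probability density on $\mathbb R^d$ satisfying (C1). Let $\mathcal X_n$ consist of $n$ independent random vectors with density $f$. Then as $n\to\infty$, $$ n^{(\alpha-d)/d}\mathcal N^{d,\alpha}(\mathcal X_n)\xrightarrow{L^2}\Gamma(1+\alpha/d)\left(v_d^{-\alpha/d}-\tfrac12 v_d\,\omega_d^{-1-\alpha/d}\right)\int_{\mathrm{supp}(f)}f(\mathbf x)^{(d-\alpha)/d}d\mathbf x. $$ In particular, with $\mathcal U_n$ consisting of $n$ independent uniform points on $(0,1)^d$: for $d=2$ and all $\alpha\ge0$, $$ n^{(\alpha-2)/2}\mathcal N^{2,\alpha}(\mathcal U_n)\xrightarrow{L^2}\Gamma(1+\alpha/2)\left(\pi^{-\alpha/2}-\frac{\pi}{2}\left(\frac{6}{8\pi+3\sqrt3}\right)^{1+\alpha/2}\right); $$ for $d=2$, $\alpha=1$, $n^{-1/2}\mathcal N^{2,1}(\mathcal U_n)\xrightarrow{L^2}\frac12-\frac14\left(\frac{6\pi}{8\pi+3\sqrt3}\right)^{3/2}$; and for $d=1$, $\alpha=1$, $\mathcal N^{1,1}(\mathcal U_n)\xrightarrow{L^2}7/18$.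
   Context: $\|\cdot\|$ is the Euclidean norm. The nearest-neighbour (undirected) graph on a finite $\mathcal X\subset\mathbb R^d$ has an undirected edge between $\mathbf x,\mathbf y\in\mathcal X$ iff $\mathbf y$ is the nearest neighbour of $\mathbf x$ in $\mathcal X\setminus\{\mathbf x\}$ or vice versa (an edge between mutual nearest neighbours is counted once). $\mathcal N^{d,\alpha}(\mathcal X)$ is its total power-weighted edge length $\sum_{\text{edges }\{\mathbf u,\mathbf v\}}\|\mathbf u-\mathbf v\|^\alpha$. $v_d=\pi^{d/2}/\Gamma(1+d/2)$ is the volume of the unit $d$-ball and $\omega_d$ is the volume of the union of two unit $d$-balls whose centres are at distance $1$. Condition (C1): $f$ is supported by a convex polyhedron in $\mathbb R^d$ and is bounded away from $0$ and $\infty$ on its support; $\mathrm{supp}(f)$ is its support. *)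

theory Defs
  imports "HOL-Probability.Probability"
begin

definition nn_of :: "'a::metric_space set \<Rightarrow> 'a \<Rightarrow> 'a \<Rightarrow> bool" where
  "nn_of X x y \<longleftrightarrow> x \<in> X \<and> y \<in> X \<and> y \<noteq> x \<and> (\<forall>z\<in>X - {x}. dist x y \<le> dist x z)"

definition nn_adj :: "'a::metric_space set \<Rightarrow> 'a \<Rightarrow> 'a \<Rightarrow> bool" where
  "nn_adj X u v \<longleftrightarrow> nn_of X u v \<or> nn_of X v u"

definition nn_edges :: "'a::metric_space set \<Rightarrow> 'a set set" where
  "nn_edges X = {{u, v} | u v. nn_adj X u v}"

text \<open>Total power-weighted edge length; each undirected edge {u,v} counted once
  (the sum over ordered adjacent pairs counts every edge twice).\<close>
definition NN_weight :: "real \<Rightarrow> 'a::metric_space set \<Rightarrow> real" where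
  "NN_weight \<alpha> X = (\<Sum>(u, v)\<in>{(u, v). nn_adj X u v}. dist u v powr \<alpha>) / 2"

definition unit_ball_vol :: "nat \<Rightarrow> real" where
  "unit_ball_vol d = pi powr (real d / 2) / Gamma (1 + real d / 2)"

definition two_ball_vol :: "'a::euclidean_space itself \<Rightarrow> real" where
  "two_ball_vol _ = measure lborel (ball (0::'a) 1 \<union> ball (SOME b. b \<in> (Basis::'a set)) 1)"

definition L2_conv_const :: "(nat \<Rightarrow> 'b measure) \<Rightarrow> (nat \<Rightarrow> 'b \<Rightarrow> real) \<Rightarrow> real \<Rightarrow> bool" where
  "L2_conv_const M Y c \<longleftrightarrow>
     (\<forall>n. integrable (M n) (\<lambda>\<omega>. (Y n \<omega> - c)\<^sup>2)) \<and>
     (\<lambda>n. \<integral>\<omega>. (Y n \<omega> - c)\<^sup>2 \<partial>M n) \<longlonglongrightarrow> 0"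

definition iid_sample :: "nat \<Rightarrow> 'a measure \<Rightarrow> (nat \<Rightarrow> 'a) measure" where
  "iid_sample n \<mu> = PiM {..<n} (\<lambda>_. \<mu>)"

end

theory Submission
  imports Defs
begin

text \<open>Almost surely the sample points are distinct, and then an ordered pair \<open>(i, j)\<close> has \<open>X\<^sub>j\<close> as the
  nearest neighbour of \<open>X\<^sub>i\<close> iff no other point lies in the ball around \<open>X\<^sub>i\<close> through \<open>X\<^sub>j\<close>, and the two
  points are mutual nearest neighbours iff no other point lies in the union of the two such balls.
  Counting every mutual pair once, the weight of the graph is \<open>T\<^sub>0 - T\<^sub>1 / 2\<close>, where \<open>T\<^sub>t\<close> is the sum of
  \<open>|X\<^sub>i - X\<^sub>j|\<^sup>\<alpha>\<close> over the ordered pairs whose empty region is the ball (\<open>t = 0\<close>) or the union (\<open>t = 1\<close>).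
  So it suffices that the rescaled \<open>T\<^sub>t\<close> converges in \<open>L\<^sup>2\<close>. Its mean is a double integral which, after
  scaling \<open>y = x + n\<^bsup>-1/d\<^esup> u\<close>, converges by dominated convergence and the \<open>L\<^sup>1\<close>-continuity of
  translations to an integral of Gamma type. For the variance only the upper bound \<open>limsup E T\<^sub>t\<^sup>2 \<le> c\<^sup>2\<close> is
  needed: for four distinct indices whose regions are disjoint the emptiness probability is at most
  the product of two factors with the limit of the mean, and all other contributions are \<open>O(1/n)\<close>.\<close>

subsection \<open>Lebesgue measure, isometries and radial integrals\<close>

text \<open>The density is merely measurable, so the rescaled mass of an empty region is not
  compared with volume times f(x) point by point: the comparison is made in the mean over x for each
  fixed rescaled offset u, which is what continuity of translations provides. Domination in u rests
  on a lower bound \<open>\<kappa> * r ^ d\<close> for the mass of a ball of radius r centred in the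
  support P and reaching another point of P. Boundary points of P must be covered too, and convexity
  achieves this. The resulting decay exp(-const * |u|^d) also drives all crude moment bounds. If the
  empty region of a pair at distance r has volume s * r^d, the mean has limit v_d *
  s^(-1-\<alpha>/d) * Gamma(1+\<alpha>/d) times the integral of f^(1-\<alpha>/d). Taking s = v_d and
  s = omega_d yields the two terms of the constant. The mean involves (1-p)^(n-2), the second moment
  exp(-(n-4)p); the limit is therefore proved once for every kernel that is uniformly close to
  exp(-n p).\<close>

lemma nn_integral_lborel_affine:
  fixes g :: "'a::euclidean_space \<Rightarrow> ennreal"
  assumes [measurable]: "g \<in> borel_measurable borel" and c: "0 < c"
  shows "(\<integral>\<^sup>+y. g y \<partial>lborel) = ennreal (c ^ DIM('a)) * (\<integral>\<^sup>+u. g (x + c *\<^sub>R u) \<partial>lborel)"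
  by (subst lborel_affine[of c x])
     (use c in \<open>simp_all add: nn_integral_density nn_integral_distr nn_integral_cmult\<close>)

lemma nn_integral_lborel_translation:
  fixes g :: "'a::euclidean_space \<Rightarrow> ennreal"
  assumes [measurable]: "g \<in> borel_measurable borel"
  shows "(\<integral>\<^sup>+y. g (x + y) \<partial>lborel) = (\<integral>\<^sup>+y. g y \<partial>lborel)"
  using nn_integral_lborel_affine[OF assms, of 1 x] by simp

text \<open>Any isometry between spaces of equal dimension can be followed by a reflection that
  moves the image of u to v. Two different types are allowed so that \<open>real^2\<close> can be
  compared with \<open>real \<times> real\<close>, where areas are computed by slicing.\<close>

lemma linear_isometry_exists:
  fixes u :: "'a::euclidean_space" and v :: "'b::euclidean_space"
  assumes "DIM('a) = DIM('b)" and "norm u = norm v"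
  obtains T S where "linear T" "linear S" "\<And>x. norm (T x) = norm x" "\<And>y. norm (S y) = norm y"
    "\<And>y. T (S y) = y" "\<And>x. S (T x) = (x::'a)" "T u = v"
proof -
  obtain f :: "'a \<Rightarrow> 'b" and g where fg: "linear f" "linear g" "\<And>x. norm(f x) = norm x" "\<And>y. norm(g y) = norm y"
      "\<And>x. g (f x) = x" "\<And>y. f(g y) = y"
    using isomorphisms_UNIV_UNIV[OF assms(1)] by metis
  define w where "w = f u - v"
  \<comment> \<open>the Householder reflection exchanging \<open>f u\<close> and \<open>v\<close>; it is the identity if \<open>f u = v\<close>\<close>
  define R where "R z = z - (2 * (z \<bullet> w) / (w \<bullet> w)) *\<^sub>R w" for z
  have linR: "linear R"
    unfolding R_def by (intro linearI) (auto simp: algebra_simps inner_simps add_divide_distrib)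
  have ww: "f u \<bullet> f u = v \<bullet> v"
    using fg(3)[of u] assms(2) by (simp add: dot_square_norm)
  have Rw: "R w = - w"
    by (cases "w = 0") (simp_all add: R_def algebra_simps scaleR_2)
  have RR: "R (R z) = z" for z
  proof -
    have "R (R z) = R z - (2 * (z \<bullet> w) / (w \<bullet> w)) *\<^sub>R R w"
      using linear_diff[OF linR, of z "(2 * (z \<bullet> w) / (w \<bullet> w)) *\<^sub>R w"] linear_scale[OF linR]
      by (simp add: R_def[of z])
    also have "\<dots> = z"
      unfolding Rw by (simp add: R_def)
    finally show ?thesis .
  qed
  have nR: "norm (R z) = norm z" for z
  proof (cases "w = 0")
    case False
    then have "R z \<bullet> R z = z \<bullet> z"
      by (simp add: R_def inner_simps field_simps inner_commute)
    then show ?thesis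
      by (simp add: norm_eq_sqrt_inner)
  qed (simp add: R_def)
  have Ru: "R (f u) = v"
  proof (cases "w = 0")
    case False
    have "2 * (f u \<bullet> w) = w \<bullet> w"
      using ww by (simp add: w_def inner_simps inner_commute)
    then show ?thesis
      using False by (simp add: R_def) (simp add: w_def)
  qed (simp add: R_def w_def)
  show thesis
  proof (rule that[of "\<lambda>x. R (f x)" "\<lambda>y. g (R y)"])
    show "linear (\<lambda>x. R (f x))" "linear (\<lambda>y. g (R y))"
      using linear_compose[OF fg(1) linR] linear_compose[OF linR fg(2)] by (simp_all add: o_def)
  qed (use fg nR RR Ru in auto)
qed

text \<open>The double integral of 1_A(T x) * 1_B(y - T x), with B the unit ball, is evaluated in
  both orders. One order gives vol(T^-1 A) * vol(B), the other vol(A) * vol(T^-1 B). An isometry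
  pulls the unit ball back to the unit ball, whose volume depends only on the dimension, so the ball
  factor cancels.\<close>

lemma distr_lborel_linear_isometry:
  fixes T :: "'a::euclidean_space \<Rightarrow> 'b::euclidean_space"
  assumes "linear T" "linear S" and nT: "\<And>x. norm (T x) = norm x" and TS: "\<And>y. T (S y) = y"
    and dim: "DIM('a) = DIM('b)"
  shows "distr lborel borel T = lborel"
proof -
  have [measurable]: "T \<in> borel_measurable borel" "S \<in> borel_measurable borel"
    using assms(1,2) by (auto intro!: borel_measurable_continuous_onI linear_continuous_on simp: linear_conv_bounded_linear)
  define B where "B = ball (0::'b) 1"
  have [measurable]: "B \<in> sets borel" by (simp add: B_def)
  have TB: "T -` B = ball 0 1"
    by (auto simp: B_def nT)
  have B_fin: "emeasure lborel B \<noteq> \<infinity>" "emeasure lborel B \<noteq> 0"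
    using unit_ball_vol_pos[of "real DIM('b)"] by (simp_all add: B_def emeasure_ball del: unit_ball_vol_pos)
  have fubini: "emeasure (distr lborel borel T) A = emeasure lborel A" if [measurable]: "A \<in> sets borel" for A
  proof -
    have [measurable]: "T -` A \<in> sets borel"
      using measurable_sets_borel[of T borel A] by simp
    have "emeasure lborel (T -` A) * emeasure lborel B
      = (\<integral>\<^sup>+x. indicator A (T x) * emeasure lborel B \<partial>lborel)"
      by (simp add: nn_integral_multc indicator_vimage[symmetric, unfolded o_def])
    also have "\<dots> = (\<integral>\<^sup>+x. indicator A (T x) * (\<integral>\<^sup>+y. indicator B (- T x + y) \<partial>lborel) \<partial>lborel)"
    proof -
      have "(\<integral>\<^sup>+y. indicator B (- T x + y) \<partial>lborel) = emeasure lborel B" for x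
        using nn_integral_lborel_translation[of "indicator B" "- T x"] by simp
      then show ?thesis by simp
    qed
    also have "\<dots> = (\<integral>\<^sup>+x. (\<integral>\<^sup>+y. indicator A (T x) * indicator B (- T x + y) \<partial>lborel) \<partial>lborel)"
      by (simp add: nn_integral_cmult)
    also have "\<dots> = (\<integral>\<^sup>+y. (\<integral>\<^sup>+x. indicator A (T x) * indicator B (- T x + y) \<partial>lborel) \<partial>lborel)"
      by (rule lborel_pair.Fubini') measurable
    \<comment> \<open>Shifting x by \<open>S y\<close> replaces \<open>T x\<close> by
      \<open>y + T x\<close>, which moves the variable y from the factor of B to the factor of
      A.\<close>
    also have "\<dots> = (\<integral>\<^sup>+y. (\<integral>\<^sup>+x. indicator A (y + T x) * indicator B (- T x) \<partial>lborel) \<partial>lborel)"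
    proof (rule nn_integral_cong)
      fix y :: 'b
      have "(\<integral>\<^sup>+x. indicator A (T x) * indicator B (- T x + y) \<partial>lborel) =
        (\<integral>\<^sup>+x. indicator A (T (S y + x)) * indicator B (- T (S y + x) + y) \<partial>(lborel::'a measure))"
        using nn_integral_lborel_translation[of "\<lambda>x. indicator A (T x) * indicator B (- T x + y)" "S y"] by simp
      then show "(\<integral>\<^sup>+x. indicator A (T x) * indicator B (- T x + y) \<partial>lborel) =
        (\<integral>\<^sup>+x. indicator A (y + T x) * indicator B (- T x) \<partial>(lborel::'a measure))"
        by (simp add: linear_add[OF assms(1)] TS)
    qed
    also have "\<dots> = (\<integral>\<^sup>+x. (\<integral>\<^sup>+y. indicator A (y + T x) * indicator B (- T x) \<partial>lborel) \<partial>lborel)"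
      by (rule lborel_pair.Fubini'[symmetric]) measurable
    also have "\<dots> = (\<integral>\<^sup>+x. (\<integral>\<^sup>+y. indicator A (T x + y) \<partial>lborel) * indicator B (- T x) \<partial>lborel)"
      by (simp add: nn_integral_multc add.commute)
    \<comment> \<open>The inner integral is the volume of A by translation invariance, and B is
      symmetric about 0.\<close>
    also have "\<dots> = (\<integral>\<^sup>+x. emeasure lborel A * indicator (T -` B) x \<partial>lborel)"
      using nn_integral_lborel_translation[of "indicator A"] by (intro nn_integral_cong) (simp add: B_def split: split_indicator)
    also have "\<dots> = emeasure lborel A * emeasure lborel (T -` B)"
      by (simp add: TB nn_integral_cmult_indicator)
    also have "emeasure lborel (T -` B) = emeasure lborel B"
      unfolding TB by (simp add: B_def emeasure_ball dim)
    finally have "emeasure lborel (T -` A) = emeasure lborel A"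
      using B_fin by (simp add: mult.commute[of _ "emeasure lborel B"] ennreal_mult_cancel_left)
    then show ?thesis
      by (simp add: emeasure_distr)
  qed
  show ?thesis
    by (rule measure_eqI) (use fubini in auto)
qed

text \<open>An isometry taking u to v fixes the unit ball at 0 and carries the second centre to the
  other one. Hence the choice of basis vector in \<open>two_ball_vol\<close> does not matter, and
  the volume may be computed in another space of the same dimension.\<close>

lemma measure_two_balls_cong:
  fixes u :: "'a::euclidean_space" and v :: "'b::euclidean_space"
  assumes dim: "DIM('a) = DIM('b)" and "norm u = norm v"
  shows "emeasure lborel (ball 0 1 \<union> ball (t *\<^sub>R u) 1) = emeasure lborel (ball 0 1 \<union> ball (t *\<^sub>R v) 1)"
proof -
  obtain T S where T: "linear T" "linear S" "\<And>x. norm (T x) = norm x" "\<And>y. norm (S y) = norm y"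
    "\<And>y. T (S y) = y" "\<And>x. S (T x) = (x::'a)" "T u = v"
    using linear_isometry_exists[OF assms] by metis
  have [measurable]: "T \<in> borel_measurable borel"
    using T(1) by (auto intro!: borel_measurable_continuous_onI linear_continuous_on simp: linear_conv_bounded_linear)
  have "norm (t *\<^sub>R v - T x) = norm (t *\<^sub>R u - x)" for x
    using T(3)[of "t *\<^sub>R u - x"] T(7) by (simp add: linear_diff[OF T(1)] linear_scale[OF T(1)])
  then have "T -` (ball 0 1 \<union> ball (t *\<^sub>R v) 1) = ball 0 1 \<union> ball (t *\<^sub>R u) 1"
    by (auto simp: T(3) dist_norm)
  moreover have "emeasure lborel (ball 0 1 \<union> ball (t *\<^sub>R v) 1) = emeasure lborel (T -` (ball 0 1 \<union> ball (t *\<^sub>R v) 1))"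
    by (subst distr_lborel_linear_isometry[OF T(1,2,3,5) dim, symmetric]) (simp add: emeasure_distr)
  ultimately show ?thesis by simp
qed

text \<open>A ball of radius r has volume v_d * r^d, so the map u -> |u|^d pushes Lebesgue measure
  to v_d times Lebesgue measure on the half-line. Using |u|^d instead of |u| makes this density
  constant. The two measures are compared on the half-lines \<open>{..a}\<close>.\<close>

lemma nn_integral_radial:
  fixes g :: "real \<Rightarrow> ennreal"
  assumes [measurable]: "g \<in> borel_measurable borel"
  shows "(\<integral>\<^sup>+u. g (norm (u::'a::euclidean_space) ^ DIM('a)) \<partial>lborel)
    = ennreal (Ball_Volume.unit_ball_vol (real DIM('a))) * (\<integral>\<^sup>+t. g t * indicator {0..} t \<partial>lborel)"
proof -
  let ?v = "Ball_Volume.unit_ball_vol (real DIM('a))"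
  let ?h = "\<lambda>u::'a. norm u ^ DIM('a)"
  let ?N = "density lborel (\<lambda>t::real. ennreal ?v * indicator {0..} t)"
  have eq: "emeasure (distr lborel borel ?h) {..a} = emeasure ?N {..a}" and fin: "emeasure (distr lborel borel ?h) {..a} \<noteq> \<infinity>" for a :: real
  proof -
    have N: "emeasure ?N {..a} = ennreal ?v * emeasure lborel {0..a}"
      by (simp add: emeasure_density mult.assoc indicator_inter_arith[symmetric] nn_integral_cmult) (rule arg_cong[where f="\<lambda>A. _ * emeasure lborel A"], auto)
    have L: "emeasure (distr lborel borel ?h) {..a} = emeasure lborel {u. ?h u \<le> a}"
      by (simp add: emeasure_distr vimage_def)
    show "emeasure (distr lborel borel ?h) {..a} = emeasure ?N {..a}"
    proof (cases "a \<ge> 0")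
      case True
      define r where "r = root DIM('a) a"
      have r: "r \<ge> 0" "r ^ DIM('a) = a"
        using True by (simp_all add: r_def)
      have "{u. ?h u \<le> a} = cball (0::'a) r"
        using r by (auto simp: power_mono_iff simp flip: r(2))
      then show ?thesis
        using r True by (simp add: L N emeasure_cball ennreal_mult')
    next
      case False
      moreover have "{u. ?h u \<le> a} = {}"
        using False by (auto simp: not_le intro: less_le_trans[of a 0])
      ultimately show ?thesis by (simp add: L N)
    qed
    then show "emeasure (distr lborel borel ?h) {..a} \<noteq> \<infinity>"
      by (simp add: N ennreal_mult_eq_top_iff emeasure_lborel_Icc_eq)
  qed
  have "distr lborel borel ?h = ?N"
  proof (rule measure_eqI_generator_eq[where E="range atMost" and \<Omega>=UNIV and A="\<lambda>i. {..real i}"])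
    show "Int_stable (range atMost :: real set set)"
      by (auto simp: Int_stable_def)
    show "(\<Union>i. {..real i}) = UNIV"
      by (auto intro: real_arch_simple)
  qed (use eq fin in \<open>auto simp: borel_eq_atMost\<close>)
  then have "(\<integral>\<^sup>+t. g t \<partial>distr lborel borel ?h) = (\<integral>\<^sup>+t. g t \<partial>?N)" by simp
  then show ?thesis
    by (simp add: nn_integral_distr nn_integral_density nn_integral_cmult[symmetric] mult_ac)
qed

lemma nn_integral_Gamma_scaled:
  assumes "\<beta> > -1" "l > 0"
  shows "(\<integral>\<^sup>+t. ennreal (t powr \<beta> * exp (- l * t)) * indicator {0..} t \<partial>lborel) = ennreal (l powr (-1 - \<beta>) * Gamma (1 + \<beta>))"
proof -
  have "(\<integral>\<^sup>+t. ennreal (t powr \<beta> * exp (- l * t)) * indicator {0..} t \<partial>lborel)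
     = ennreal (1/l) * (\<integral>\<^sup>+t. ennreal ((t/l) powr \<beta> * exp (- t)) * indicator {0..} (t / l) \<partial>lborel)"
    using assms by (subst nn_integral_real_affine[where c="1/l" and t=0]) auto
  also have "(\<integral>\<^sup>+t. ennreal ((t/l) powr \<beta> * exp (- t)) * indicator {0..} (t / l) \<partial>lborel)
     = (\<integral>\<^sup>+t. ennreal (l powr (-\<beta>)) * ennreal (indicator {0..} t * t powr ((1 + \<beta>) - 1) / exp t) \<partial>lborel)"
    using assms by (intro nn_integral_cong)
      (auto simp: indicator_def powr_divide exp_minus powr_minus field_simps zero_le_divide_iff simp flip: ennreal_mult')
  also have "\<dots> = ennreal (l powr (-\<beta>)) * ennreal (Gamma (1 + \<beta>))"
    using assms by (subst Gamma_conv_nn_integral_real) (auto intro!: nn_integral_cmult)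
  also have "ennreal (1/l) * \<dots> = ennreal (l powr (-1 - \<beta>) * Gamma (1 + \<beta>))"
    using assms by (simp add: powr_diff powr_minus field_simps flip: ennreal_mult')
  finally show ?thesis .
qed

text \<open>Source of every Gamma factor: in the variable t = |u|^d the weight becomes
  t^(\<gamma>/d) * exp(-l t).\<close>

lemma nn_integral_powr_exp_norm:
  assumes "\<gamma> \<ge> 0" "l > 0"
  shows "(\<integral>\<^sup>+u. ennreal (norm (u::'a::euclidean_space) powr \<gamma> * exp (- l * norm u ^ DIM('a))) \<partial>lborel)
    = ennreal (Ball_Volume.unit_ball_vol (real DIM('a)) * (l powr (-1 - \<gamma> / DIM('a)) * Gamma (1 + \<gamma> / DIM('a))))"
proof -
  have *: "norm u powr \<gamma> = (norm u ^ DIM('a)) powr (\<gamma> / DIM('a))" for u :: 'a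
    by (cases "u = 0") (simp_all add: powr_powr flip: powr_realpow)
  have "(\<integral>\<^sup>+u. ennreal (norm (u::'a) powr \<gamma> * exp (- l * norm u ^ DIM('a))) \<partial>lborel)
    = (\<integral>\<^sup>+u. (\<lambda>t. ennreal (t powr (\<gamma> / DIM('a)) * exp (- l * t))) (norm (u::'a) ^ DIM('a)) \<partial>lborel)"
    unfolding * by simp
  also have "-1 < \<gamma> / DIM('a)"
    using assms by (auto intro: less_le_trans[OF _ divide_nonneg_nonneg])
  then have "(\<integral>\<^sup>+u. (\<lambda>t. ennreal (t powr (\<gamma> / DIM('a)) * exp (- l * t))) (norm (u::'a) ^ DIM('a)) \<partial>lborel)
    = ennreal (Ball_Volume.unit_ball_vol (real DIM('a))) * ennreal (l powr (-1 - \<gamma> / DIM('a)) * Gamma (1 + \<gamma> / DIM('a)))"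
    using assms by (subst nn_integral_radial) (use nn_integral_Gamma_scaled[of "\<gamma> / DIM('a)" l] assms in auto)
  finally show ?thesis
    by (simp add: ennreal_mult')
qed

subsection \<open>Continuity of translations in the mean\<close>

text \<open>A point of an open set stays in it under small shifts, so the measure of the points
  leaving U tends to 0 by dominated convergence with bound 1_U. The points entering U under the
  shift h are, after a translation, those leaving it under -h.\<close>

lemma L1_translation_tendsto_0_open:
  fixes U :: "'a::euclidean_space set"
  assumes U: "open U" "emeasure lborel U < \<infinity>" and h: "h \<longlonglongrightarrow> 0"
  shows "(\<lambda>n. \<integral>\<^sup>+x. ennreal \<bar>indicator U (x + h n) - indicator U x\<bar> \<partial>lborel) \<longlonglongrightarrow> 0"
proof -
  have [measurable]: "U \<in> sets borel" using U(1) by auto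
  define D where "D k = (\<integral>\<^sup>+x. indicator U x * indicator (- U) (x + k) \<partial>lborel)" for k
  have D: "(\<lambda>n. D (k n)) \<longlonglongrightarrow> 0" if k: "k \<longlonglongrightarrow> 0" for k
  proof -
    have "(\<lambda>n. D (k n)) \<longlonglongrightarrow> (\<integral>\<^sup>+x. 0 \<partial>(lborel::'a measure))"
      unfolding D_def
    proof (rule nn_integral_dominated_convergence[where w="indicator U"])
      show "AE x in lborel. (\<lambda>n. indicator U x * indicator (- U) (x + k n) :: ennreal) \<longlonglongrightarrow> 0"
      proof (rule AE_I2)
        fix x
        show "(\<lambda>n. indicator U x * indicator (- U) (x + k n) :: ennreal) \<longlonglongrightarrow> 0"
        proof (cases "x \<in> U")
          case True
          have "(\<lambda>n. x + k n) \<longlonglongrightarrow> x + 0"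
            using k by (intro tendsto_intros)
          then have "eventually (\<lambda>n. x + k n \<in> U) sequentially"
            using U(1) True by (auto simp: tendsto_def)
          then show ?thesis
            by (intro tendsto_eventually, elim eventually_mono) simp
        qed simp
      qed
    qed (use U(2) in \<open>auto split: split_indicator\<close>)
    then show ?thesis by simp
  qed
  have "(\<integral>\<^sup>+x. ennreal \<bar>indicator U (x + h n) - indicator U x\<bar> \<partial>lborel) = D (- h n) + D (h n)" for n
  proof -
    have "(\<integral>\<^sup>+x. ennreal \<bar>indicator U (x + h n) - indicator U x\<bar> \<partial>lborel)
      = (\<integral>\<^sup>+x. indicator U (x + h n) * indicator (- U) x + indicator U x * indicator (- U) (x + h n) \<partial>lborel)"
      by (intro nn_integral_cong) (auto simp: indicator_def)
    also have "\<dots> = (\<integral>\<^sup>+x. indicator U (x + h n) * indicator (- U) x \<partial>lborel) + D (h n)"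
      by (simp add: nn_integral_add D_def)
    also have "(\<integral>\<^sup>+x. indicator U (x + h n) * indicator (- U) x \<partial>lborel) = D (- h n)"
      unfolding D_def by (subst nn_integral_lborel_translation[symmetric, where x="- h n"])
        (simp_all add: add.commute)
    finally show ?thesis .
  qed
  moreover have "(\<lambda>n. D (- h n) + D (h n)) \<longlonglongrightarrow> 0 + 0"
    using h by (intro tendsto_intros D) (auto intro!: tendsto_eq_intros)
  ultimately show ?thesis by simp
qed

lemma ennreal_tendsto_0_iff_le:
  fixes f :: "nat \<Rightarrow> ennreal"
  shows "f \<longlonglongrightarrow> 0 \<longleftrightarrow> (\<forall>e>0. eventually (\<lambda>n. f n \<le> ennreal e) sequentially)"
proof
  assume "f \<longlonglongrightarrow> 0"
  then show "\<forall>e>0. eventually (\<lambda>n. f n \<le> ennreal e) sequentially"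
  proof (intro allI impI)
    fix e :: real assume "e > 0"
    then have "eventually (\<lambda>n. f n < ennreal e) sequentially"
      using \<open>f \<longlonglongrightarrow> 0\<close> by (intro order_tendstoD(2)) auto
    then show "eventually (\<lambda>n. f n \<le> ennreal e) sequentially"
      by eventually_elim simp
  qed
next
  assume *: "\<forall>e>0. eventually (\<lambda>n. f n \<le> ennreal e) sequentially"
  show "f \<longlonglongrightarrow> 0"
  proof (rule order_tendstoI)
    fix a :: ennreal assume "0 < a"
    then obtain e where e: "0 < ennreal e" "ennreal e < a"
      using dense[of 0 a] by (metis ennreal_cases less_top top.not_eq_extremum top.extremum_strict dual_order.strict_trans1 order_less_imp_le)
    then show "eventually (\<lambda>n. f n < a) sequentially"
      using * by (auto elim!: allE[of _ e] eventually_mono)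
  qed simp
qed

text \<open>Induction over integrable functions. Indicators are reduced to open sets by outer
  regularity, limits by an e/3 argument; in both, translation invariance lets the approximation
  error be counted twice, once shifted and once not.\<close>

theorem L1_translation_tendsto_0:
  fixes f :: "'a::euclidean_space \<Rightarrow> real"
  assumes "integrable lborel f" and h: "h \<longlonglongrightarrow> 0"
  shows "(\<lambda>n. \<integral>\<^sup>+x. ennreal \<bar>f (x + h n) - f x\<bar> \<partial>lborel) \<longlonglongrightarrow> 0"
  using assms(1)
proof (induct f)
  case (base A c)
  have [measurable]: "A \<in> sets borel" using base by simp
  have shift: "(\<integral>\<^sup>+x. g (x + k) \<partial>lborel) = (\<integral>\<^sup>+x. g x \<partial>lborel)" if "g \<in> borel_measurable borel" for g and k :: 'a
    using nn_integral_lborel_translation[OF that, of k] by (simp add: add.commute)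
  have "(\<lambda>n. \<integral>\<^sup>+x. ennreal \<bar>indicator A (x + h n) - indicator A x\<bar> \<partial>lborel) \<longlonglongrightarrow> 0"
    unfolding ennreal_tendsto_0_iff_le
  proof (intro allI impI)
    fix e :: real assume e: "e > 0"
    obtain U where U: "open U" "A \<subseteq> U" "(U - A) \<in> lmeasurable" "emeasure lebesgue (U - A) < ennreal (e/3)"
      using sets_lebesgue_outer_open[of A "e/3"] base e by auto
    have [measurable]: "U \<in> sets borel" using U by auto
    have le: "emeasure lborel (U - A) < ennreal (e/3)"
      using U(4) by (simp add: emeasure_completion)
    have fin: "emeasure lborel U < \<infinity>"
    proof -
      have "emeasure lborel U \<le> emeasure lborel A + emeasure lborel (U - A)"
        using U(2) by (subst plus_emeasure) (auto simp: Un_absorb1)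
      also have "\<dots> < \<infinity>"
        using base(2) le by (simp add: less_top ) (metis ennreal_less_top dual_order.strict_trans less_top)
      finally show ?thesis .
    qed
    have "eventually (\<lambda>n. (\<integral>\<^sup>+x. ennreal \<bar>indicator U (x + h n) - indicator U x\<bar> \<partial>lborel) \<le> ennreal (e/3)) sequentially"
      using L1_translation_tendsto_0_open[OF U(1) fin h] e unfolding ennreal_tendsto_0_iff_le by auto
    then show "eventually (\<lambda>n. (\<integral>\<^sup>+x. ennreal \<bar>indicator A (x + h n) - indicator A x\<bar> \<partial>lborel) \<le> ennreal e) sequentially"
    proof (rule eventually_mono)
      fix n assume n: "(\<integral>\<^sup>+x. ennreal \<bar>indicator U (x + h n) - indicator U x\<bar> \<partial>lborel) \<le> ennreal (e/3)"
      \<comment> \<open>If exactly one of x and x + h lies in A, then either one of them lies in U -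
        A or they are separated by U.\<close>
      have "(\<integral>\<^sup>+x. ennreal \<bar>indicator A (x + h n) - indicator A x\<bar> \<partial>lborel)
        \<le> (\<integral>\<^sup>+x. indicator (U - A) (x + h n) + ennreal \<bar>indicator U (x + h n) - indicator U x\<bar> + indicator (U - A) x \<partial>lborel)"
        using U(2) by (intro nn_integral_mono) (auto simp: indicator_def)
      also have "\<dots> = emeasure lborel (U - A) + (\<integral>\<^sup>+x. ennreal \<bar>indicator U (x + h n) - indicator U x\<bar> \<partial>lborel) + emeasure lborel (U - A)"
        by (simp add: nn_integral_add shift[of "indicator (U - A)"])
      also have "\<dots> \<le> ennreal (e/3) + ennreal (e/3) + ennreal (e/3)"
        using le n by (intro add_mono) auto
      also have "\<dots> = ennreal e"
        using e by (simp flip: ennreal_plus)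
      finally show "(\<integral>\<^sup>+x. ennreal \<bar>indicator A (x + h n) - indicator A x\<bar> \<partial>lborel) \<le> ennreal e" .
    qed
  qed
  then have "(\<lambda>n. ennreal \<bar>c\<bar> * (\<integral>\<^sup>+x. ennreal \<bar>indicator A (x + h n) - indicator A x\<bar> \<partial>lborel)) \<longlonglongrightarrow> ennreal \<bar>c\<bar> * 0"
    by (intro ennreal_tendsto_cmult) auto
  moreover have "ennreal \<bar>c\<bar> * (\<integral>\<^sup>+x. ennreal \<bar>indicator A (x + h n) - indicator A x\<bar> \<partial>lborel)
    = (\<integral>\<^sup>+x. ennreal \<bar>indicator A (x + h n) *\<^sub>R c - indicator A x *\<^sub>R c\<bar> \<partial>lborel)" for n
    by (subst nn_integral_cmult[symmetric])
      (auto intro!: nn_integral_cong simp: ennreal_mult'[symmetric] abs_mult[symmetric] algebra_simps)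
  ultimately show ?case by simp
next
  case (add f g)
  have [measurable]: "f \<in> borel_measurable borel" "g \<in> borel_measurable borel"
    using add(1,3) by auto
  have "(\<lambda>n. (\<integral>\<^sup>+x. ennreal \<bar>f (x + h n) - f x\<bar> \<partial>lborel) + (\<integral>\<^sup>+x. ennreal \<bar>g (x + h n) - g x\<bar> \<partial>lborel)) \<longlonglongrightarrow> 0 + 0"
    using add(2,4) by (intro tendsto_add)
  moreover have "(\<integral>\<^sup>+x. ennreal \<bar>(f (x + h n) + g (x + h n)) - (f x + g x)\<bar> \<partial>lborel) \<le>
      (\<integral>\<^sup>+x. ennreal \<bar>f (x + h n) - f x\<bar> \<partial>lborel) + (\<integral>\<^sup>+x. ennreal \<bar>g (x + h n) - g x\<bar> \<partial>lborel)" for n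
  proof -
    have "\<bar>(f (x + h n) + g (x + h n)) - (f x + g x)\<bar> \<le> \<bar>f (x + h n) - f x\<bar> + \<bar>g (x + h n) - g x\<bar>" for x
      by linarith
    then show ?thesis
      by (subst nn_integral_add[symmetric]) (simp_all add: nn_integral_mono ennreal_leI flip: ennreal_plus)
  qed
  ultimately show ?case
    using tendsto_const[of "0::ennreal"]
    by (intro tendsto_sandwich[of "\<lambda>_. 0" "\<lambda>n. \<integral>\<^sup>+x. ennreal \<bar>(f (x + h n) + g (x + h n)) - (f x + g x)\<bar> \<partial>lborel"] always_eventually allI)
      (simp_all only: zero_le add_0)
next
  case (lim f s)
  have [measurable]: "f \<in> borel_measurable borel" "\<And>i. s i \<in> borel_measurable borel"
    using borel_measurable_integrable[OF lim(5)] borel_measurable_integrable[OF lim(1)] by simp_all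
  have shift: "(\<integral>\<^sup>+x. g (x + k) \<partial>lborel) = (\<integral>\<^sup>+x. g x \<partial>lborel)" if "g \<in> borel_measurable borel" for g and k :: 'a
    using nn_integral_lborel_translation[OF that, of k] by (simp add: add.commute)
  have approx: "(\<lambda>i. \<integral>\<^sup>+x. norm (f x - s i x) \<partial>lborel) \<longlonglongrightarrow> 0"
  proof (rule nn_integral_dominated_convergence_norm[where w="\<lambda>x. 2 * norm (f x)"])
    show "(\<integral>\<^sup>+x. ennreal (2 * norm (f x)) \<partial>lborel) < \<infinity>"
      using lim(5) by (simp add: integrable_iff_bounded ennreal_mult nn_integral_cmult ennreal_mult_less_top)
  qed (use lim(3,4) in auto)
  show ?case
    unfolding ennreal_tendsto_0_iff_le
  proof (intro allI impI)
    fix e :: real assume e: "e > 0"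
    obtain i where i: "(\<integral>\<^sup>+x. norm (f x - s i x) \<partial>lborel) \<le> ennreal (e/3)"
      using approx e unfolding ennreal_tendsto_0_iff_le eventually_sequentially
      by (metis divide_pos_pos zero_less_numeral order_refl)
    have "eventually (\<lambda>n. (\<integral>\<^sup>+x. ennreal \<bar>s i (x + h n) - s i x\<bar> \<partial>lborel) \<le> ennreal (e/3)) sequentially"
      using lim(2)[of i] e unfolding ennreal_tendsto_0_iff_le by auto
    then show "eventually (\<lambda>n. (\<integral>\<^sup>+x. ennreal \<bar>f (x + h n) - f x\<bar> \<partial>lborel) \<le> ennreal e) sequentially"
    proof (rule eventually_mono)
      fix n assume n: "(\<integral>\<^sup>+x. ennreal \<bar>s i (x + h n) - s i x\<bar> \<partial>lborel) \<le> ennreal (e/3)"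
      have "(\<integral>\<^sup>+x. ennreal \<bar>f (x + h n) - f x\<bar> \<partial>lborel)
        \<le> (\<integral>\<^sup>+x. ennreal (norm (f (x + h n) - s i (x + h n))) + ennreal \<bar>s i (x + h n) - s i x\<bar> + ennreal (norm (f x - s i x)) \<partial>lborel)"
      proof (intro nn_integral_mono)
        fix x
        have "\<bar>f (x + h n) - f x\<bar> \<le> norm (f (x + h n) - s i (x + h n)) + \<bar>s i (x + h n) - s i x\<bar> + norm (f x - s i x)"
          unfolding real_norm_def by linarith
        then show "ennreal \<bar>f (x + h n) - f x\<bar> \<le> ennreal (norm (f (x + h n) - s i (x + h n))) + ennreal \<bar>s i (x + h n) - s i x\<bar> + ennreal (norm (f x - s i x))"
          by (simp add: ennreal_leI flip: ennreal_plus)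
      qed
      also have "\<dots> = (\<integral>\<^sup>+x. norm (f x - s i x) \<partial>lborel) + (\<integral>\<^sup>+x. ennreal \<bar>s i (x + h n) - s i x\<bar> \<partial>lborel) + (\<integral>\<^sup>+x. norm (f x - s i x) \<partial>lborel)"
        by (simp add: nn_integral_add shift[of "\<lambda>x. ennreal (norm (f x - s i x))", simplified])
      also have "\<dots> \<le> ennreal (e/3) + ennreal (e/3) + ennreal (e/3)"
        using i n by (intro add_mono) auto
      also have "\<dots> = ennreal e"
        using e by (simp flip: ennreal_plus)
      finally show "(\<integral>\<^sup>+x. ennreal \<bar>f (x + h n) - f x\<bar> \<partial>lborel) \<le> ennreal e" .
    qed
  qed
qed

subsection \<open>Convex sets of finite volume\<close>

text \<open>Positive volume gives an inner ball around some p. If P were unbounded, the convex hull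
  of this ball and a far point x would contain K disjoint balls of half the radius, for every K,
  which contradicts finite volume.\<close>

lemma bounded_convex_finite_measure:
  fixes P :: "'a::euclidean_space set"
  assumes P: "convex P" "closed P" and pos: "emeasure lborel P \<noteq> 0" and fin: "emeasure lborel P < \<infinity>"
  shows "bounded P"
proof (rule ccontr)
  assume unb: "\<not> bounded P"
  have [measurable]: "P \<in> sets borel" using P by auto
  have "interior P \<noteq> {}"
  proof
    assume "interior P = {}"
    then have "negligible P"
      using negligible_convex_frontier[OF P(1)] P(2) by (simp add: frontier_def)
    then show False
      using pos by (simp add: negligible_iff_null_sets null_sets_def emeasure_completion)
  qed
  then obtain p r where r: "r > 0" "ball p r \<subseteq> P"
    by (metis ex_in_conv mem_interior)
  define w where "w = Ball_Volume.unit_ball_vol (real DIM('a)) * (r/2) ^ DIM('a)"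
  have w: "w > 0" using r by (simp add: w_def)
  define V where "V = measure lborel P"
  have le: "real K * w \<le> V" for K
  proof -
    obtain x where x: "x \<in> P" "norm (x - p) > 2 * real K * r"
    proof -
      have "\<not> P \<subseteq> cball p (2 * real K * r)"
        using unb bounded_subset[OF bounded_cball] by blast
      then obtain x where "x \<in> P" "x \<notin> cball p (2 * real K * r)" by blast
      then show ?thesis
        using that[of x] by (simp add: dist_norm norm_minus_commute)
    qed
    \<comment> \<open>The centres occupy only the half of the segment next to p, so the hull still
      has at least half the width r there. As |x - p| > 2 K r, consecutive centres are more than r
      apart.\<close>
    define c where "c j = p + (real j / (2 * real K)) *\<^sub>R (x - p)" for j :: nat
    have sub: "ball (c j) (r/2) \<subseteq> P" if "j < K" for j
    proof
      fix y assume y: "y \<in> ball (c j) (r/2)"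
      define t where "t = real j / (2 * real K)"
      have t: "0 \<le> t" "t \<le> 1/2" using that by (auto simp: t_def field_simps)
      \<comment> \<open>The point of the ball around p for which y lies on the segment from q to x
        at parameter t.\<close>
      define q where "q = p + (1 / (1 - t)) *\<^sub>R (y - c j)"
      have "norm (y - c j) < r/2" using y by (simp add: dist_norm norm_minus_commute)
      also have "\<dots> \<le> r * (1 - t)" using t r by (simp add: field_simps)
      finally have "norm (y - c j) / (1 - t) < r" using t by (simp add: field_simps)
      then have "q \<in> ball p r"
        using t by (simp add: q_def dist_norm)
      moreover have "y = (1 - t) *\<^sub>R q + t *\<^sub>R x"
      proof -
        have "(1 - t) *\<^sub>R q = (1 - t) *\<^sub>R p + (y - c j)"
          using t by (simp add: q_def scaleR_add_right)
        moreover have "c j = p + t *\<^sub>R (x - p)"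
          by (simp add: c_def t_def)
        ultimately show ?thesis
          by (simp add: algebra_simps)
      qed
      ultimately show "y \<in> P"
        using x r t P(1) by (auto simp: convex_alt)
    qed
    have disj: "disjoint_family_on (\<lambda>j. ball (c j) (r/2)) {..<K}"
    proof (unfold disjoint_family_on_def, intro ballI impI)
      fix i j assume ij: "i \<in> {..<K}" "j \<in> {..<K}" "i \<noteq> j"
      have "c i - c j = ((real i - real j) / (2 * real K)) *\<^sub>R (x - p)"
        by (simp add: c_def algebra_simps diff_divide_distrib)
      then have "dist (c i) (c j) = \<bar>real i - real j\<bar> * (norm (x - p) / (2 * real K))"
        by (simp add: dist_norm)
      also have "\<dots> \<ge> 1 * r"
        using ij x(2) r(1) by (intro mult_mono) (auto simp: field_simps)
      finally have "dist (c i) (c j) \<ge> r" by simp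
      then show "ball (c i) (r/2) \<inter> ball (c j) (r/2) = {}"
        by (intro disjoint_ballI) auto
    qed
    have "real K * w = (\<Sum>j<K. measure lborel (ball (c j) (r/2)))"
      using r by (simp add: content_ball w_def)
    also have "\<dots> = measure lborel (\<Union>j<K. ball (c j) (r/2))"
      by (rule measure_finite_Union[symmetric]) (use disj r in \<open>auto simp: emeasure_ball\<close>)
    also have "\<dots> \<le> V"
      unfolding V_def by (rule measure_mono_fmeasurable) (use sub fin in \<open>auto simp: fmeasurable_def\<close>)
    finally show ?thesis .
  qed
  obtain K :: nat where "real K > V / w" using reals_Archimedean2 by blast
  then show False using le[of K] w by (simp add: field_simps)
qed

text \<open>The homothety with centre x and ratio r / R maps P into itself by convexity, and into
  the ball of radius r because P lies in the ball of radius R. This holds at boundary points as well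
  and is the source of the constant \<open>\<kappa>\<close>.\<close>

lemma emeasure_convex_Int_ball_ge:
  fixes P :: "'a::euclidean_space set"
  assumes "convex P" "closed P" "x \<in> P" "P \<subseteq> ball x R" "0 \<le> r" "r \<le> R"
  shows "ennreal ((r / R) ^ DIM('a)) * emeasure lborel P \<le> emeasure lborel (P \<inter> ball x r)"
proof (cases "r = 0")
  case False
  define t where "t = r / R"
  have R: "R > 0" and t: "0 < t" "t \<le> 1" using assms False by (auto simp: t_def field_simps)
  have [measurable]: "P \<in> sets borel" using assms by auto
  have "ennreal (t ^ DIM('a)) * emeasure lborel P = ennreal (t ^ DIM('a)) * (\<integral>\<^sup>+u. indicator P (x + u) \<partial>lborel)"
    using nn_integral_lborel_translation[of "indicator P" x] by simp
  also have "\<dots> \<le> ennreal (t ^ DIM('a)) * (\<integral>\<^sup>+u. indicator (P \<inter> ball x r) (x + t *\<^sub>R u) \<partial>lborel)"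
  proof (intro mult_left_mono nn_integral_mono)
    fix u
    have "x + t *\<^sub>R u \<in> P \<inter> ball x r" if u: "x + u \<in> P"
    proof -
      have "x + t *\<^sub>R u = (1 - t) *\<^sub>R x + t *\<^sub>R (x + u)" by (simp add: algebra_simps)
      then have "x + t *\<^sub>R u \<in> P"
        using u t assms(1,3) unfolding convex_alt by (metis less_imp_le)
      moreover have "norm u < R" using u assms(4) by (auto simp: dist_norm)
      ultimately show ?thesis
        using R False assms(5) by (auto simp: dist_norm t_def field_simps)
    qed
    then show "indicator P (x + u) \<le> (indicator (P \<inter> ball x r) (x + t *\<^sub>R u) :: ennreal)"
      by (auto simp: indicator_def)
  qed simp
  also have "\<dots> = emeasure lborel (P \<inter> ball x r)"
  proof -
    have "P \<inter> ball x r \<in> sets borel" by measurable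
    then show ?thesis
      using nn_integral_lborel_affine[OF borel_measurable_indicator t(1), of "P \<inter> ball x r" x] by simp
  qed
  finally show ?thesis by (simp add: t_def)
qed simp

subsection \<open>Empty regions and their volume\<close>

lemma Defs_unit_ball_vol_eq: "Defs.unit_ball_vol d = Ball_Volume.unit_ball_vol (real d)"
  by (simp add: Defs.unit_ball_vol_def Ball_Volume.unit_ball_vol_def add.commute)

text \<open>The region that the other points have to avoid in order for \<open>y\<close> to be the nearest neighbour
  of \<open>x\<close> (\<open>t = 0\<close>), respectively for \<open>x\<close> and \<open>y\<close> to be mutual nearest neighbours (\<open>t = 1\<close>).\<close>

definition zone :: "real \<Rightarrow> 'a::real_normed_vector \<Rightarrow> 'a \<Rightarrow> 'a set" where
  "zone t x y = ball x (dist x y) \<union> ball (x + t *\<^sub>R (y - x)) (dist x y)"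

definition zone_vol :: "'a::euclidean_space itself \<Rightarrow> real \<Rightarrow> real" where
  "zone_vol _ t = measure lborel (ball (0::'a) 1 \<union> ball (t *\<^sub>R (SOME b. b \<in> Basis)) 1)"

lemma zone_0: "zone 0 x y = ball x (dist x y)"
  and zone_1: "zone 1 x y = ball x (dist x y) \<union> ball y (dist x y)"
  by (simp_all add: zone_def)

lemma open_zone [simp]: "open (zone t x y)"
  by (simp add: zone_def open_Un)

lemma borel_zone [measurable, simp]: "zone t x (y::'a::euclidean_space) \<in> sets borel"
  by simp

lemma mem_zone_iff: "z \<in> zone t x y \<longleftrightarrow> dist x z < dist x y \<or> dist (x + t *\<^sub>R (y - x)) z < dist x y"
  by (simp add: zone_def)

lemma measurable_mem_zone [measurable (raw)]:
  fixes f g h :: "'b \<Rightarrow> 'a::euclidean_space"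
  assumes [measurable]: "f \<in> borel_measurable M" "g \<in> borel_measurable M" "h \<in> borel_measurable M"
  shows "Measurable.pred M (\<lambda>w. f w \<in> zone t (g w) (h w))"
  unfolding mem_zone_iff by measurable

lemma ball_subset_zone: "ball x (dist x y) \<subseteq> zone t x y"
  by (auto simp: zone_def)

lemma zone_subset_ball:
  assumes "0 \<le> t" "t \<le> 1"
  shows "zone t x y \<subseteq> ball x (2 * dist x y)"
proof -
  have "dist x z < 2 * dist x y" if "dist (x + t *\<^sub>R (y - x)) z < dist x y" for z
  proof -
    have "dist x z \<le> dist x (x + t *\<^sub>R (y - x)) + dist (x + t *\<^sub>R (y - x)) z" by (rule dist_triangle)
    also have "dist x (x + t *\<^sub>R (y - x)) = t * dist x y"
      using assms by (simp add: dist_norm norm_minus_commute)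
    also have "t * dist x y \<le> 1 * dist x y" using assms by (intro mult_right_mono) auto
    finally show ?thesis using that by simp
  qed
  moreover have "dist x z < 2 * dist x y" if "dist x z < dist x y" for z
    using that zero_le_dist[of x z] by linarith
  ultimately show ?thesis by (auto simp: zone_def)
qed

lemma zone_scale:
  assumes "h > 0"
  shows "x + h *\<^sub>R w \<in> zone t x (x + h *\<^sub>R u) \<longleftrightarrow> w \<in> zone t 0 u"
proof -
  have "x + t *\<^sub>R (x + h *\<^sub>R u - x) - (x + h *\<^sub>R w) = h *\<^sub>R (t *\<^sub>R u - w)"
    by (simp add: algebra_simps)
  then show ?thesis
    using assms by (simp add: mem_zone_iff dist_norm)
qed

lemma zone_self [simp]: "zone t x x = {}"
  by (simp add: zone_def)

lemma zone_vol_0: "zone_vol TYPE('a) 0 = Ball_Volume.unit_ball_vol (real DIM('a::euclidean_space))"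
  by (simp add: zone_vol_def content_ball)

lemma zone_vol_1: "zone_vol TYPE('a) 1 = two_ball_vol TYPE('a::euclidean_space)"
  by (simp add: zone_vol_def two_ball_vol_def)

lemma emeasure_two_balls_finite:
  "emeasure lborel (ball (x::'a::euclidean_space) r \<union> ball y s) < \<infinity>"
  by (rule emeasure_bounded_finite) auto

lemma zone_vol_pos: "zone_vol TYPE('a::euclidean_space) t > 0"
proof -
  have "0 < measure lborel (ball (0::'a) 1)"
    by (simp add: content_ball)
  also have "\<dots> \<le> zone_vol TYPE('a) t"
    unfolding zone_vol_def
    by (intro measure_mono_fmeasurable) (auto simp: fmeasurable_def emeasure_two_balls_finite[simplified])
  finally show ?thesis .
qed

text \<open>Translation and scaling bring the pair to 0 and a unit vector u; rotation then replaces
  u by the basis vector in \<open>zone_vol\<close>.\<close>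

lemma emeasure_zone:
  "emeasure lborel (zone t x (y::'a::euclidean_space)) = ennreal (zone_vol TYPE('a) t * dist x y ^ DIM('a))"
proof (cases "x = y")
  case False
  define r where "r = dist x y"
  define u where "u = (1 / r) *\<^sub>R (y - x)"
  define e :: 'a where "e = (SOME b. b \<in> Basis)"
  have e: "norm e = 1"
    unfolding e_def using someI_ex[of "\<lambda>b. b \<in> (Basis::'a set)"] nonempty_Basis by (auto intro: norm_Basis)
  have r: "r > 0" using False by (simp add: r_def)
  then have u: "norm u = 1" by (simp add: u_def r_def dist_norm norm_minus_commute)
  have y: "y = x + r *\<^sub>R u" using r by (simp add: u_def)
  have "zone t x y \<in> sets borel" by simp
  then have "emeasure lborel (zone t x y) = ennreal (r ^ DIM('a)) * (\<integral>\<^sup>+w. indicator (zone t x y) (x + r *\<^sub>R w) \<partial>lborel)"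
    using nn_integral_lborel_affine[OF borel_measurable_indicator r, of "zone t x y" x] by simp
  also have "(\<lambda>w. indicator (zone t x y) (x + r *\<^sub>R w) :: ennreal) = indicator (zone t 0 u)"
    by (auto simp: y zone_scale[OF r] fun_eq_iff split: split_indicator)
  also have "zone t 0 u = ball 0 1 \<union> ball (t *\<^sub>R u) 1"
    using u by (simp add: zone_def)
  also have "(\<integral>\<^sup>+w. indicator (ball 0 1 \<union> ball (t *\<^sub>R u) 1) w \<partial>lborel) = emeasure lborel (ball 0 1 \<union> ball (t *\<^sub>R e) 1)"
    using measure_two_balls_cong[of u e t] u e by simp
  also have "\<dots> = ennreal (zone_vol TYPE('a) t)"
    using emeasure_two_balls_finite by (subst emeasure_eq_ennreal_measure) (auto simp: zone_vol_def e_def less_top)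
  also have "ennreal (r ^ DIM('a)) * ennreal (zone_vol TYPE('a) t) = ennreal (zone_vol TYPE('a) t * dist x y ^ DIM('a))"
    by (simp add: r_def ennreal_mult less_imp_le[OF zone_vol_pos] mult.commute)
  finally show ?thesis .
qed (simp add: zero_power)

section \<open>The volume of two overlapping unit balls in dimensions one and two\<close>

lemma two_ball_vol_real: "two_ball_vol TYPE(real) = 3"
proof -
  have "(SOME b. b \<in> (Basis :: real set)) = 1"
    by simp
  moreover have "ball 0 1 \<union> ball 1 1 = {-1<..<2::real}"
    by (auto simp: dist_real_def)
  ultimately show ?thesis
    by (simp add: two_ball_vol_def)
qed

text \<open>The line x = 1/2 bisects the segment between the centres (0,0) and (1,0). This is the
  area of the part of the first unit disc on its own side of that line, half of the area of the
  union.\<close>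

lemma nn_integral_half_disc:
  "(\<integral>\<^sup>+x. ennreal (2 * sqrt (1 - x\<^sup>2)) * indicator {-1..1/2} x \<partial>lborel) = ennreal (2 * pi / 3 + sqrt 3 / 4)"
proof -
  define F where "F x = x * sqrt (1 - x\<^sup>2) + arcsin x" for x :: real
  have F_deriv: "(F has_real_derivative 2 * sqrt (1 - x\<^sup>2)) (at x)" if "x \<in> {-1<..<1/2}" for x
  proof -
    have "\<bar>x\<bar> < 1" using that by (auto simp: abs_less_iff)
    then have "x\<^sup>2 < 1" by (simp add: abs_square_less_1)
    then have pos: "sqrt (1 - x\<^sup>2) > 0" "sqrt (1 - x\<^sup>2) * sqrt (1 - x\<^sup>2) = 1 - x\<^sup>2" by simp_all
    have alg: "1 * s + (inverse s / 2 * (0 - 2 * x)) * x + inverse s = s + (1 - x\<^sup>2) / s" for s :: real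
      by (cases "s = 0") (simp_all add: field_simps power2_eq_square)
    have "(F has_real_derivative 1 * sqrt (1 - x\<^sup>2) + (inverse (sqrt (1 - x\<^sup>2)) / 2 * (0 - 2 * x)) * x + inverse (sqrt (1 - x\<^sup>2))) (at x)"
      unfolding F_def using that pos by (auto intro!: derivative_eq_intros)
    also have "1 * sqrt (1 - x\<^sup>2) + (inverse (sqrt (1 - x\<^sup>2)) / 2 * (0 - 2 * x)) * x + inverse (sqrt (1 - x\<^sup>2))
      = sqrt (1 - x\<^sup>2) + (1 - x\<^sup>2) / sqrt (1 - x\<^sup>2)"
      by (rule alg)
    also have "\<dots> = 2 * sqrt (1 - x\<^sup>2)"
      using pos by (metis mult_2 nonzero_mult_div_cancel_left less_irrefl)
    finally show ?thesis .
  qed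
  \<comment> \<open>Only interior derivatives are used, because arcsin is not differentiable at
    -1.\<close>
  have "((\<lambda>x. 2 * sqrt (1 - x\<^sup>2)) has_integral F (1/2) - F (-1)) {-1..1/2}"
  proof (rule fundamental_theorem_of_calculus_interior)
    show "continuous_on {-1..1/2} F"
      unfolding F_def by (intro continuous_intros) auto
  qed (use F_deriv in \<open>auto simp: has_real_derivative_iff_has_vector_derivative\<close>)
  moreover have "F (1/2) - F (-1) = 2 * pi / 3 + sqrt 3 / 4"
  proof -
    have "sqrt (1 - (1/2)\<^sup>2) = sqrt (3 / 4)" by (simp add: power2_eq_square)
    also have "\<dots> = sqrt 3 / 2" by (simp add: real_sqrt_divide)
    finally have "sqrt (1 - (1/2)\<^sup>2) = sqrt 3 / 2" .
    moreover have "arcsin (1/2) = pi / 6"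
      using arcsin_sin[of "pi/6"] by (simp add: sin_30)
    ultimately show ?thesis by (simp add: F_def)
  qed
  moreover have "2 * sqrt (1 - x\<^sup>2) \<ge> 0" if "x \<in> {-1..1/2}" for x :: real
    using that by (auto simp: abs_square_le_1 abs_le_iff)
  ultimately show ?thesis
    by (subst nn_integral_has_integral_lebesgue[symmetric, of "{-1..1/2}" "\<lambda>x. 2 * sqrt (1 - x\<^sup>2)"])
      (auto simp: nn_integral_completion intro!: nn_integral_cong split: split_indicator)
qed

lemma emeasure_interval_sq:
  "emeasure lborel {y::real. y\<^sup>2 < c} = ennreal (if c \<ge> 0 then 2 * sqrt c else 0)"
proof (cases "c \<ge> 0")
  case True
  then have "{y::real. y\<^sup>2 < c} = {- sqrt c<..<sqrt c}"
    by (auto simp: real_less_rsqrt abs_less_iff[symmetric] intro: real_sqrt_less_iff)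
       (metis abs_less_iff minus_less_iff real_sqrt_abs real_sqrt_less_iff)+
  then show ?thesis using True by simp
next
  case False
  then have "{y::real. y\<^sup>2 < c} = {}"
    by (auto simp: not_less intro: order_trans[OF _ zero_le_power2])
  then show ?thesis using False by simp
qed

text \<open>Vertical slices of the two discs are concentric intervals, so the longer one is the
  slice of the union. It belongs to the disc at the origin for x at most 1/2 and to the other disc
  beyond.\<close>

lemma emeasure_two_discs:
  "emeasure lborel (ball (0, 0) 1 \<union> ball (1, 0) 1 :: (real \<times> real) set) = ennreal (4 * pi / 3 + sqrt 3 / 2)"
proof -
  let ?A = "ball (0, 0) 1 \<union> ball (1, 0) 1 :: (real \<times> real) set"
  let ?g = "\<lambda>x::real. ennreal (2 * sqrt (1 - x\<^sup>2))"
  have [measurable]: "?A \<in> sets (lborel \<Otimes>\<^sub>M lborel)"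
    unfolding lborel_prod by simp
  have slice: "emeasure lborel (Pair x -` ?A) = ?g x * indicator {-1..1/2} x + ?g (x - 1) * indicator {1/2<..2} x" for x
  proof -
    have "Pair x -` ?A = {y. y\<^sup>2 < max (1 - x\<^sup>2) (1 - (x - 1)\<^sup>2)}"
      by (auto simp: dist_Pair_Pair dist_real_def less_max_iff_disj power2_commute[of 1 x])
    then have "emeasure lborel (Pair x -` ?A) = ennreal (if max (1 - x\<^sup>2) (1 - (x - 1)\<^sup>2) \<ge> 0 then 2 * sqrt (max (1 - x\<^sup>2) (1 - (x - 1)\<^sup>2)) else 0)"
      by (simp only: emeasure_interval_sq)
    moreover have le: "x \<le> 1/2 \<Longrightarrow> max (1 - x\<^sup>2) (1 - (x - 1)\<^sup>2) = 1 - x\<^sup>2"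
      and gt: "x > 1/2 \<Longrightarrow> max (1 - x\<^sup>2) (1 - (x - 1)\<^sup>2) = 1 - (x - 1)\<^sup>2"
      by (auto simp: max_def power2_eq_square algebra_simps)
    moreover have "x \<le> 1/2 \<Longrightarrow> 1 - x\<^sup>2 \<ge> 0 \<longleftrightarrow> -1 \<le> x" "x > 1/2 \<Longrightarrow> 1 - (x - 1)\<^sup>2 \<ge> 0 \<longleftrightarrow> x \<le> 2"
      by (auto simp: abs_square_le_1)
    ultimately show ?thesis
      by (cases "x \<le> 1/2") (auto split: split_indicator)
  qed
  have "emeasure lborel ?A = (\<integral>\<^sup>+x. emeasure lborel (Pair x -` ?A) \<partial>lborel)"
    unfolding lborel_prod[symmetric] by (rule lborel.emeasure_pair_measure_alt) measurable
  also have "\<dots> = (\<integral>\<^sup>+x. ?g x * indicator {-1..1/2} x \<partial>lborel) + (\<integral>\<^sup>+x. ?g (x - 1) * indicator {1/2<..2} x \<partial>lborel)"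
    unfolding slice by (rule nn_integral_add) auto
  \<comment> \<open>Reflection in the bisector exchanges the two discs; the resulting intervals then
    differ only at the null point 1/2.\<close>
  also have "(\<integral>\<^sup>+x. ?g (x - 1) * indicator {1/2<..2} x \<partial>lborel) = (\<integral>\<^sup>+x. ?g (- x) * indicator {1/2<..2} (1 - x) \<partial>lborel)"
    by (subst nn_integral_real_affine[where c="-1" and t=1]) auto
  also have "\<dots> = (\<integral>\<^sup>+x. ?g x * indicator {-1..1/2} x \<partial>lborel)"
  proof (rule nn_integral_cong_AE)
    show "AE x in lborel. ?g (- x) * indicator {1/2<..2} (1 - x) = ?g x * indicator {-1..1/2} x"
      using AE_lborel_singleton[of "1/2::real"] by eventually_elim (auto split: split_indicator)
  qed
  also have "(\<integral>\<^sup>+x. ?g x * indicator {-1..1/2} x \<partial>lborel) + (\<integral>\<^sup>+x. ?g x * indicator {-1..1/2} x \<partial>lborel) = ennreal (4 * pi / 3 + sqrt 3 / 2)"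
    unfolding nn_integral_half_disc by (simp flip: ennreal_plus)
  finally show ?thesis .
qed

text \<open>The area found in \<open>real \<times> real\<close> is carried over by
  \<open>measure_two_balls_cong\<close>.\<close>

lemma two_ball_vol_real2: "two_ball_vol TYPE(real^2) = (8 * pi + 3 * sqrt 3) / 6"
proof -
  define e :: "real^2" where "e = (SOME b. b \<in> Basis)"
  have e: "norm e = 1"
    unfolding e_def using someI_ex[of "\<lambda>b. b \<in> (Basis::(real^2) set)"] nonempty_Basis by (auto intro: norm_Basis)
  have "emeasure lborel (ball 0 1 \<union> ball e 1) = emeasure lborel (ball (0, 0) 1 \<union> ball (1, 0) 1 :: (real \<times> real) set)"
    using measure_two_balls_cong[of e "(1, 0) :: real \<times> real" 1] e by (simp add: norm_Pair zero_prod_def)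
  then show ?thesis
    by (simp add: two_ball_vol_def e_def[symmetric] measure_def emeasure_two_discs field_simps)
qed

subsection \<open>Independent samples\<close>

context prob_space
begin

text \<open>Once coordinate i is overwritten by y, the old coordinate is integrated over a
  probability measure and contributes the factor 1. This allows coordinates to be integrated out one
  at a time without splitting the index set of the product.\<close>

lemma nn_integral_PiM_resample:
  assumes I: "finite I" "i \<in> I" and F: "F \<in> borel_measurable (PiM I (\<lambda>_. M))"
  shows "(\<integral>\<^sup>+w. F w \<partial>PiM I (\<lambda>_. M)) = (\<integral>\<^sup>+w. (\<integral>\<^sup>+y. F (w(i := y)) \<partial>M) \<partial>PiM I (\<lambda>_. M))"
proof -
  interpret product_sigma_finite "\<lambda>_. M"
    by (simp add: product_sigma_finite_def sigma_finite_measure_axioms)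
  define J where "J = I - {i}"
  have J: "finite J" "i \<notin> J" and IJ: "I = insert i J"
    using I by (auto simp: J_def)
  have [measurable]: "F \<in> borel_measurable (PiM (insert i J) (\<lambda>_. M))"
    using F by (simp add: IJ)
  have [measurable]: "(\<lambda>p. (fst p)(i := snd p)) \<in> measurable (PiM (insert i J) (\<lambda>_. M) \<Otimes>\<^sub>M M) (PiM (insert i J) (\<lambda>_. M))"
    using measurable_add_dim[of i "insert i J" "\<lambda>_. M"] by (simp add: case_prod_beta')
  have "(\<integral>\<^sup>+w. (\<integral>\<^sup>+y. F (w(i := y)) \<partial>M) \<partial>PiM I (\<lambda>_. M))
    = (\<integral>\<^sup>+w. (\<integral>\<^sup>+z. (\<integral>\<^sup>+y. F ((w(i := z))(i := y)) \<partial>M) \<partial>M) \<partial>PiM J (\<lambda>_. M))"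
    unfolding IJ by (rule product_nn_integral_insert[OF J]) measurable
  also have "\<dots> = (\<integral>\<^sup>+w. (\<integral>\<^sup>+y. F (w(i := y)) \<partial>M) \<partial>PiM J (\<lambda>_. M))"
    by (simp add: emeasure_space_1)
  also have "\<dots> = (\<integral>\<^sup>+w. F w \<partial>PiM I (\<lambda>_. M))"
    unfolding IJ by (rule product_nn_integral_insert[OF J, symmetric]) measurable
  finally show ?thesis by simp
qed

lemma prob_space_PiM_iid: "prob_space (PiM I (\<lambda>_. M))"
  by (rule prob_space_PiM) (rule prob_space_axioms)

lemma nn_integral_PiM_component:
  assumes "finite I" "i \<in> I" and [measurable]: "g \<in> borel_measurable M"
  shows "(\<integral>\<^sup>+w. g (w i) \<partial>PiM I (\<lambda>_. M)) = (\<integral>\<^sup>+x. g x \<partial>M)"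
proof -
  interpret P: prob_space "PiM I (\<lambda>_. M)" by (rule prob_space_PiM_iid)
  show ?thesis
    using assms by (subst nn_integral_PiM_resample[of I i]) (auto simp: P.emeasure_space_1)
qed

text \<open>Conditionally on the coordinates outside \<open>B\<close>, the coordinates in \<open>B\<close> avoid \<open>S\<close> independently.\<close>

lemma nn_integral_PiM_avoid:
  fixes S :: "('i \<Rightarrow> 'a) \<Rightarrow> 'a set"
  assumes "finite B" "finite I" "B \<subseteq> I" and "g \<in> borel_measurable (PiM I (\<lambda>_. M))"
    and S [measurable]: "Measurable.pred (PiM I (\<lambda>_. M) \<Otimes>\<^sub>M M) (\<lambda>(w, z). z \<in> S w)"
    and "\<And>i w y. i \<in> B \<Longrightarrow> g (w(i := y)) = g w"
    and "\<And>i w y. i \<in> B \<Longrightarrow> S (w(i := y)) = S w"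
  shows "(\<integral>\<^sup>+w. g w * (\<Prod>k\<in>B. indicator (- S w) (w k)) \<partial>PiM I (\<lambda>_. M))
    = (\<integral>\<^sup>+w. g w * (\<integral>\<^sup>+z. indicator (- S w) z \<partial>M) ^ card B \<partial>PiM I (\<lambda>_. M))"
  using assms(1,3,4,6,7)
proof (induction B arbitrary: g rule: finite_induct)
  case (insert l B)
  note insert.prems(2) [measurable]
  define q where "q w = (\<integral>\<^sup>+z. indicator (- S w) z \<partial>M)" for w
  have ind: "(\<lambda>(w, z). indicator (- S w) z :: ennreal) \<in> borel_measurable (PiM I (\<lambda>_. M) \<Otimes>\<^sub>M M)"
  proof -
    have "(\<lambda>(w, z). indicator (- S w) z :: ennreal) = (\<lambda>p. if (\<lambda>(w, z). z \<in> S w) p then 0 else 1)"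
      by (auto simp: fun_eq_iff)
    also have "\<dots> \<in> borel_measurable (PiM I (\<lambda>_. M) \<Otimes>\<^sub>M M)"
      by measurable
    finally show ?thesis .
  qed
  have [measurable]: "q \<in> borel_measurable (PiM I (\<lambda>_. M))"
    unfolding q_def by (rule borel_measurable_nn_integral[OF ind])
  have ind_k [measurable]: "(\<lambda>w. indicator (- S w) (w k) :: ennreal) \<in> borel_measurable (PiM I (\<lambda>_. M))" if "k \<in> I" for k
    using measurable_compose[OF measurable_Pair[OF measurable_ident_sets[OF refl] measurable_component_singleton[OF that]] ind]
    by simp
  have prod_meas [measurable]: "(\<lambda>w. \<Prod>k\<in>C. indicator (- S w) (w k) :: ennreal) \<in> borel_measurable (PiM I (\<lambda>_. M))" if "C \<subseteq> I" for C
    using that by (intro borel_measurable_prod_ennreal ind_k) auto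
  have "(\<integral>\<^sup>+w. g w * (\<Prod>k\<in>insert l B. indicator (- S w) (w k)) \<partial>PiM I (\<lambda>_. M))
    = (\<integral>\<^sup>+w. (\<integral>\<^sup>+y. (\<lambda>w. g w * (\<Prod>k\<in>insert l B. indicator (- S w) (w k))) (w(l := y)) \<partial>M) \<partial>PiM I (\<lambda>_. M))"
    using insert.prems prod_meas[of "insert l B"] by (intro nn_integral_PiM_resample assms) auto
  also have "\<dots> = (\<integral>\<^sup>+w. (\<integral>\<^sup>+y. (g w * (\<Prod>k\<in>B. indicator (- S w) (w k))) * indicator (- S w) y \<partial>M) \<partial>PiM I (\<lambda>_. M))"
  proof (intro nn_integral_cong)
    fix w y
    have "(\<Prod>k\<in>B. indicator (- S w) ((w(l := y)) k)) = (\<Prod>k\<in>B. indicator (- S w) (w k) :: ennreal)"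
      using insert.hyps by (intro prod.cong) auto
    moreover have "g (w(l := y)) = g w" "S (w(l := y)) = S w"
      using insert.prems(3,4)[OF insertI1] by blast+
    ultimately show "(\<lambda>w. g w * (\<Prod>k\<in>insert l B. indicator (- S w) (w k))) (w(l := y))
      = (g w * (\<Prod>k\<in>B. indicator (- S w) (w k))) * indicator (- S w) y"
      by (simp only: prod.insert[OF insert.hyps] fun_upd_same) (simp only: mult_ac)
  qed
  also have "\<dots> = (\<integral>\<^sup>+w. (g w * (\<Prod>k\<in>B. indicator (- S w) (w k))) * q w \<partial>PiM I (\<lambda>_. M))"
  proof (intro nn_integral_cong)
    fix w assume "w \<in> space (PiM I (\<lambda>_. M))"
    then have "(\<lambda>y. indicator (- S w) y :: ennreal) \<in> borel_measurable M"
      using measurable_compose[OF measurable_Pair1' ind] by simp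
    then show "(\<integral>\<^sup>+y. (g w * (\<Prod>k\<in>B. indicator (- S w) (w k))) * indicator (- S w) y \<partial>M)
      = (g w * (\<Prod>k\<in>B. indicator (- S w) (w k))) * q w"
      unfolding q_def by (rule nn_integral_cmult)
  qed
  also have "\<dots> = (\<integral>\<^sup>+w. (g w * q w) * (\<Prod>k\<in>B. indicator (- S w) (w k)) \<partial>PiM I (\<lambda>_. M))"
    by (simp add: mult_ac)
  \<comment> \<open>The induction hypothesis is used with the factor q absorbed into g; the product
    still ignores the coordinates in B because S does.\<close>
  also have "\<dots> = (\<integral>\<^sup>+w. (g w * q w) * q w ^ card B \<partial>PiM I (\<lambda>_. M))"
  proof (rule insert.IH[of "\<lambda>w. g w * q w", folded q_def])
    show "g (w(i := y)) * q (w(i := y)) = g w * q w" if "i \<in> B" for i w y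
      unfolding q_def insert.prems(3)[OF insertI2[OF that]] insert.prems(4)[OF insertI2[OF that]] ..
    show "S (w(i := y)) = S w" if "i \<in> B" for i w y
      by (rule insert.prems(4)[OF insertI2[OF that]])
  qed (use insert.prems(1) in auto)
  finally show ?case
    using insert.hyps by (simp add: q_def mult_ac)
qed simp

end

subsection \<open>Moments of sums over pairs with an empty region\<close>

text \<open>Convexity of the support enters only through \<open>ball_ge\<close>, a lower bound on
  the mass of balls that is uniform up to the boundary of P. Keeping t as a parameter treats nearest
  neighbours and mutual nearest neighbours at once.\<close>

locale nn_density =
  fixes f :: "'a::euclidean_space \<Rightarrow> real" and P :: "'a set" and b \<kappa> t :: real
  assumes f_meas [measurable]: "f \<in> borel_measurable borel"
    and f_nonneg: "\<And>x. 0 \<le> f x" and f_le: "\<And>x. f x \<le> b"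
    and f_zero: "\<And>x. x \<notin> P \<Longrightarrow> f x = 0"
    and f_prob: "(\<integral>\<^sup>+x. ennreal (f x) \<partial>lborel) = 1"
    and kappa_pos: "\<kappa> > 0"
    and ball_ge: "\<And>x y. x \<in> P \<Longrightarrow> y \<in> P \<Longrightarrow>
      \<kappa> * dist x y ^ DIM('a) \<le> measure (density lborel (\<lambda>x. ennreal (f x))) (ball x (dist x y))"
    and t_range: "0 \<le> t" "t \<le> 1"
begin

definition mu :: "'a measure" where
  "mu = density lborel (\<lambda>x. ennreal (f x))"

lemma sets_mu [measurable_cong, simp]: "sets mu = sets borel"
  by (simp add: mu_def)

lemma space_mu [simp]: "space mu = UNIV"
  by (simp add: mu_def)

sublocale prob_space mu
  by (rule prob_spaceI) (simp add: mu_def emeasure_density f_prob)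

lemma nn_integral_mu:
  "g \<in> borel_measurable borel \<Longrightarrow> (\<integral>\<^sup>+x. g x \<partial>mu) = (\<integral>\<^sup>+x. ennreal (f x) * g x \<partial>lborel)"
  unfolding mu_def by (rule nn_integral_density) auto

lemma b_pos: "b > 0"
proof (rule ccontr)
  assume "\<not> b > 0"
  then have "f x = 0" for x using f_nonneg[of x] f_le[of x] by linarith
  then show False using f_prob by simp
qed

lemma AE_mu_P: "AE x in mu. x \<in> P"
proof -
  have "x \<in> P" if "f x > 0" for x using that f_zero[of x] by force
  then show ?thesis unfolding mu_def by (subst AE_density) (auto intro!: AE_I2)
qed

lemma nn_integral_mu_le:
  "g \<in> borel_measurable borel \<Longrightarrow> (\<integral>\<^sup>+x. g x \<partial>mu) \<le> ennreal b * (\<integral>\<^sup>+x. g x \<partial>lborel)"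
  by (subst nn_integral_mu, simp, subst nn_integral_cmult[symmetric])
     (auto intro!: nn_integral_mono mult_right_mono ennreal_leI f_le)

definition zp :: "'a \<Rightarrow> 'a \<Rightarrow> real" where
  "zp x y = measure mu (zone t x y)"

lemma zp_nonneg [simp]: "0 \<le> zp x y" and zp_le_1 [simp]: "zp x y \<le> 1"
  by (simp_all add: zp_def)

text \<open>Written as a parametrised integral, the probability is visibly measurable in x and y
  jointly.\<close>

lemma zp_eq: "zp x y = enn2real (\<integral>\<^sup>+z. indicator (zone t x y) z \<partial>mu)"
  by (simp add: zp_def measure_def)

lemma measurable_zp [measurable (raw)]:
  assumes [measurable]: "g \<in> borel_measurable N" "h \<in> borel_measurable N"
  shows "(\<lambda>w. zp (g w) (h w)) \<in> borel_measurable N"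
  unfolding zp_eq by measurable

lemma zp_ge: "x \<in> P \<Longrightarrow> y \<in> P \<Longrightarrow> \<kappa> * dist x y ^ DIM('a) \<le> zp x y"
  unfolding zp_def using ball_ge[of x y] finite_measure_mono[OF ball_subset_zone[of x y t]]
  by (simp add: mu_def)

lemma measure_mu_ball_le:
  "r \<ge> 0 \<Longrightarrow> emeasure mu (cball x r) \<le> ennreal (b * Ball_Volume.unit_ball_vol (real DIM('a)) * r ^ DIM('a))"
  using nn_integral_mu_le[of "indicator (cball x r)", OF borel_measurable_indicator] b_pos
  by (simp add: emeasure_cball ennreal_mult' mult.assoc)

text \<open>The factor \<open>10 = 2 * 5\<close> comes from bounding a union of two regions below by the mean of the two
  and from \<open>n - 4 \<ge> n / 5\<close> for \<open>n \<ge> 5\<close>.\<close>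

definition c :: real where "c = \<kappa> / 10"

lemma c_pos: "c > 0" using kappa_pos by (simp add: c_def)

text \<open>The dominating kernel of all crude estimates: the edge weight times an exponential bound
  on the emptiness probability. It is symmetric in x and y, unlike the region for t = 0.\<close>

definition Psi :: "real \<Rightarrow> nat \<Rightarrow> 'a \<Rightarrow> 'a \<Rightarrow> real" where
  "Psi \<gamma> n x y = dist x y powr \<gamma> * exp (- (c * real n) * dist x y ^ DIM('a))"

definition K :: "real \<Rightarrow> real" where
  "K \<gamma> = b * (Ball_Volume.unit_ball_vol (real DIM('a)) * (c powr (-1 - \<gamma> / DIM('a)) * Gamma (1 + \<gamma> / DIM('a))))"

lemma K_nonneg: "\<gamma> \<ge> 0 \<Longrightarrow> K \<gamma> \<ge> 0"
proof -
  assume "\<gamma> \<ge> 0"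
  then have "1 + \<gamma> / DIM('a) > 0" by (simp add: add_pos_nonneg)
  then show ?thesis using b_pos by (auto simp: K_def intro!: mult_nonneg_nonneg Gamma_real_nonneg less_imp_le[OF Gamma_real_pos])
qed

lemma Psi_nonneg [simp]: "0 \<le> Psi \<gamma> n x y"
  by (simp add: Psi_def)

lemma Psi_commute: "Psi \<gamma> n x y = Psi \<gamma> n y x"
  by (simp add: Psi_def dist_commute)

lemma measurable_Psi [measurable (raw)]:
  assumes [measurable]: "g \<in> borel_measurable N" "h \<in> borel_measurable N"
  shows "(\<lambda>w. Psi \<gamma> n (g w) (h w)) \<in> borel_measurable N"
  unfolding Psi_def by measurable

text \<open>The bound f \<le> b reduces this to a radial Gamma integral. The estimate is uniform in
  x, so in a product of kernels one free endpoint after another can be integrated out, each at the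
  cost of a factor of order n^(-1-\<gamma>/d).\<close>

lemma Psi_int:
  assumes "\<gamma> \<ge> 0" "n > 0"
  shows "(\<integral>\<^sup>+y. ennreal (Psi \<gamma> n x y) \<partial>mu) \<le> ennreal (K \<gamma> * real n powr (-1 - \<gamma> / DIM('a)))"
proof -
  have "(\<integral>\<^sup>+y. ennreal (Psi \<gamma> n x y) \<partial>mu) \<le> ennreal b * (\<integral>\<^sup>+y. ennreal (Psi \<gamma> n x y) \<partial>lborel)"
    by (rule nn_integral_mu_le) measurable
  also have "(\<integral>\<^sup>+y. ennreal (Psi \<gamma> n x y) \<partial>lborel) = (\<integral>\<^sup>+y. ennreal (Psi \<gamma> n x (x + y)) \<partial>lborel)"
    by (rule nn_integral_lborel_translation[symmetric]) measurable
  also have "\<dots> = (\<integral>\<^sup>+u. ennreal (norm u powr \<gamma> * exp (- (c * real n) * norm u ^ DIM('a))) \<partial>(lborel :: 'a measure))"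
    by (simp add: Psi_def dist_norm)
  also have "\<dots> = ennreal (Ball_Volume.unit_ball_vol (real DIM('a)) * ((c * real n) powr (-1 - \<gamma> / DIM('a)) * Gamma (1 + \<gamma> / DIM('a))))"
    using assms c_pos by (intro nn_integral_powr_exp_norm) auto
  also have "ennreal b * \<dots> = ennreal (K \<gamma> * real n powr (-1 - \<gamma> / DIM('a)))"
    using b_pos c_pos by (simp add: K_def powr_mult mult_ac flip: ennreal_mult')
  finally show ?thesis .
qed

definition pterm :: "real \<Rightarrow> nat \<Rightarrow> nat \<Rightarrow> nat \<Rightarrow> (nat \<Rightarrow> 'a) \<Rightarrow> real" where
  "pterm \<alpha> n i j w = dist (w i) (w j) powr \<alpha> * (\<Prod>m\<in>{..<n} - {i, j}. indicator (- zone t (w i) (w j)) (w m))"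

abbreviation PM :: "nat \<Rightarrow> (nat \<Rightarrow> 'a) measure" where
  "PM n \<equiv> PiM {..<n} (\<lambda>_. mu)"

lemma component_borel: "i < n \<Longrightarrow> (\<lambda>w. w i) \<in> borel_measurable (PM n)"
  using measurable_component_singleton[of i "{..<n}" "\<lambda>_. mu"]
  by (simp add: measurable_cong_sets[OF refl sets_mu])

lemma pterm_measurable [measurable]:
  assumes ij: "i < n" "j < n"
  shows "pterm \<alpha> n i j \<in> borel_measurable (PM n)"
proof -
  note [measurable] = component_borel[OF ij(1)] component_borel[OF ij(2)]
  have "(\<lambda>w. indicator (- zone t (w i) (w j)) (w m) :: real) \<in> borel_measurable (PM n)" if m: "m < n" for m
  proof -
    note [measurable] = component_borel[OF m]
    have "(\<lambda>w. indicator (- zone t (w i) (w j)) (w m) :: real) = (\<lambda>w. if w m \<in> zone t (w i) (w j) then 0 else 1)"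
      by (auto simp: fun_eq_iff)
    also have "\<dots> \<in> borel_measurable (PM n)" by measurable
    finally show ?thesis .
  qed
  then have "(\<lambda>w. \<Prod>m\<in>{..<n} - {i, j}. indicator (- zone t (w i) (w j)) (w m) :: real) \<in> borel_measurable (PM n)"
    by (intro borel_measurable_prod) auto
  then show ?thesis unfolding pterm_def[abs_def] by measurable
qed

lemma pterm_nonneg: "0 \<le> pterm \<alpha> n i j w"
  by (auto simp: pterm_def intro!: mult_nonneg_nonneg prod_nonneg)

lemma compl_prob:
  assumes [measurable]: "A \<in> sets borel"
  shows "(\<integral>\<^sup>+z. indicator (- A) z \<partial>mu) = ennreal (1 - measure mu A)"
proof -
  have "(\<integral>\<^sup>+z. indicator (- A) z \<partial>mu) = emeasure mu (space mu - A)"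
    by (subst nn_integral_indicator) (auto simp: Compl_eq_Diff_UNIV)
  also have "\<dots> = ennreal (1 - measure mu A)"
    using prob_compl[of A] by (subst emeasure_eq_measure) simp
  finally show ?thesis .
qed

lemma nn_integral_PM_pair:
  assumes ij: "i < n" "j < n" "i \<noteq> j" and [measurable]: "(\<lambda>(x, y). g x y) \<in> borel_measurable (borel \<Otimes>\<^sub>M borel)"
  shows "(\<integral>\<^sup>+w. g (w i) (w j) \<partial>PM n) = (\<integral>\<^sup>+x. (\<integral>\<^sup>+y. g x y \<partial>mu) \<partial>mu)"
proof -
  note [measurable] = component_borel[OF ij(1)] component_borel[OF ij(2)]
  have "(\<integral>\<^sup>+w. g (w i) (w j) \<partial>PM n) = (\<integral>\<^sup>+w. (\<integral>\<^sup>+y. g (w i) y \<partial>mu) \<partial>PM n)"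
    using ij by (subst nn_integral_PiM_resample[of _ j]) auto
  also have "\<dots> = (\<integral>\<^sup>+x. (\<integral>\<^sup>+y. g x y \<partial>mu) \<partial>mu)"
    using ij by (intro nn_integral_PiM_component) auto
  finally show ?thesis .
qed

text \<open>Given the two endpoints, the remaining n - 2 points avoid their region independently of
  each other.\<close>

lemma pterm_expectation:
  assumes ij: "i < n" "j < n" "i \<noteq> j"
  shows "(\<integral>\<^sup>+w. ennreal (pterm \<alpha> n i j w) \<partial>PM n)
    = (\<integral>\<^sup>+x. (\<integral>\<^sup>+y. ennreal (dist x y powr \<alpha> * (1 - zp x y) ^ (n - 2)) \<partial>mu) \<partial>mu)"
proof -
  note [measurable] = component_borel[OF ij(1)] component_borel[OF ij(2)]
  have "(\<integral>\<^sup>+w. ennreal (pterm \<alpha> n i j w) \<partial>PM n)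
    = (\<integral>\<^sup>+w. ennreal (dist (w i) (w j) powr \<alpha>) * (\<Prod>m\<in>{..<n} - {i, j}. indicator (- zone t (w i) (w j)) (w m)) \<partial>PM n)"
    by (simp add: pterm_def ennreal_mult prod_nonneg ennreal_indicator prod_ennreal[symmetric])
  also have "\<dots> = (\<integral>\<^sup>+w. ennreal (dist (w i) (w j) powr \<alpha>) * (\<integral>\<^sup>+z. indicator (- zone t (w i) (w j)) z \<partial>mu) ^ card ({..<n} - {i, j}) \<partial>PM n)"
    by (rule nn_integral_PiM_avoid) (auto split: prod.splits)
  also have "\<dots> = (\<integral>\<^sup>+w. ennreal (dist (w i) (w j) powr \<alpha> * (1 - zp (w i) (w j)) ^ (n - 2)) \<partial>PM n)"
    unfolding compl_prob[OF borel_zone] zp_def[symmetric]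
    using ij by (simp add: ennreal_power ennreal_mult card_Diff_subset numeral_2_eq_2)
  also have "\<dots> = (\<integral>\<^sup>+x. (\<integral>\<^sup>+y. ennreal (dist x y powr \<alpha> * (1 - zp x y) ^ (n - 2)) \<partial>mu) \<partial>mu)"
    by (intro nn_integral_PM_pair ij) measurable
  finally show ?thesis .
qed

definition zp2 :: "'a \<Rightarrow> 'a \<Rightarrow> 'a \<Rightarrow> 'a \<Rightarrow> real" where
  "zp2 x y x' y' = measure mu (zone t x y \<union> zone t x' y')"

lemma zp2_eq: "zp2 x y x' y' = enn2real (\<integral>\<^sup>+z. indicator (zone t x y \<union> zone t x' y') z \<partial>mu)"
  by (simp add: zp2_def measure_def)

lemma measurable_zp2 [measurable (raw)]:
  assumes [measurable]: "g \<in> borel_measurable N" "h \<in> borel_measurable N" "g' \<in> borel_measurable N" "h' \<in> borel_measurable N"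
  shows "(\<lambda>w. zp2 (g w) (h w) (g' w) (h' w)) \<in> borel_measurable N"
  unfolding zp2_eq by measurable

text \<open>All points other than the four endpoints have to avoid both regions, hence their union;
  constraints on endpoints of the other pair are discarded. Then 1 - p \<le> exp(-p) is
  applied.\<close>

lemma pterm_mult_expectation_le:
  assumes ij: "i < n" "j < n" "k < n" "l < n"
  shows "(\<integral>\<^sup>+w. ennreal (pterm \<alpha> n i j w * pterm \<alpha> n k l w) \<partial>PM n)
    \<le> (\<integral>\<^sup>+w. ennreal (dist (w i) (w j) powr \<alpha> * dist (w k) (w l) powr \<alpha> * exp (- real (n - 4) * zp2 (w i) (w j) (w k) (w l))) \<partial>PM n)"
proof -
  note [measurable] = component_borel[OF ij(1)] component_borel[OF ij(2)] component_borel[OF ij(3)] component_borel[OF ij(4)]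
  \<comment> \<open>The four indices may coincide, so B has at least n - 4 elements, which covers
    all overlap patterns at once.\<close>
  define B where "B = {..<n} - {i, j, k, l}"
  have "card {i, j, k, l} \<le> 4" using card_length[of "[i, j, k, l]"] by simp
  then have B: "n - 4 \<le> card B" "finite B" "B \<subseteq> {..<n}"
    using ij by (auto simp: B_def card_Diff_subset)
  let ?S = "\<lambda>w::nat \<Rightarrow> 'a. zone t (w i) (w j) \<union> zone t (w k) (w l)"
  let ?g = "\<lambda>w::nat \<Rightarrow> 'a. ennreal (dist (w i) (w j) powr \<alpha> * dist (w k) (w l) powr \<alpha>)"
  have "(\<integral>\<^sup>+w. ennreal (pterm \<alpha> n i j w * pterm \<alpha> n k l w) \<partial>PM n)
    \<le> (\<integral>\<^sup>+w. ?g w * (\<Prod>m\<in>B. indicator (- ?S w) (w m)) \<partial>PM n)"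
  proof (intro nn_integral_mono)
    fix w
    have prod_le: "(\<Prod>m\<in>{..<n} - {i, j}. indicator (- zone t (w i) (w j)) (w m)) * (\<Prod>m\<in>{..<n} - {k, l}. indicator (- zone t (w k) (w l)) (w m))
      \<le> (\<Prod>m\<in>B. indicator (- ?S w) (w m) :: real)"
    proof -
      have mono: "(\<Prod>m\<in>A. indicator (- Z) (w m) :: real) \<le> (\<Prod>m\<in>B. indicator (- Z) (w m))" if "finite A" "B \<subseteq> A" for A and Z :: "'a set"
      proof -
        have "(\<Prod>m\<in>A. indicator (- Z) (w m) :: real) = (\<Prod>m\<in>B. indicator (- Z) (w m)) * (\<Prod>m\<in>A - B. indicator (- Z) (w m))"
          using that by (metis mult.commute prod.subset_diff)
        also have "\<dots> \<le> (\<Prod>m\<in>B. indicator (- Z) (w m)) * 1"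
          by (intro mult_left_mono prod_le_1 prod_nonneg) (auto simp: indicator_def)
        finally show ?thesis by simp
      qed
      have "(\<Prod>m\<in>{..<n} - {i, j}. indicator (- zone t (w i) (w j)) (w m)) * (\<Prod>m\<in>{..<n} - {k, l}. indicator (- zone t (w k) (w l)) (w m))
        \<le> (\<Prod>m\<in>B. indicator (- zone t (w i) (w j)) (w m) :: real) * (\<Prod>m\<in>B. indicator (- zone t (w k) (w l)) (w m))"
        by (intro mult_mono mono prod_nonneg) (auto simp: B_def)
      also have "\<dots> = (\<Prod>m\<in>B. indicator (- ?S w) (w m))"
        unfolding prod.distrib[symmetric] by (intro prod.cong) (auto simp: indicator_def)
      finally show ?thesis .
    qed
    have "pterm \<alpha> n i j w * pterm \<alpha> n k l w \<le> dist (w i) (w j) powr \<alpha> * dist (w k) (w l) powr \<alpha> * (\<Prod>m\<in>B. indicator (- ?S w) (w m))"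
      using mult_left_mono[OF prod_le, of "dist (w i) (w j) powr \<alpha> * dist (w k) (w l) powr \<alpha>"]
      by (simp add: pterm_def mult_ac)
    then show "ennreal (pterm \<alpha> n i j w * pterm \<alpha> n k l w) \<le> ?g w * (\<Prod>m\<in>B. indicator (- ?S w) (w m))"
      by (simp add: ennreal_indicator[symmetric] prod_ennreal ennreal_mult'[symmetric] ennreal_leI)
  qed
  also have "\<dots> = (\<integral>\<^sup>+w. ?g w * (\<integral>\<^sup>+z. indicator (- ?S w) z \<partial>mu) ^ card B \<partial>PM n)"
    by (rule nn_integral_PiM_avoid) (use B in \<open>auto simp: B_def split: prod.splits\<close>)
  also have "\<dots> \<le> (\<integral>\<^sup>+w. ennreal (dist (w i) (w j) powr \<alpha> * dist (w k) (w l) powr \<alpha> * exp (- real (n - 4) * zp2 (w i) (w j) (w k) (w l))) \<partial>PM n)"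
  proof (intro nn_integral_mono)
    fix w
    let ?p = "zp2 (w i) (w j) (w k) (w l)"
    have p: "0 \<le> ?p" "?p \<le> 1" by (simp_all add: zp2_def)
    have "(1 - ?p) ^ card B \<le> (1 - ?p) ^ (n - 4)"
      using p B by (intro power_decreasing) auto
    also have "\<dots> \<le> exp (- ?p) ^ (n - 4)"
      using p exp_ge_add_one_self[of "- ?p"] by (intro power_mono) auto
    also have "\<dots> = exp (- real (n - 4) * ?p)"
      by (simp flip: exp_of_nat_mult)
    finally have "(1 - ?p) ^ card B \<le> exp (- real (n - 4) * ?p)" .
    then show "?g w * (\<integral>\<^sup>+z. indicator (- ?S w) z \<partial>mu) ^ card B \<le> ennreal (dist (w i) (w j) powr \<alpha> * dist (w k) (w l) powr \<alpha> * exp (- real (n - 4) * ?p))"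
      using p by (subst compl_prob) (auto simp: zp2_def[symmetric] ennreal_power ennreal_mult'[symmetric] intro!: ennreal_leI mult_left_mono)
  qed
  finally show ?thesis .
qed

lemma finite_measure_mono_Un: "zp x y \<le> zp2 x y x' y'" "zp x' y' \<le> zp2 x y x' y'"
  by (auto simp: zp_def zp2_def intro!: finite_measure_mono)

lemma exp_zp2_le_Psi:
  assumes P: "x \<in> P" "y \<in> P" "x' \<in> P" "y' \<in> P" and n: "n \<ge> 5"
  shows "dist x y powr \<alpha> * dist x' y' powr \<alpha> * exp (- real (n - 4) * zp2 x y x' y') \<le> Psi \<alpha> n x y * Psi \<alpha> n x' y'"
proof -
  let ?r = "dist x y ^ DIM('a)" and ?r' = "dist x' y' ^ DIM('a)"
  have "\<kappa> * ?r \<le> zp2 x y x' y'" "\<kappa> * ?r' \<le> zp2 x y x' y'"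
    using zp_ge[OF P(1,2)] zp_ge[OF P(3,4)] finite_measure_mono_Un(1)[of x y x' y'] finite_measure_mono_Un(2)[of x' y' x y] by linarith+
  then have *: "5 * c * (?r + ?r') \<le> zp2 x y x' y'"
    by (simp add: c_def algebra_simps)
  have "c * real n * (?r + ?r') = real n / 5 * (5 * c * (?r + ?r'))"
    by simp
  also have "\<dots> \<le> real (n - 4) * zp2 x y x' y'"
    using n * c_pos by (intro mult_mono) (auto simp: of_nat_diff intro!: mult_nonneg_nonneg)
  finally have "exp (- real (n - 4) * zp2 x y x' y') \<le> exp (- (c * real n) * ?r) * exp (- (c * real n) * ?r')"
    by (simp add: algebra_simps flip: exp_add)
  then have "dist x y powr \<alpha> * dist x' y' powr \<alpha> * exp (- real (n - 4) * zp2 x y x' y')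
    \<le> dist x y powr \<alpha> * dist x' y' powr \<alpha> * (exp (- (c * real n) * ?r) * exp (- (c * real n) * ?r'))"
    by (intro mult_left_mono) auto
  then show ?thesis
    by (simp add: Psi_def mult_ac)
qed

lemma AE_PM_P: "AE w in PM n. \<forall>i<n. w i \<in> P"
  using AE_PiM_component[of "{..<n}" "\<lambda>_. mu" _ "\<lambda>x. x \<in> P"] prob_space_axioms AE_mu_P
  by (subst AE_all_countable[of "\<lambda>i w. i < n \<longrightarrow> w i \<in> P", simplified]) auto

lemma pterm_mult_le_Psi:
  assumes ij: "i < n" "j < n" "k < n" "l < n" and n: "n \<ge> 5"
  shows "(\<integral>\<^sup>+w. ennreal (pterm \<alpha> n i j w * pterm \<alpha> n k l w) \<partial>PM n)
    \<le> (\<integral>\<^sup>+w. ennreal (Psi \<alpha> n (w i) (w j)) * ennreal (Psi \<alpha> n (w k) (w l)) \<partial>PM n)"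
proof (rule order_trans[OF pterm_mult_expectation_le[OF ij]], rule nn_integral_mono_AE)
  show "AE w in PM n. ennreal (dist (w i) (w j) powr \<alpha> * dist (w k) (w l) powr \<alpha> * exp (- real (n - 4) * zp2 (w i) (w j) (w k) (w l)))
    \<le> ennreal (Psi \<alpha> n (w i) (w j)) * ennreal (Psi \<alpha> n (w k) (w l))"
    using AE_PM_P[of n]
    by eventually_elim
      (subst ennreal_mult'[symmetric], simp, intro ennreal_leI exp_zp2_le_Psi, use ij n in auto)
qed

lemma borel_measurable_mu_Psi [simp]: "(\<lambda>y. ennreal (Psi \<alpha> n x y)) \<in> borel_measurable mu"
  by (rule measurable_compose[OF measurable_Psi measurable_ennreal]) (auto intro: measurable_ident_sets)

lemma Psi_int2:
  assumes "\<gamma> \<ge> 0" "n > 0"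
  shows "(\<integral>\<^sup>+x. (\<integral>\<^sup>+y. ennreal (Psi \<gamma> n x y) \<partial>mu) \<partial>mu) \<le> ennreal (K \<gamma> * real n powr (-1 - \<gamma> / DIM('a)))"
proof -
  have "(\<integral>\<^sup>+x. (\<integral>\<^sup>+y. ennreal (Psi \<gamma> n x y) \<partial>mu) \<partial>mu) \<le> (\<integral>\<^sup>+x. ennreal (K \<gamma> * real n powr (-1 - \<gamma> / DIM('a))) \<partial>mu)"
    by (intro nn_integral_mono Psi_int assms)
  then show ?thesis
    using emeasure_space_1 by simp
qed

text \<open>Two pairs sharing one index: the free endpoint l is integrated out first, then the
  remaining pair. There are of order n^3 such quadruples, so with the squared normalisation
  n^(2\<alpha>/d-2) they contribute O(1/n).\<close>

lemma nn_integral_PM_Psi_star: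
  assumes ij: "i < n" "j < n" "l < n" "i \<noteq> j" "l \<noteq> i" "l \<noteq> j" and \<alpha>: "\<alpha> \<ge> 0"
  shows "(\<integral>\<^sup>+w. ennreal (Psi \<alpha> n (w i) (w j)) * ennreal (Psi \<alpha> n (w i) (w l)) \<partial>PM n)
    \<le> ennreal ((K \<alpha>)\<^sup>2 * real n powr (-2 - 2 * \<alpha> / DIM('a)))"
proof -
  note [measurable] = component_borel[OF ij(1)] component_borel[OF ij(2)] component_borel[OF ij(3)]
  let ?k = "ennreal (K \<alpha> * real n powr (-1 - \<alpha> / DIM('a)))"
  have "(\<integral>\<^sup>+w. ennreal (Psi \<alpha> n (w i) (w j)) * ennreal (Psi \<alpha> n (w i) (w l)) \<partial>PM n)
    = (\<integral>\<^sup>+w. ennreal (Psi \<alpha> n (w i) (w j)) * (\<integral>\<^sup>+y. ennreal (Psi \<alpha> n (w i) y) \<partial>mu) \<partial>PM n)"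
    using ij by (subst nn_integral_PiM_resample[of _ l]) (auto simp: nn_integral_cmult)
  also have "\<dots> \<le> (\<integral>\<^sup>+w. ennreal (Psi \<alpha> n (w i) (w j)) * ?k \<partial>PM n)"
    using ij \<alpha> by (intro nn_integral_mono mult_left_mono Psi_int) auto
  also have "\<dots> = (\<integral>\<^sup>+x. (\<integral>\<^sup>+y. ennreal (Psi \<alpha> n x y) \<partial>mu) \<partial>mu) * ?k"
    using ij by (simp add: nn_integral_multc nn_integral_PM_pair[of i n j "\<lambda>x y. ennreal (Psi \<alpha> n x y)"])
  also have "\<dots> \<le> ?k * ?k"
    using ij \<alpha> by (intro mult_right_mono Psi_int2) auto
  also have "\<dots> = ennreal ((K \<alpha>)\<^sup>2 * real n powr (-2 - 2 * \<alpha> / DIM('a)))"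
  proof -
    have "real n powr (-1 - \<alpha> / DIM('a)) * real n powr (-1 - \<alpha> / DIM('a)) = real n powr (-2 - 2 * \<alpha> / DIM('a))"
      by (simp flip: powr_add)
    then show ?thesis
      by (simp add: K_nonneg \<alpha> power2_eq_square mult_ac flip: ennreal_mult')
  qed
  finally show ?thesis .
qed

text \<open>Two equal pairs: dropping one exponential factor leaves the kernel with exponent
  2\<alpha>. Of order n^2 such quadruples contribute O(1/n) after normalisation.\<close>

lemma nn_integral_PM_Psi_square:
  assumes ij: "i < n" "j < n" "i \<noteq> j" and \<alpha>: "\<alpha> \<ge> 0"
  shows "(\<integral>\<^sup>+w. ennreal (Psi \<alpha> n (w i) (w j)) * ennreal (Psi \<alpha> n (w i) (w j)) \<partial>PM n)
    \<le> ennreal (K (2 * \<alpha>) * real n powr (-1 - 2 * \<alpha> / DIM('a)))"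
proof -
  note [measurable] = component_borel[OF ij(1)] component_borel[OF ij(2)]
  have "Psi \<alpha> n x y * Psi \<alpha> n x y \<le> Psi (2 * \<alpha>) n x y" for x y
  proof -
    have "exp (- (c * real n) * dist x y ^ DIM('a)) \<le> 1"
      using c_pos by simp
    then have "Psi (2 * \<alpha>) n x y * exp (- (c * real n) * dist x y ^ DIM('a)) \<le> Psi (2 * \<alpha>) n x y * 1"
      by (intro mult_left_mono) auto
    moreover have "dist x y powr \<alpha> * dist x y powr \<alpha> = dist x y powr (2 * \<alpha>)"
      by (simp flip: powr_add)
    moreover have "Psi \<alpha> n x y * Psi \<alpha> n x y = (dist x y powr \<alpha> * dist x y powr \<alpha>) *
        exp (- (c * real n) * dist x y ^ DIM('a)) * exp (- (c * real n) * dist x y ^ DIM('a))"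
      by (simp only: Psi_def mult_ac)
    ultimately show ?thesis
      by (simp only: Psi_def mult_1_right)
  qed
  then have "(\<integral>\<^sup>+w. ennreal (Psi \<alpha> n (w i) (w j)) * ennreal (Psi \<alpha> n (w i) (w j)) \<partial>PM n)
    \<le> (\<integral>\<^sup>+w. ennreal (Psi (2 * \<alpha>) n (w i) (w j)) \<partial>PM n)"
    by (intro nn_integral_mono) (simp add: ennreal_leI flip: ennreal_mult')
  also have "\<dots> = (\<integral>\<^sup>+x. (\<integral>\<^sup>+y. ennreal (Psi (2 * \<alpha>) n x y) \<partial>mu) \<partial>mu)"
    by (intro nn_integral_PM_pair ij) measurable
  also have "\<dots> \<le> ennreal (K (2 * \<alpha>) * real n powr (-1 - 2 * \<alpha> / DIM('a)))"
    using Psi_int2[of "2 * \<alpha>" n] ij \<alpha> by simp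
  finally show ?thesis .
qed

definition K_near :: "real \<Rightarrow> real" where
  "K_near \<alpha> = K \<alpha> * (b * Ball_Volume.unit_ball_vol (real DIM('a)) * 4 ^ DIM('a)) * K (\<alpha> + DIM('a))"

text \<open>Confining the point k to a ball of radius 4r around the point i, where r is the length
  of the pair (i, j), costs a factor of order r^d, that is 1/n on average. This compensates for
  there being n^4 quadruples of distinct indices.\<close>

lemma nn_integral_PM_Psi_near:
  assumes ij: "i < n" "j < n" "k < n" "l < n" "distinct [i, j, k, l]" and \<alpha>: "\<alpha> \<ge> 0"
  shows "(\<integral>\<^sup>+w. indicator {p. dist (fst p) (snd p) \<le> 4 * dist (w i) (w j)} (w i, w k) *
      (ennreal (Psi \<alpha> n (w i) (w j)) * ennreal (Psi \<alpha> n (w k) (w l))) \<partial>PM n)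
    \<le> ennreal (K_near \<alpha> * real n powr (-3 - 2 * \<alpha> / DIM('a)))" (is "?L \<le> _")
proof -
  note [measurable] = component_borel[OF ij(1)] component_borel[OF ij(2)] component_borel[OF ij(3)] component_borel[OF ij(4)]
  let ?k = "ennreal (K \<alpha> * real n powr (-1 - \<alpha> / DIM('a)))"
  let ?v = "b * Ball_Volume.unit_ball_vol (real DIM('a)) * 4 ^ DIM('a)"
  let ?C = "\<lambda>w::nat \<Rightarrow> 'a. \<lambda>z. indicator (cball (w i) (4 * dist (w i) (w j))) z :: ennreal"
  have meas [measurable]: "(\<lambda>w. ?C w (w k)) \<in> borel_measurable (PM n)"
  proof -
    have "(\<lambda>w. ?C w (w k)) = (\<lambda>w. if dist (w i) (w k) \<le> 4 * dist (w i) (w j) then 1 else 0)"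
      by (auto simp: fun_eq_iff)
    also have "\<dots> \<in> borel_measurable (PM n)" by measurable
    finally show ?thesis .
  qed
  have "?L = (\<integral>\<^sup>+w. ?C w (w k) * (ennreal (Psi \<alpha> n (w i) (w j)) * ennreal (Psi \<alpha> n (w k) (w l))) \<partial>PM n)"
    by (intro nn_integral_cong) (auto simp: indicator_def)
  also have "\<dots> = (\<integral>\<^sup>+w. ?C w (w k) * ennreal (Psi \<alpha> n (w i) (w j)) * (\<integral>\<^sup>+y. ennreal (Psi \<alpha> n (w k) y) \<partial>mu) \<partial>PM n)"
    using ij by (subst nn_integral_PiM_resample[of _ l]) (auto simp: nn_integral_cmult mult.assoc[symmetric])
  also have "\<dots> \<le> (\<integral>\<^sup>+w. ?C w (w k) * ennreal (Psi \<alpha> n (w i) (w j)) * ?k \<partial>PM n)"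
    using ij \<alpha> by (intro nn_integral_mono mult_left_mono Psi_int) auto
  also have "\<dots> = (\<integral>\<^sup>+w. ?C w (w k) * ennreal (Psi \<alpha> n (w i) (w j)) \<partial>PM n) * ?k"
    by (intro nn_integral_multc) measurable
  also have "(\<integral>\<^sup>+w. ?C w (w k) * ennreal (Psi \<alpha> n (w i) (w j)) \<partial>PM n)
    = (\<integral>\<^sup>+w. emeasure mu (cball (w i) (4 * dist (w i) (w j))) * ennreal (Psi \<alpha> n (w i) (w j)) \<partial>PM n)"
    using ij by (subst nn_integral_PiM_resample[of _ k])
      (auto simp: nn_integral_multc[OF borel_measurable_indicator])
  \<comment> \<open>The mass bound for the ball is proportional to r^d, which is absorbed by raising
    the exponent of the kernel from \<alpha> to \<alpha> + d.\<close>
  also have "\<dots> \<le> (\<integral>\<^sup>+w. ennreal ?v * ennreal (Psi (\<alpha> + DIM('a)) n (w i) (w j)) \<partial>PM n)"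
  proof (intro nn_integral_mono)
    fix w :: "nat \<Rightarrow> 'a"
    let ?r = "dist (w i) (w j)"
    have "?r ^ DIM('a) * Psi \<alpha> n (w i) (w j) = Psi (\<alpha> + DIM('a)) n (w i) (w j)"
      by (cases "w i = w j") (auto simp: Psi_def powr_add powr_realpow)
    moreover have "emeasure mu (cball (w i) (4 * ?r)) \<le> ennreal (?v * ?r ^ DIM('a))"
      using measure_mu_ball_le[of "4 * ?r" "w i"] by (simp add: power_mult_distrib mult.assoc)
    then have "emeasure mu (cball (w i) (4 * ?r)) * ennreal (Psi \<alpha> n (w i) (w j)) \<le> ennreal (?v * ?r ^ DIM('a)) * ennreal (Psi \<alpha> n (w i) (w j))"
      by (intro mult_right_mono) auto
    ultimately show "emeasure mu (cball (w i) (4 * ?r)) * ennreal (Psi \<alpha> n (w i) (w j)) \<le> ennreal ?v * ennreal (Psi (\<alpha> + DIM('a)) n (w i) (w j))"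
      using b_pos by (simp add: mult.assoc flip: ennreal_mult')
  qed
  also have "\<dots> = ennreal ?v * (\<integral>\<^sup>+x. (\<integral>\<^sup>+y. ennreal (Psi (\<alpha> + DIM('a)) n x y) \<partial>mu) \<partial>mu)"
    using ij by (simp add: nn_integral_cmult nn_integral_PM_pair[of i n j "\<lambda>x y. ennreal (Psi (\<alpha> + DIM('a)) n x y)"])
  also have "\<dots> \<le> ennreal ?v * ennreal (K (\<alpha> + DIM('a)) * real n powr (-1 - (\<alpha> + DIM('a)) / DIM('a)))"
    using ij \<alpha> by (intro mult_left_mono Psi_int2) auto
  finally have "?L \<le> ennreal ?v * ennreal (K (\<alpha> + DIM('a)) * real n powr (-1 - (\<alpha> + DIM('a)) / DIM('a))) * ?k"
    by (simp add: mult_right_mono)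
  also have "\<dots> = ennreal (K_near \<alpha> * real n powr (-3 - 2 * \<alpha> / DIM('a)))"
  proof -
    have "real n powr (-1 - (\<alpha> + DIM('a)) / DIM('a)) * real n powr (-1 - \<alpha> / DIM('a)) = real n powr (-3 - 2 * \<alpha> / DIM('a))"
      by (simp add: add_divide_distrib flip: powr_add)
    then show ?thesis
      using b_pos by (simp add: K_near_def K_nonneg \<alpha> mult_ac flip: ennreal_mult')
  qed
  finally show ?thesis .
qed

text \<open>In contrast to \<open>Psi\<close>, the exact mass \<open>zp\<close> is kept, since the
  double integral of this kernel must have the same limit as the mean.\<close>

definition Q :: "real \<Rightarrow> nat \<Rightarrow> 'a \<Rightarrow> 'a \<Rightarrow> real" where
  "Q \<alpha> n x y = dist x y powr \<alpha> * exp (- real (n - 4) * zp x y)"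

lemma Q_nonneg [simp]: "0 \<le> Q \<alpha> n x y"
  by (simp add: Q_def)

lemma measurable_Q [measurable (raw)]:
  assumes [measurable]: "g \<in> borel_measurable N" "h \<in> borel_measurable N"
  shows "(\<lambda>w. Q \<alpha> n (g w) (h w)) \<in> borel_measurable N"
  unfolding Q_def by measurable

lemma borel_measurable_mu_Q [simp]: "(\<lambda>y. ennreal (Q \<alpha> n x y)) \<in> borel_measurable mu"
  by (rule measurable_compose[OF measurable_Q measurable_ennreal]) (auto intro: measurable_ident_sets)

definition I :: "real \<Rightarrow> nat \<Rightarrow> ennreal" where
  "I \<alpha> n = (\<integral>\<^sup>+x. (\<integral>\<^sup>+y. ennreal (Q \<alpha> n x y) \<partial>mu) \<partial>mu)"

text \<open>If the two regions are disjoint, their measures add up; otherwise one of the two pairs is long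
  compared with the distance between \<open>x\<close> and \<open>x'\<close>.\<close>

lemma exp_zp2_le_far_or_near:
  assumes P: "x \<in> P" "y \<in> P" "x' \<in> P" "y' \<in> P" and n: "n \<ge> 5"
  shows "dist x y powr \<alpha> * dist x' y' powr \<alpha> * exp (- real (n - 4) * zp2 x y x' y')
    \<le> Q \<alpha> n x y * Q \<alpha> n x' y' + of_bool (dist x x' \<le> 4 * dist x y) * (Psi \<alpha> n x y * Psi \<alpha> n x' y')
      + of_bool (dist x' x \<le> 4 * dist x' y') * (Psi \<alpha> n x' y' * Psi \<alpha> n x y)"
proof (cases "zone t x y \<inter> zone t x' y' = {}")
  case True
  then have "zp2 x y x' y' = zp x y + zp x' y'"
    unfolding zp2_def zp_def by (intro finite_measure_Union) auto
  then have "dist x y powr \<alpha> * dist x' y' powr \<alpha> * exp (- real (n - 4) * zp2 x y x' y') = Q \<alpha> n x y * Q \<alpha> n x' y'"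
    by (simp add: Q_def algebra_simps exp_add[symmetric] exp_diff exp_minus divide_simps)
  then show ?thesis
    by (simp add: add_nonneg_nonneg)
next
  case False
  then obtain z where "z \<in> ball x (2 * dist x y)" "z \<in> ball x' (2 * dist x' y')"
    using zone_subset_ball[OF t_range] by blast
  \<comment> \<open>Each region lies in a ball of twice the length of its pair, so a common point
    bounds the distance of the first endpoints by four times the longer length.\<close>
  then have "dist x x' \<le> 2 * dist x y + 2 * dist x' y'"
    using dist_triangle2[of x x' z] by (auto simp: dist_commute)
  then have "dist x x' \<le> 4 * dist x y \<or> dist x' x \<le> 4 * dist x' y'"
    by (auto simp: dist_commute)
  then have "1 \<le> of_bool (dist x x' \<le> 4 * dist x y) + (of_bool (dist x' x \<le> 4 * dist x' y') :: real)"
    by auto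
  then have "1 * (Psi \<alpha> n x y * Psi \<alpha> n x' y') \<le>
    (of_bool (dist x x' \<le> 4 * dist x y) + of_bool (dist x' x \<le> 4 * dist x' y')) * (Psi \<alpha> n x y * Psi \<alpha> n x' y')"
    by (intro mult_right_mono) auto
  moreover have "0 \<le> Q \<alpha> n x y * Q \<alpha> n x' y'" by simp
  ultimately show ?thesis
    using exp_zp2_le_Psi[OF assms, of \<alpha>] by (simp only: distrib_right mult_1 mult.commute[of "Psi \<alpha> n x' y'"])
qed

text \<open>With four distinct indices the two factors Q depend on independent pairs, so integrating
  out l and then k leaves \<open>I \<alpha> n * I \<alpha> n\<close>. The two near terms account for
  the factor 2.\<close>

lemma pterm_mult_le_disjoint:
  assumes ij: "i < n" "j < n" "k < n" "l < n" "distinct [i, j, k, l]" and n: "n \<ge> 5" and \<alpha>: "\<alpha> \<ge> 0"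
  shows "(\<integral>\<^sup>+w. ennreal (pterm \<alpha> n i j w * pterm \<alpha> n k l w) \<partial>PM n)
    \<le> I \<alpha> n * I \<alpha> n + ennreal (2 * K_near \<alpha> * real n powr (-3 - 2 * \<alpha> / DIM('a)))"
proof -
  note [measurable] = component_borel[OF ij(1)] component_borel[OF ij(2)] component_borel[OF ij(3)] component_borel[OF ij(4)]
  let ?b = "\<lambda>i j k l w. indicator {p. dist (fst p) (snd p) \<le> 4 * dist (w i) (w j)} (w i, w k) *
      (ennreal (Psi \<alpha> n (w i) (w j)) * ennreal (Psi \<alpha> n (w k) (w l)))"
  have b_meas: "?b i j k l \<in> borel_measurable (PM n)"
    if that: "i < n" "j < n" "k < n" "l < n" for i j k l
  proof -
    note [measurable] = that[THEN component_borel]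
    have "?b i j k l = (\<lambda>w. (if dist (w i) (w k) \<le> 4 * dist (w i) (w j) then 1 else 0) *
      (ennreal (Psi \<alpha> n (w i) (w j)) * ennreal (Psi \<alpha> n (w k) (w l))))"
      by (auto simp: fun_eq_iff)
    also have "\<dots> \<in> borel_measurable (PM n)" by measurable
    finally show ?thesis .
  qed
  have [measurable]: "?b i j k l \<in> borel_measurable (PM n)" "?b k l i j \<in> borel_measurable (PM n)"
    using b_meas ij by blast+
  have "(\<integral>\<^sup>+w. ennreal (pterm \<alpha> n i j w * pterm \<alpha> n k l w) \<partial>PM n)
    \<le> (\<integral>\<^sup>+w. ennreal (dist (w i) (w j) powr \<alpha> * dist (w k) (w l) powr \<alpha> * exp (- real (n - 4) * zp2 (w i) (w j) (w k) (w l))) \<partial>PM n)"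
    by (rule pterm_mult_expectation_le) (use ij in auto)
  also have "\<dots> \<le> (\<integral>\<^sup>+w. ennreal (Q \<alpha> n (w i) (w j)) * ennreal (Q \<alpha> n (w k) (w l)) + ?b i j k l w + ?b k l i j w \<partial>PM n)"
  proof (rule nn_integral_mono_AE)
    show "AE w in PM n. ennreal (dist (w i) (w j) powr \<alpha> * dist (w k) (w l) powr \<alpha> * exp (- real (n - 4) * zp2 (w i) (w j) (w k) (w l)))
      \<le> ennreal (Q \<alpha> n (w i) (w j)) * ennreal (Q \<alpha> n (w k) (w l)) + ?b i j k l w + ?b k l i j w"
      using AE_PM_P[of n]
    proof eventually_elim
      case (elim w)
      have "ennreal (dist (w i) (w j) powr \<alpha> * dist (w k) (w l) powr \<alpha> * exp (- real (n - 4) * zp2 (w i) (w j) (w k) (w l)))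
        \<le> ennreal (Q \<alpha> n (w i) (w j) * Q \<alpha> n (w k) (w l) + of_bool (dist (w i) (w k) \<le> 4 * dist (w i) (w j)) * (Psi \<alpha> n (w i) (w j) * Psi \<alpha> n (w k) (w l))
      + of_bool (dist (w k) (w i) \<le> 4 * dist (w k) (w l)) * (Psi \<alpha> n (w k) (w l) * Psi \<alpha> n (w i) (w j)))"
        using elim ij n by (intro ennreal_leI exp_zp2_le_far_or_near) auto
      also have "\<dots> = ennreal (Q \<alpha> n (w i) (w j)) * ennreal (Q \<alpha> n (w k) (w l)) + ?b i j k l w + ?b k l i j w"
        by (simp add: ennreal_mult' of_bool_def)
      finally show ?case .
    qed
  qed
  also have "\<dots> = (\<integral>\<^sup>+w. ennreal (Q \<alpha> n (w i) (w j)) * ennreal (Q \<alpha> n (w k) (w l)) \<partial>PM n) + (\<integral>\<^sup>+w. ?b i j k l w \<partial>PM n) + (\<integral>\<^sup>+w. ?b k l i j w \<partial>PM n)"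
    by (subst nn_integral_add, measurable, subst nn_integral_add, measurable)
  also have "(\<integral>\<^sup>+w. ennreal (Q \<alpha> n (w i) (w j)) * ennreal (Q \<alpha> n (w k) (w l)) \<partial>PM n)
    = (\<integral>\<^sup>+w. ennreal (Q \<alpha> n (w i) (w j)) * (\<integral>\<^sup>+y. ennreal (Q \<alpha> n (w k) y) \<partial>mu) \<partial>PM n)"
    using ij by (subst nn_integral_PiM_resample[of _ l]) (auto simp: nn_integral_cmult)
  also have "\<dots> = (\<integral>\<^sup>+w. ennreal (Q \<alpha> n (w i) (w j)) * I \<alpha> n \<partial>PM n)"
    using ij unfolding I_def by (subst nn_integral_PiM_resample[of _ k]) (auto simp: nn_integral_cmult)
  also have "\<dots> = I \<alpha> n * I \<alpha> n"
    using ij by (simp add: nn_integral_multc nn_integral_PM_pair[of i n j "\<lambda>x y. ennreal (Q \<alpha> n x y)"] I_def)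
  also have "I \<alpha> n * I \<alpha> n + (\<integral>\<^sup>+w. ?b i j k l w \<partial>PM n) + (\<integral>\<^sup>+w. ?b k l i j w \<partial>PM n)
    \<le> I \<alpha> n * I \<alpha> n + ennreal (K_near \<alpha> * real n powr (-3 - 2 * \<alpha> / DIM('a))) + ennreal (K_near \<alpha> * real n powr (-3 - 2 * \<alpha> / DIM('a)))"
    using ij \<alpha> by (intro add_mono order_refl nn_integral_PM_Psi_near) auto
  also have "\<dots> = I \<alpha> n * I \<alpha> n + ennreal (2 * K_near \<alpha> * real n powr (-3 - 2 * \<alpha> / DIM('a)))"
    using b_pos K_nonneg \<alpha> by (simp add: K_near_def add.assoc flip: ennreal_plus)
  finally show ?thesis .
qed

text \<open>Serves to show that \<open>I\<close> is finite, so that it can be handled as a real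
  number.\<close>

lemma I_le:
  assumes n: "n \<ge> 5" and \<alpha>: "\<alpha> \<ge> 0"
  shows "I \<alpha> n \<le> ennreal (K \<alpha> * real n powr (-1 - \<alpha> / DIM('a)))"
proof -
  have "Q \<alpha> n x y \<le> Psi \<alpha> n x y" if "x \<in> P" "y \<in> P" for x y
  proof -
    have "c * real n * dist x y ^ DIM('a) = real n / 10 * (\<kappa> * dist x y ^ DIM('a))"
      by (simp add: c_def)
    also have "\<dots> \<le> real (n - 4) * zp x y"
      using n zp_ge[OF that] kappa_pos by (intro mult_mono) (auto simp: of_nat_diff)
    finally show ?thesis
      by (auto simp: Q_def Psi_def intro!: mult_left_mono)
  qed
  then have "I \<alpha> n \<le> (\<integral>\<^sup>+x. (\<integral>\<^sup>+y. ennreal (Psi \<alpha> n x y) \<partial>mu) \<partial>mu)"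
    unfolding I_def
    by (intro nn_integral_mono_AE eventually_mono[OF AE_mu_P] ennreal_leI) auto
  also have "\<dots> \<le> ennreal (K \<alpha> * real n powr (-1 - \<alpha> / DIM('a)))"
    using n \<alpha> by (intro Psi_int2) auto
  finally show ?thesis .
qed

end

section \<open>Second moment of the sum over all ordered pairs\<close>

definition offdiag :: "nat \<Rightarrow> (nat \<times> nat) set" where
  "offdiag n = {(i, j). i < n \<and> j < n \<and> i \<noteq> j}"

lemma offdiag_subset: "offdiag n \<subseteq> {..<n} \<times> {..<n}"
  by (auto simp: offdiag_def)

lemma finite_offdiag [simp]: "finite (offdiag n)"
  by (rule finite_subset[OF offdiag_subset]) auto

lemma card_offdiag: "real (card (offdiag n)) = real n * (real n - 1)"
proof -
  have "offdiag n = {..<n} \<times> {..<n} - (\<lambda>i. (i, i)) ` {..<n}"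
    by (auto simp: offdiag_def)
  moreover have "card ((\<lambda>i. (i, i)) ` {..<n}) = n"
    by (subst card_image) (auto simp: inj_on_def)
  ultimately have "card (offdiag n) = n * n - n"
    by (simp add: card_Diff_subset image_subset_iff)
  then show ?thesis
    by (cases n) (auto simp: algebra_simps of_nat_diff)
qed

context nn_density
begin

definition total :: "real \<Rightarrow> nat \<Rightarrow> (nat \<Rightarrow> 'a) \<Rightarrow> real" where
  "total \<alpha> n w = (\<Sum>(i, j)\<in>offdiag n. pterm \<alpha> n i j w)"

lemma measurable_total [measurable]: "total \<alpha> n \<in> borel_measurable (PM n)"
  unfolding total_def[abs_def]
  by (intro borel_measurable_sum) (auto simp: offdiag_def split: prod.splits)

text \<open>The coefficients count cases: two ways for one pair to be near the other, four positions
  of a single shared index, and two orders of the same pair.\<close>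

definition K_sq :: "real \<Rightarrow> real" where
  "K_sq \<alpha> = 2 * K_near \<alpha> + 4 * (K \<alpha>)\<^sup>2 + 2 * K (2 * \<alpha>)"

text \<open>The square is expanded over quadruples of indices. The near, one-shared and equal
  patterns number at most n^4, n^3 and n^2 up to constants, and each contributes order
  n^(1-2\<alpha>/d), a factor n below the normalising scale n^(2-2\<alpha>/d).\<close>

lemma total_square_le:
  assumes n: "n \<ge> 5" and \<alpha>: "\<alpha> \<ge> 0"
  shows "(\<integral>\<^sup>+w. ennreal ((total \<alpha> n w)\<^sup>2) \<partial>PM n)
    \<le> ennreal (real n ^ 4 * (enn2real (I \<alpha> n))\<^sup>2 + K_sq \<alpha> * real n powr (1 - 2 * \<alpha> / DIM('a)))"
proof -
  define A where "A = (enn2real (I \<alpha> n))\<^sup>2 + 2 * K_near \<alpha> * real n powr (-3 - 2 * \<alpha> / DIM('a))"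
  define B3 where "B3 = (K \<alpha>)\<^sup>2 * real n powr (-2 - 2 * \<alpha> / DIM('a))"
  define B2 where "B2 = K (2 * \<alpha>) * real n powr (-1 - 2 * \<alpha> / DIM('a))"
  \<comment> \<open>One bound for all patterns: the 0-1 terms switch on the estimate for a shared
    index, so that summation over k and l counts the coincidences.\<close>
  define U where "U i j k l = A + B3 * (of_bool (k = i) + of_bool (k = j) + of_bool (l = i) + of_bool (l = j))
    + B2 * (of_bool (k = i \<and> l = j) + of_bool (k = j \<and> l = i))" for i j k l :: nat
  have K_near: "K_near \<alpha> \<ge> 0"
    using b_pos K_nonneg \<alpha> by (auto simp: K_near_def intro!: mult_nonneg_nonneg)
  have pos: "A \<ge> 0" "B3 \<ge> 0" "B2 \<ge> 0"
    unfolding A_def B3_def B2_def using K_near K_nonneg[of "2 * \<alpha>"] \<alpha>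
    by (intro add_nonneg_nonneg mult_nonneg_nonneg zero_le_power2 powr_ge_zero; simp)+
  have U_nonneg: "U i j k l \<ge> 0" for i j k l
    unfolding U_def by (intro add_nonneg_nonneg mult_nonneg_nonneg pos) auto
  have I_fin: "I \<alpha> n = ennreal (enn2real (I \<alpha> n))"
    using I_le[OF n \<alpha>] by (metis ennreal_enn2real ennreal_less_top order_le_less_trans)
  have e_le: "(\<integral>\<^sup>+w. ennreal (pterm \<alpha> n i j w * pterm \<alpha> n k l w) \<partial>PM n) \<le> ennreal (U i j k l)"
    if "(i, j) \<in> offdiag n" "(k, l) \<in> offdiag n" for i j k l
  proof -
    have ij: "i < n" "j < n" "i \<noteq> j" "k < n" "l < n" "k \<noteq> l" using that by (auto simp: offdiag_def)
    let ?E = "\<lambda>i j k l. \<integral>\<^sup>+w. ennreal (Psi \<alpha> n (w i) (w j)) * ennreal (Psi \<alpha> n (w k) (w l)) \<partial>PM n"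
    have P: "(\<integral>\<^sup>+w. ennreal (pterm \<alpha> n i j w * pterm \<alpha> n k l w) \<partial>PM n) \<le> ennreal (U i j k l)"
      if "?E i j k l \<le> ennreal B" "B \<le> U i j k l" for B
      using pterm_mult_le_Psi[OF ij(1,2,4,5) n, of \<alpha>] that by (meson ennreal_leI order_trans)
    have swap1: "?E i j k l = ?E j i k l" and swap2: "?E i j k l = ?E i j l k" for i j k l
      by (intro nn_integral_cong; metis Psi_commute)+
    have S: "?E i j i l \<le> ennreal B3" if "i < n" "j < n" "l < n" "i \<noteq> j" "l \<noteq> i" "l \<noteq> j" for i j l
      unfolding B3_def by (rule nn_integral_PM_Psi_star[OF that \<alpha>])
    have T: "?E i j i j \<le> ennreal B2"
      unfolding B2_def by (rule nn_integral_PM_Psi_square[OF ij(1,2,3) \<alpha>])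
    consider "distinct [i, j, k, l]" | "k = i" "l \<noteq> j" | "k = j" "l \<noteq> i" | "l = i" "k \<noteq> j" | "l = j" "k \<noteq> i"
      | "k = i" "l = j" | "k = j" "l = i" using ij by auto
    then show ?thesis
    proof cases
      case 1
      have "I \<alpha> n * I \<alpha> n = ennreal ((enn2real (I \<alpha> n))\<^sup>2)"
        by (subst (1 2) I_fin) (simp add: power2_eq_square flip: ennreal_mult')
      then have "(\<integral>\<^sup>+w. ennreal (pterm \<alpha> n i j w * pterm \<alpha> n k l w) \<partial>PM n) \<le> ennreal A"
        using pterm_mult_le_disjoint[OF ij(1,2,4,5) 1 n \<alpha>] K_near
        by (simp add: A_def flip: ennreal_plus)
      also have "\<dots> \<le> ennreal (U i j k l)" using 1 by (intro ennreal_leI) (simp add: U_def)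
      finally show ?thesis .
    next
      case 2
      then show ?thesis using ij S[of i j l] pos by (intro P[of B3]) (auto simp: U_def)
    next
      case 3
      then show ?thesis using ij S[of j i l] pos by (intro P[of B3]) (auto simp: U_def swap1[of i])
    next
      case 4
      then show ?thesis using ij S[of i j k] pos by (intro P[of B3]) (auto simp: U_def swap2[of _ _ k])
    next
      case 5
      have "?E i j k l = ?E l i l k"
        using 5 swap1[of i j k l] swap2[of j i k l] by simp
      then show ?thesis using ij 5 S[of l i k] pos by (intro P[of B3]) (auto simp: U_def)
    next
      case 6
      then show ?thesis using ij T pos by (intro P[of B2]) (auto simp: U_def)
    next
      case 7
      then show ?thesis using ij T pos by (intro P[of B2]) (auto simp: U_def swap2[of _ _ j])
    qed
  qed
  have "(total \<alpha> n w)\<^sup>2 = (\<Sum>p\<in>offdiag n. \<Sum>q\<in>offdiag n. pterm \<alpha> n (fst p) (snd p) w * pterm \<alpha> n (fst q) (snd q) w)" for w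
    by (simp add: total_def power2_eq_square sum_product case_prod_beta')
  then have "(\<integral>\<^sup>+w. ennreal ((total \<alpha> n w)\<^sup>2) \<partial>PM n)
    = (\<integral>\<^sup>+w. (\<Sum>p\<in>offdiag n. \<Sum>q\<in>offdiag n. ennreal (pterm \<alpha> n (fst p) (snd p) w * pterm \<alpha> n (fst q) (snd q) w)) \<partial>PM n)"
    by (simp add: sum_ennreal pterm_nonneg sum_nonneg)
  also have "\<dots> = (\<Sum>p\<in>offdiag n. \<Sum>q\<in>offdiag n. \<integral>\<^sup>+w. ennreal (pterm \<alpha> n (fst p) (snd p) w * pterm \<alpha> n (fst q) (snd q) w) \<partial>PM n)"
  proof -
    have [measurable]: "pterm \<alpha> n (fst p) (snd p) \<in> borel_measurable (PM n)" if "p \<in> offdiag n" for p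
      using that by (intro pterm_measurable) (auto simp: offdiag_def)
    show ?thesis
      by (subst nn_integral_sum, measurable, intro sum.cong refl nn_integral_sum) measurable
  qed
  also have "\<dots> \<le> (\<Sum>p\<in>offdiag n. \<Sum>q\<in>offdiag n. ennreal (U (fst p) (snd p) (fst q) (snd q)))"
    by (intro sum_mono e_le) auto
  also have "\<dots> = ennreal (\<Sum>p\<in>offdiag n. \<Sum>q\<in>offdiag n. U (fst p) (snd p) (fst q) (snd q))"
    by (simp add: sum_ennreal U_nonneg sum_nonneg)
  also have "\<dots> \<le> ennreal (real n ^ 4 * (enn2real (I \<alpha> n))\<^sup>2 + K_sq \<alpha> * real n powr (1 - 2 * \<alpha> / DIM('a)))"
  proof (rule ennreal_leI)
    have inner: "(\<Sum>q\<in>offdiag n. U i j (fst q) (snd q)) \<le> real n ^ 2 * A + 4 * real n * B3 + 2 * B2"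
      if ij: "i < n" "j < n" for i j
    proof -
      have *: "(\<Sum>k<n. of_bool (k = m) :: real) = 1" if "m < n" for m
        using that by (simp add: of_bool_def)
      \<comment> \<open>Passing to the full square is harmless since U is nonnegative, and it turns
        each coincidence into a plain count.\<close>
      have "(\<Sum>q\<in>offdiag n. U i j (fst q) (snd q)) \<le> (\<Sum>q\<in>{..<n} \<times> {..<n}. U i j (fst q) (snd q))"
        using U_nonneg by (intro sum_mono2 offdiag_subset) auto
      also have "\<dots> = (\<Sum>k<n. \<Sum>l<n. U i j k l)"
        by (simp add: sum.cartesian_product case_prod_beta')
      also have "\<dots> = real n ^ 2 * A + 4 * real n * B3 + 2 * B2"
        using ij by (simp add: U_def sum.distrib sum_distrib_left[symmetric] * of_bool_conj power2_eq_square algebra_simps)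
      finally show ?thesis .
    qed
    have "(\<Sum>p\<in>offdiag n. \<Sum>q\<in>offdiag n. U (fst p) (snd p) (fst q) (snd q)) \<le> (\<Sum>p\<in>offdiag n. real n ^ 2 * A + 4 * real n * B3 + 2 * B2)"
      by (intro sum_mono inner) (auto simp: offdiag_def)
    also have "\<dots> \<le> (\<Sum>p\<in>{..<n} \<times> {..<n}. real n ^ 2 * A + 4 * real n * B3 + 2 * B2)"
      using pos by (intro sum_mono2 offdiag_subset) auto
    also have "\<dots> = real n ^ 2 * (real n ^ 2 * A + 4 * real n * B3 + 2 * B2)"
      by (simp add: power2_eq_square)
    also have "\<dots> = real n ^ 4 * (enn2real (I \<alpha> n))\<^sup>2 + K_sq \<alpha> * real n powr (1 - 2 * \<alpha> / DIM('a))"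
    proof -
      have pw: "real n ^ m * real n powr e = real n powr (real m + e)" for m e
        using n by (simp add: powr_add powr_realpow)
      have 4: "real n ^ 4 * real n powr (-3 - 2 * \<alpha> / DIM('a)) = real n powr (1 - 2 * \<alpha> / DIM('a))"
        and 3: "real n ^ 3 * real n powr (-2 - 2 * \<alpha> / DIM('a)) = real n powr (1 - 2 * \<alpha> / DIM('a))"
        and 2: "real n ^ 2 * real n powr (-1 - 2 * \<alpha> / DIM('a)) = real n powr (1 - 2 * \<alpha> / DIM('a))"
        by (simp_all only: pw) simp_all
      have "K_sq \<alpha> * real n powr (1 - 2 * \<alpha> / DIM('a)) = 2 * K_near \<alpha> * (real n ^ 4 * real n powr (-3 - 2 * \<alpha> / DIM('a)))
         + 4 * (K \<alpha>)\<^sup>2 * (real n ^ 3 * real n powr (-2 - 2 * \<alpha> / DIM('a))) + 2 * K (2 * \<alpha>) * (real n ^ 2 * real n powr (-1 - 2 * \<alpha> / DIM('a)))"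
        unfolding K_sq_def 4 3 2 by (simp add: algebra_simps)
      then show ?thesis
        by (simp add: A_def B3_def B2_def algebra_simps power2_eq_square power3_eq_cube power4_eq_xxxx)
    qed
    finally show "(\<Sum>p\<in>offdiag n. \<Sum>q\<in>offdiag n. U (fst p) (snd p) (fst q) (snd q))
      \<le> real n ^ 4 * (enn2real (I \<alpha> n))\<^sup>2 + K_sq \<alpha> * real n powr (1 - 2 * \<alpha> / DIM('a))" .
  qed
  finally show ?thesis .
qed

section \<open>Local rescaling of the region probabilities and the limit of the mean\<close>

lemma integrable_f [simp]: "integrable lborel f"
  using f_prob f_nonneg by (intro integrableI_nonneg) auto

definition sc :: "nat \<Rightarrow> real" where
  "sc n = real n powr (- 1 / DIM('a))"

lemma sc_pos: "n > 0 \<Longrightarrow> sc n > 0"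
  by (simp add: sc_def)

lemma sc_pow: "n > 0 \<Longrightarrow> sc n ^ DIM('a) = 1 / real n"
  unfolding sc_def by (subst powr_realpow[symmetric], simp, subst powr_powr) (simp add: powr_minus_divide)

lemma sc_powr: "sc n powr \<alpha> = real n powr (- \<alpha> / DIM('a))"
  by (simp add: sc_def powr_powr)

lemma sc_tendsto: "sc \<longlonglongrightarrow> 0"
  unfolding sc_def by (intro tendsto_neg_powr filterlim_real_sequentially) auto

text \<open>The error in replacing n times the mass of the rescaled region at x by its expected
  limit, the volume of the unscaled region times f(x).\<close>

definition gap :: "nat \<Rightarrow> 'a \<Rightarrow> 'a \<Rightarrow> real" where
  "gap n u x = \<bar>real n * zp x (x + sc n *\<^sub>R u) - zone_vol TYPE('a) t * norm u ^ DIM('a) * f x\<bar>"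

lemma measurable_gap [measurable]: "gap n u \<in> borel_measurable borel"
  unfolding gap_def[abs_def] by measurable

text \<open>After rescaling by \<open>sc n\<close>, whose d-th power is 1/n, both quantities are
  integrals over the same region \<open>zone t 0 u\<close>, of f(x + sc n w) and of f(x)
  respectively.\<close>

lemma gap_le:
  assumes n: "n > 0"
  shows "ennreal (gap n u x) \<le> (\<integral>\<^sup>+w. indicator (zone t 0 u) w * ennreal \<bar>f (x + sc n *\<^sub>R w) - f x\<bar> \<partial>lborel)"
proof -
  let ?Z = "zone t 0 u" and ?h = "sc n"
  have h: "?h > 0" using n by (rule sc_pos)
  have Z_fin: "emeasure lborel ?Z < \<infinity>"
    unfolding emeasure_zone by simp
  have Z_int: "integrable lborel (indicator ?Z :: 'a \<Rightarrow> real)"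
    using Z_fin by (simp add: integrable_indicator_iff)
  have int1: "integrable lborel (\<lambda>w. indicator ?Z w * f (x + ?h *\<^sub>R w))"
  proof (rule Bochner_Integration.integrable_bound[OF integrable_mult_right[OF Z_int, of b]])
    show "AE w in lborel. norm (indicator ?Z w * f (x + ?h *\<^sub>R w)) \<le> norm (b * indicator ?Z w)"
      using f_nonneg f_le b_pos by (intro AE_I2) (auto simp: indicator_def)
  qed measurable
  have int2: "integrable lborel (\<lambda>w. indicator ?Z w * f x)"
    using Z_int by (rule integrable_mult_left)
  have "emeasure mu (zone t x (x + ?h *\<^sub>R u)) = (\<integral>\<^sup>+y. ennreal (f y) * indicator (zone t x (x + ?h *\<^sub>R u)) y \<partial>lborel)"
    unfolding mu_def by (rule emeasure_density) auto
  also have "\<dots> = ennreal (?h ^ DIM('a)) * (\<integral>\<^sup>+w. ennreal (f (x + ?h *\<^sub>R w)) * indicator (zone t x (x + ?h *\<^sub>R u)) (x + ?h *\<^sub>R w) \<partial>lborel)"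
    by (rule nn_integral_lborel_affine[OF _ h]) measurable
  also have "(\<integral>\<^sup>+w. ennreal (f (x + ?h *\<^sub>R w)) * indicator (zone t x (x + ?h *\<^sub>R u)) (x + ?h *\<^sub>R w) \<partial>lborel)
      = (\<integral>\<^sup>+w. ennreal (indicator ?Z w * f (x + ?h *\<^sub>R w)) \<partial>lborel)"
    by (intro nn_integral_cong) (auto simp: zone_scale[OF h] split: split_indicator)
  also have "\<dots> = ennreal (\<integral>w. indicator ?Z w * f (x + ?h *\<^sub>R w) \<partial>lborel)"
    using int1 f_nonneg by (intro nn_integral_eq_integral) auto
  finally have "ennreal (zp x (x + ?h *\<^sub>R u)) = ennreal (?h ^ DIM('a) * (\<integral>w. indicator ?Z w * f (x + ?h *\<^sub>R w) \<partial>lborel))"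
    using h by (simp add: zp_def emeasure_eq_measure ennreal_mult')
  then have zp: "zp x (x + ?h *\<^sub>R u) = ?h ^ DIM('a) * (\<integral>w. indicator ?Z w * f (x + ?h *\<^sub>R w) \<partial>lborel)"
    using h f_nonneg by (subst (asm) ennreal_inj) (auto intro!: mult_nonneg_nonneg integral_nonneg_AE)
  have "real n * zp x (x + ?h *\<^sub>R u) = (\<integral>w. indicator ?Z w * f (x + ?h *\<^sub>R w) \<partial>lborel)"
    using n by (simp add: zp sc_pow)
  moreover have "zone_vol TYPE('a) t * norm u ^ DIM('a) * f x = (\<integral>w. indicator ?Z w * f x \<partial>lborel)"
    using zone_vol_pos[of t, where 'a='a] by (simp add: measure_def emeasure_zone)
  ultimately have "real n * zp x (x + ?h *\<^sub>R u) - zone_vol TYPE('a) t * norm u ^ DIM('a) * f x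
      = (\<integral>w. indicator ?Z w * f (x + ?h *\<^sub>R w) - indicator ?Z w * f x \<partial>lborel)"
    using int1 int2 by simp
  then have "ennreal (gap n u x) \<le> (\<integral>\<^sup>+w. norm (indicator ?Z w * f (x + ?h *\<^sub>R w) - indicator ?Z w * f x) \<partial>lborel)"
    using integral_norm_bound_ennreal[OF Bochner_Integration.integrable_diff[OF int1 int2]] by (simp add: gap_def)
  also have "\<dots> = (\<integral>\<^sup>+w. indicator ?Z w * ennreal \<bar>f (x + ?h *\<^sub>R w) - f x\<bar> \<partial>lborel)"
    by (intro nn_integral_cong) (auto split: split_indicator)
  finally show ?thesis .
qed

lemma L1_shift: "(\<lambda>n. \<integral>\<^sup>+x. ennreal \<bar>f (x + sc n *\<^sub>R w) - f x\<bar> \<partial>lborel) \<longlonglongrightarrow> 0"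
  by (rule L1_translation_tendsto_0) (auto intro!: tendsto_eq_intros sc_tendsto)

lemma nn_integral_shift_le_2: "(\<integral>\<^sup>+x. ennreal \<bar>f (x + k) - f x\<bar> \<partial>lborel) \<le> 2"
proof -
  have "(\<integral>\<^sup>+x. ennreal \<bar>f (x + k) - f x\<bar> \<partial>lborel) \<le> (\<integral>\<^sup>+x. ennreal (f (k + x)) + ennreal (f x) \<partial>lborel)"
  proof (intro nn_integral_mono)
    fix x
    have "\<bar>f (x + k) - f x\<bar> \<le> f (k + x) + f x"
      using f_nonneg[of "k + x"] f_nonneg[of x] by (simp add: add.commute)
    then show "ennreal \<bar>f (x + k) - f x\<bar> \<le> ennreal (f (k + x)) + ennreal (f x)"
      using f_nonneg by (simp add: ennreal_leI flip: ennreal_plus)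
  qed
  also have "\<dots> = 2"
    using nn_integral_lborel_translation[of "\<lambda>x. ennreal (f x)" k]
    by (simp add: nn_integral_add f_prob)
  finally show ?thesis .
qed

text \<open>By Fubini the integral over x is taken first. For each w in the region it tends to 0 by
  continuity of translations and never exceeds 2, so dominated convergence over the finite volume of
  the region applies.\<close>

lemma gap_tendsto: "(\<lambda>n. \<integral>\<^sup>+x. ennreal (gap n u x) \<partial>lborel) \<longlonglongrightarrow> 0"
proof -
  let ?Z = "zone t 0 u"
  have Z_fin: "emeasure lborel ?Z < \<infinity>"
    unfolding emeasure_zone by simp
  have "(\<lambda>n. \<integral>\<^sup>+w. indicator ?Z w * (\<integral>\<^sup>+x. ennreal \<bar>f (x + sc n *\<^sub>R w) - f x\<bar> \<partial>lborel) \<partial>lborel)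
    \<longlonglongrightarrow> (\<integral>\<^sup>+w. 0 \<partial>(lborel :: 'a measure))"
  proof (rule nn_integral_dominated_convergence[where w="\<lambda>w. indicator ?Z w * 2"])
    show "(\<integral>\<^sup>+w. indicator ?Z w * 2 \<partial>lborel) < \<infinity>"
      using Z_fin by (simp add: nn_integral_multc ennreal_mult_less_top)
    show "AE w in lborel. indicator ?Z w * (\<integral>\<^sup>+x. ennreal \<bar>f (x + sc n *\<^sub>R w) - f x\<bar> \<partial>lborel) \<le> indicator ?Z w * 2" for n
      by (intro AE_I2 mult_left_mono nn_integral_shift_le_2) auto
    show "AE w in lborel. (\<lambda>n. indicator ?Z w * (\<integral>\<^sup>+x. ennreal \<bar>f (x + sc n *\<^sub>R w) - f x\<bar> \<partial>lborel)) \<longlonglongrightarrow> 0"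
      using L1_shift by (intro AE_I2) (auto split: split_indicator)
  qed measurable
  then have lim: "(\<lambda>n. \<integral>\<^sup>+w. indicator ?Z w * (\<integral>\<^sup>+x. ennreal \<bar>f (x + sc n *\<^sub>R w) - f x\<bar> \<partial>lborel) \<partial>lborel) \<longlonglongrightarrow> 0"
    by simp
  have "(\<integral>\<^sup>+x. ennreal (gap n u x) \<partial>lborel)
    \<le> (\<integral>\<^sup>+w. indicator ?Z w * (\<integral>\<^sup>+x. ennreal \<bar>f (x + sc n *\<^sub>R w) - f x\<bar> \<partial>lborel) \<partial>lborel)" if "n > 0" for n
  proof -
    have "(\<integral>\<^sup>+x. ennreal (gap n u x) \<partial>lborel)
      \<le> (\<integral>\<^sup>+x. (\<integral>\<^sup>+w. indicator ?Z w * ennreal \<bar>f (x + sc n *\<^sub>R w) - f x\<bar> \<partial>lborel) \<partial>lborel)"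
      by (intro nn_integral_mono gap_le that)
    also have "\<dots> = (\<integral>\<^sup>+w. (\<integral>\<^sup>+x. indicator ?Z w * ennreal \<bar>f (x + sc n *\<^sub>R w) - f x\<bar> \<partial>lborel) \<partial>lborel)"
      by (rule lborel_pair.Fubini') measurable
    also have "\<dots> = (\<integral>\<^sup>+w. indicator ?Z w * (\<integral>\<^sup>+x. ennreal \<bar>f (x + sc n *\<^sub>R w) - f x\<bar> \<partial>lborel) \<partial>lborel)"
      by (intro nn_integral_cong nn_integral_cmult) measurable
    finally show ?thesis .
  qed
  then have "eventually (\<lambda>n. (\<integral>\<^sup>+x. ennreal (gap n u x) \<partial>lborel)
    \<le> (\<integral>\<^sup>+w. indicator ?Z w * (\<integral>\<^sup>+x. ennreal \<bar>f (x + sc n *\<^sub>R w) - f x\<bar> \<partial>lborel) \<partial>lborel)) sequentially"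
    by (rule eventually_mono[OF eventually_gt_at_top[of "0::nat"]])
  then show ?thesis
    by (intro tendsto_sandwich[OF _ _ tendsto_const lim]) auto
qed

end

text \<open>\<open>G n p\<close> abstracts the probability, or a bound for it, that a region of mass
  p is empty. Uniform closeness to exp(-n p) determines the limit; the bound exp(1 - n p / 5) gives
  the domination and holds for all n, including those where a truncated exponent is 0.\<close>

locale nn_kernel = nn_density +
  fixes G :: "nat \<Rightarrow> real \<Rightarrow> real" and \<epsilon> :: "nat \<Rightarrow> real"
  assumes G_meas [measurable]: "\<And>n. G n \<in> borel_measurable borel"
    and G_nonneg: "\<And>n p. 0 \<le> p \<Longrightarrow> p \<le> 1 \<Longrightarrow> 0 \<le> G n p"
    and G_exp: "\<And>n p. 0 \<le> p \<Longrightarrow> p \<le> 1 \<Longrightarrow> G n p \<le> exp (1 - real n / 5 * p)"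
    and G_eps: "\<And>n p. 0 \<le> p \<Longrightarrow> p \<le> 1 \<Longrightarrow> \<bar>G n p - exp (- (real n * p))\<bar> \<le> \<epsilon> n"
    and eps: "\<epsilon> \<longlonglongrightarrow> 0"
begin

definition J :: "nat \<Rightarrow> 'a \<Rightarrow> ennreal" where
  "J n u = (\<integral>\<^sup>+x. ennreal (f x * f (x + sc n *\<^sub>R u) * G n (zp x (x + sc n *\<^sub>R u))) \<partial>lborel)"

definition J_lim :: "'a \<Rightarrow> ennreal" where
  "J_lim u = (\<integral>\<^sup>+x. ennreal ((f x)\<^sup>2 * exp (- (zone_vol TYPE('a) t * norm u ^ DIM('a) * f x))) \<partial>lborel)"

lemma measurable_J [measurable]: "J n \<in> borel_measurable borel" "J_lim \<in> borel_measurable borel"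
proof -
  show "J n \<in> borel_measurable borel"
    unfolding J_def[abs_def] by measurable
  show "J_lim \<in> borel_measurable borel"
    unfolding J_lim_def[abs_def] by measurable
qed

lemma G_le_e: "0 \<le> p \<Longrightarrow> p \<le> 1 \<Longrightarrow> G n p \<le> exp 1"
  using G_exp[of p n] by (rule order_trans) (auto intro: mult_nonneg_nonneg)

lemma exp_minus_lipschitz: "\<bar>exp (- x) - exp (- y)\<bar> \<le> \<bar>x - y\<bar>" if "0 \<le> x" "0 \<le> y" for x y :: real
proof -
  have "exp (- x) - exp (- y) \<le> y - x" if "0 \<le> x" "x \<le> y" for x y :: real
  proof -
    have "exp (- x) - exp (- y) = exp (- x) * (1 - exp (- (y - x)))"
      by (simp add: right_diff_distrib flip: exp_add)
    also have "\<dots> \<le> 1 * (y - x)"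
    proof (rule mult_mono)
      show "1 - exp (- (y - x)) \<le> y - x"
        using exp_ge_add_one_self[of "- (y - x)"] by linarith
    qed (use that in auto)
    finally show ?thesis by simp
  qed
  from this[of x y] this[of y x] that show ?thesis
    by (cases "x \<le> y") (auto simp: abs_if)
qed

text \<open>Three replacements, each with its own error: f(y) by f(x), the kernel by exp(-n p), and
  n p by its limit l. The bounds f \<le> b and G \<le> e control the other factors.\<close>

lemma J_integrand_diff_le:
  fixes x u :: 'a and n :: nat
  defines "y \<equiv> x + sc n *\<^sub>R u" and "l \<equiv> zone_vol TYPE('a) t * norm u ^ DIM('a) * f x"
  shows "\<bar>f x * f y * G n (zp x y) - (f x)\<^sup>2 * exp (- l)\<bar>
    \<le> exp 1 * b * \<bar>f y - f x\<bar> + b * \<epsilon> n * f x + b\<^sup>2 * gap n u x"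
proof -
  let ?G = "G n (zp x y)"
  have l: "0 \<le> l"
    unfolding l_def using f_nonneg zone_vol_pos[of t, where 'a='a] by (intro mult_nonneg_nonneg) auto
  have fx: "0 \<le> f x" "f x \<le> b" by (simp_all add: f_nonneg f_le)
  have G: "0 \<le> ?G" "?G \<le> exp 1" by (simp_all add: G_nonneg G_le_e)
  have "\<bar>?G - exp (- l)\<bar> \<le> \<bar>?G - exp (- (real n * zp x y))\<bar> + \<bar>exp (- (real n * zp x y)) - exp (- l)\<bar>"
    by linarith
  also have "\<dots> \<le> \<epsilon> n + gap n u x"
    using exp_minus_lipschitz[of "real n * zp x y" l] l unfolding gap_def y_def[symmetric] l_def[symmetric]
    by (intro add_mono G_eps) auto
  finally have diff: "\<bar>?G - exp (- l)\<bar> \<le> \<epsilon> n + gap n u x" .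
  have eps0: "0 \<le> \<epsilon> n" using G_eps[of 0 n] by linarith
  have gap0: "0 \<le> gap n u x" by (simp add: gap_def)
  have "f x * f y * ?G - (f x)\<^sup>2 * exp (- l) = f x * ?G * (f y - f x) + (f x)\<^sup>2 * (?G - exp (- l))"
    by (simp add: algebra_simps power2_eq_square)
  also have "\<bar>\<dots>\<bar> \<le> \<bar>f x * ?G * (f y - f x)\<bar> + \<bar>(f x)\<^sup>2 * (?G - exp (- l))\<bar>"
    by (rule abs_triangle_ineq)
  also have "\<dots> = (f x * ?G) * \<bar>f y - f x\<bar> + (f x)\<^sup>2 * \<bar>?G - exp (- l)\<bar>"
    using fx G by (simp add: abs_mult)
  also have "\<dots> \<le> (b * exp 1) * \<bar>f y - f x\<bar> + (f x)\<^sup>2 * (\<epsilon> n + gap n u x)"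
    using fx G diff by (intro add_mono mult_mono) auto
  also have "(f x)\<^sup>2 * (\<epsilon> n + gap n u x) = f x * f x * \<epsilon> n + (f x)\<^sup>2 * gap n u x"
    by (simp add: algebra_simps power2_eq_square)
  also have "\<dots> \<le> b * f x * \<epsilon> n + b\<^sup>2 * gap n u x"
    using fx eps0 gap0 by (intro add_mono mult_right_mono power_mono) auto
  finally show ?thesis by (simp add: mult_ac)
qed

text \<open>Integrated over x, the three errors vanish by \<open>L1_shift\<close>, by
  \<open>eps\<close> and by \<open>gap_tendsto\<close>. The limit holds for every u.\<close>

lemma J_tendsto: "(\<lambda>n. J n u) \<longlonglongrightarrow> J_lim u"
proof -
  let ?s = "zone_vol TYPE('a) t"
  define jn where "jn n x = f x * f (x + sc n *\<^sub>R u) * G n (zp x (x + sc n *\<^sub>R u))" for n x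
  define j where "j x = (f x)\<^sup>2 * exp (- (?s * norm u ^ DIM('a) * f x))" for x
  have [measurable]: "jn n \<in> borel_measurable borel" "j \<in> borel_measurable borel" for n
    unfolding jn_def[abs_def] j_def[abs_def] by measurable
  have jn_nonneg: "0 \<le> jn n x" and j_nonneg: "0 \<le> j x" for n x
    by (auto simp: jn_def j_def f_nonneg G_nonneg)
  have int_jn: "integrable lborel (jn n)" for n
  proof (rule Bochner_Integration.integrable_bound[OF integrable_mult_right[OF integrable_f, of "b * exp 1"]])
    show "AE x in lborel. norm (jn n x) \<le> norm (b * exp 1 * f x)"
    proof (rule AE_I2)
      fix x
      have "jn n x \<le> f x * b * exp 1"
        unfolding jn_def by (intro mult_mono mult_nonneg_nonneg) (auto simp: f_nonneg f_le G_nonneg G_le_e less_imp_le[OF b_pos])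
      then show "norm (jn n x) \<le> norm (b * exp 1 * f x)"
        using jn_nonneg[of n x] f_nonneg[of x] b_pos by (simp add: mult_ac)
    qed
  qed measurable
  have int_j: "integrable lborel j"
  proof (rule Bochner_Integration.integrable_bound[OF integrable_mult_right[OF integrable_f, of b]])
    show "AE x in lborel. norm (j x) \<le> norm (b * f x)"
    proof (rule AE_I2)
      fix x
      have "0 \<le> ?s * norm u ^ DIM('a) * f x"
        using f_nonneg zone_vol_pos[of t, where 'a='a] by (intro mult_nonneg_nonneg) auto
      then have "j x \<le> f x * b * 1"
        unfolding j_def power2_eq_square
        by (intro mult_mono mult_nonneg_nonneg) (auto simp: f_nonneg f_le less_imp_le[OF b_pos])
      then show "norm (j x) \<le> norm (b * f x)"
        using j_nonneg[of x] f_nonneg[of x] b_pos by (simp add: mult_ac)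
    qed
  qed measurable
  have "(\<lambda>n. \<integral>\<^sup>+x. norm (jn n x - j x) \<partial>lborel) \<longlonglongrightarrow> 0"
  proof -
    have eps0: "0 \<le> \<epsilon> n" for n using G_eps[of 0 n] by fastforce
    let ?B = "\<lambda>n. ennreal (exp 1 * b) * (\<integral>\<^sup>+x. ennreal \<bar>f (x + sc n *\<^sub>R u) - f x\<bar> \<partial>lborel)
      + ennreal (b * \<epsilon> n) + ennreal (b\<^sup>2) * (\<integral>\<^sup>+x. ennreal (gap n u x) \<partial>lborel)"
    have "?B \<longlonglongrightarrow> ennreal (exp 1 * b) * 0 + ennreal (b * 0) + ennreal (b\<^sup>2) * 0"
      by (intro tendsto_add ennreal_tendsto_cmult L1_shift gap_tendsto tendsto_ennrealI tendsto_mult tendsto_const eps) auto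
    then have lim: "?B \<longlonglongrightarrow> 0" by simp
    have le: "(\<integral>\<^sup>+x. norm (jn n x - j x) \<partial>lborel) \<le> ?B n" for n
    proof -
      have "(\<integral>\<^sup>+x. norm (jn n x - j x) \<partial>lborel) \<le>
        (\<integral>\<^sup>+x. ennreal (exp 1 * b) * ennreal \<bar>f (x + sc n *\<^sub>R u) - f x\<bar> + ennreal (b * \<epsilon> n) * ennreal (f x) + ennreal (b\<^sup>2) * ennreal (gap n u x) \<partial>lborel)"
      proof (intro nn_integral_mono)
        fix x
        have nn: "0 \<le> exp 1 * b * \<bar>f (x + sc n *\<^sub>R u) - f x\<bar>" "0 \<le> b * \<epsilon> n * f x" "0 \<le> b\<^sup>2 * gap n u x"
          using b_pos eps0 f_nonneg by (auto simp: gap_def intro!: mult_nonneg_nonneg)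
        have "ennreal (norm (jn n x - j x)) \<le> ennreal (exp 1 * b * \<bar>f (x + sc n *\<^sub>R u) - f x\<bar> + b * \<epsilon> n * f x + b\<^sup>2 * gap n u x)"
          using J_integrand_diff_le[of x n u] by (intro ennreal_leI) (simp add: jn_def j_def)
        also have "\<dots> = ennreal (exp 1 * b) * ennreal \<bar>f (x + sc n *\<^sub>R u) - f x\<bar> + ennreal (b * \<epsilon> n) * ennreal (f x) + ennreal (b\<^sup>2) * ennreal (gap n u x)"
          using nn b_pos eps0[of n] by (simp add: ennreal_plus ennreal_mult' )
        finally show "ennreal (norm (jn n x - j x)) \<le> ennreal (exp 1 * b) * ennreal \<bar>f (x + sc n *\<^sub>R u) - f x\<bar> + ennreal (b * \<epsilon> n) * ennreal (f x) + ennreal (b\<^sup>2) * ennreal (gap n u x)" .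
      qed
      also have "\<dots> = ?B n"
        by (simp add: nn_integral_add nn_integral_cmult f_prob)
      finally show ?thesis .
    qed
    show ?thesis
      by (rule tendsto_sandwich[OF _ _ tendsto_const lim])
        (use le in \<open>auto intro!: always_eventually simp del: real_norm_def\<close>)
  qed
  then have "(\<lambda>n. \<integral>x. jn n x \<partial>lborel) \<longlonglongrightarrow> (\<integral>x. j x \<partial>lborel)"
    by (intro tendsto_L1_int int_jn int_j)
  then have "(\<lambda>n. ennreal (\<integral>x. jn n x \<partial>lborel)) \<longlonglongrightarrow> ennreal (\<integral>x. j x \<partial>lborel)"
    by (rule tendsto_ennrealI)
  moreover have "J n u = ennreal (\<integral>x. jn n x \<partial>lborel)" "J_lim u = ennreal (\<integral>x. j x \<partial>lborel)" for n
    unfolding J_def J_lim_def jn_def[symmetric] j_def[symmetric]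
    by (intro nn_integral_eq_integral int_jn int_j AE_I2 jn_nonneg j_nonneg)+
  ultimately show ?thesis by simp
qed

text \<open>The integrand vanishes unless both points lie in P. There the region has mass at least
  \<kappa> |u|^d / n, and the n in the exponent of the kernel cancels, leaving a bound independent
  of n.\<close>

lemma J_le:
  assumes n: "n > 0"
  shows "J n u \<le> ennreal (exp 1 * b * exp (- (\<kappa> / 5) * norm u ^ DIM('a)))"
proof -
  let ?E = "exp 1 * b * exp (- (\<kappa> / 5) * norm u ^ DIM('a))"
  have "J n u \<le> (\<integral>\<^sup>+x. ennreal ?E * ennreal (f x) \<partial>lborel)"
    unfolding J_def
  proof (intro nn_integral_mono)
    fix x
    let ?y = "x + sc n *\<^sub>R u"
    show "ennreal (f x * f ?y * G n (zp x ?y)) \<le> ennreal ?E * ennreal (f x)"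
    proof (cases "x \<in> P \<and> ?y \<in> P")
      case True
      have "dist x ?y ^ DIM('a) = norm u ^ DIM('a) / real n"
        using sc_pos[OF n] sc_pow[OF n] by (simp add: dist_norm power_mult_distrib)
      then have "\<kappa> * (norm u ^ DIM('a) / real n) \<le> zp x ?y"
        using zp_ge[of x ?y] True by simp
      then have "\<kappa> / 5 * norm u ^ DIM('a) \<le> real n / 5 * zp x ?y"
        using n by (simp add: field_simps)
      then have "exp (1 - real n / 5 * zp x ?y) \<le> exp (1 + - (\<kappa> / 5) * norm u ^ DIM('a))"
        by simp
      then have "G n (zp x ?y) \<le> exp 1 * exp (- (\<kappa> / 5) * norm u ^ DIM('a))"
        using G_exp[of "zp x ?y" n] unfolding exp_add[symmetric] by (simp add: order_trans)
      then have "f x * f ?y * G n (zp x ?y) \<le> f x * b * (exp 1 * exp (- (\<kappa> / 5) * norm u ^ DIM('a)))"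
        by (intro mult_mono) (auto simp: f_nonneg f_le G_nonneg less_imp_le[OF b_pos])
      also have "\<dots> = ?E * f x" by simp
      finally show ?thesis
        using b_pos by (simp add: ennreal_leI flip: ennreal_mult')
    next
      case False
      then show ?thesis using f_zero by auto
    qed
  qed
  also have "\<dots> = ennreal ?E"
    by (simp add: nn_integral_cmult f_prob)
  finally show ?thesis .
qed

text \<open>Substituting y = x + sc n u, the Jacobian supplies 1/n and the edge weight
  n^(-\<alpha>/d), exactly what the prefactor removes; Fubini then makes u the outer
  variable.\<close>

lemma nn_integral_kernel_eq:
  assumes n: "n > 0"
  shows "ennreal (real n powr (1 + \<alpha> / DIM('a))) * (\<integral>\<^sup>+x. (\<integral>\<^sup>+y. ennreal (dist x y powr \<alpha> * G n (zp x y)) \<partial>mu) \<partial>mu)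
    = (\<integral>\<^sup>+u. ennreal (norm u powr \<alpha>) * J n u \<partial>lborel)"
proof -
  let ?h = "sc n"
  have h: "?h > 0" using n by (rule sc_pos)
  let ?g = "\<lambda>x u. ennreal (norm u powr \<alpha>) * ennreal (f x * f (x + ?h *\<^sub>R u) * G n (zp x (x + ?h *\<^sub>R u)))"
  have inner: "ennreal (f x) * (\<integral>\<^sup>+y. ennreal (dist x y powr \<alpha> * G n (zp x y)) \<partial>mu)
    = ennreal (real n powr (-1 - \<alpha> / DIM('a))) * (\<integral>\<^sup>+u. ?g x u \<partial>lborel)" for x
  proof -
    have "(\<integral>\<^sup>+y. ennreal (dist x y powr \<alpha> * G n (zp x y)) \<partial>mu)
      = (\<integral>\<^sup>+y. ennreal (f y) * ennreal (dist x y powr \<alpha> * G n (zp x y)) \<partial>lborel)"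
      by (rule nn_integral_mu) measurable
    also have "\<dots> = ennreal (?h ^ DIM('a)) * (\<integral>\<^sup>+u. ennreal (f (x + ?h *\<^sub>R u)) * ennreal (dist x (x + ?h *\<^sub>R u) powr \<alpha> * G n (zp x (x + ?h *\<^sub>R u))) \<partial>lborel)"
      by (rule nn_integral_lborel_affine[OF _ h]) measurable
    finally have "ennreal (f x) * (\<integral>\<^sup>+y. ennreal (dist x y powr \<alpha> * G n (zp x y)) \<partial>mu)
      = (\<integral>\<^sup>+u. ennreal (f x) * (ennreal (?h ^ DIM('a)) * (ennreal (f (x + ?h *\<^sub>R u)) * ennreal (dist x (x + ?h *\<^sub>R u) powr \<alpha> * G n (zp x (x + ?h *\<^sub>R u))))) \<partial>lborel)"
      by (simp add: nn_integral_cmult)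
    also have "\<dots> = (\<integral>\<^sup>+u. ennreal (real n powr (-1 - \<alpha> / DIM('a))) * ?g x u \<partial>lborel)"
    proof (intro nn_integral_cong)
      fix u :: 'a
      have 1: "dist x (x + ?h *\<^sub>R u) powr \<alpha> = real n powr (- \<alpha> / DIM('a)) * norm u powr \<alpha>"
        using h by (simp add: dist_norm powr_mult sc_powr)
      have 2: "?h ^ DIM('a) * real n powr (- \<alpha> / DIM('a)) = real n powr (-1 - \<alpha> / DIM('a))"
        using n by (simp add: sc_pow powr_diff powr_minus_divide)
      have "f x * (?h ^ DIM('a) * (f (x + ?h *\<^sub>R u) * (dist x (x + ?h *\<^sub>R u) powr \<alpha> * G n (zp x (x + ?h *\<^sub>R u)))))
        = real n powr (-1 - \<alpha> / DIM('a)) * (norm u powr \<alpha> * (f x * f (x + ?h *\<^sub>R u) * G n (zp x (x + ?h *\<^sub>R u))))"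
        unfolding 1 2[symmetric] by (simp only: mult_ac)
      then show "ennreal (f x) * (ennreal (?h ^ DIM('a)) * (ennreal (f (x + ?h *\<^sub>R u)) * ennreal (dist x (x + ?h *\<^sub>R u) powr \<alpha> * G n (zp x (x + ?h *\<^sub>R u)))))
        = ennreal (real n powr (-1 - \<alpha> / DIM('a))) * ?g x u"
        using h by (simp add: f_nonneg G_nonneg flip: ennreal_mult')
    qed
    also have "\<dots> = ennreal (real n powr (-1 - \<alpha> / DIM('a))) * (\<integral>\<^sup>+u. ?g x u \<partial>lborel)"
      by (rule nn_integral_cmult) measurable
    finally show ?thesis .
  qed
  have "(\<integral>\<^sup>+x. (\<integral>\<^sup>+y. ennreal (dist x y powr \<alpha> * G n (zp x y)) \<partial>mu) \<partial>mu)
    = (\<integral>\<^sup>+x. ennreal (f x) * (\<integral>\<^sup>+y. ennreal (dist x y powr \<alpha> * G n (zp x y)) \<partial>mu) \<partial>lborel)"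
    by (rule nn_integral_mu) measurable
  also have "\<dots> = ennreal (real n powr (-1 - \<alpha> / DIM('a))) * (\<integral>\<^sup>+x. (\<integral>\<^sup>+u. ?g x u \<partial>lborel) \<partial>lborel)"
    unfolding inner by (rule nn_integral_cmult) measurable
  also have "(\<integral>\<^sup>+x. (\<integral>\<^sup>+u. ?g x u \<partial>lborel) \<partial>lborel) = (\<integral>\<^sup>+u. (\<integral>\<^sup>+x. ?g x u \<partial>lborel) \<partial>lborel)"
    by (rule lborel_pair.Fubini') measurable
  also have "\<dots> = (\<integral>\<^sup>+u. ennreal (norm u powr \<alpha>) * J n u \<partial>lborel)"
    unfolding J_def by (intro nn_integral_cong nn_integral_cmult) measurable
  moreover have "ennreal (real n powr (1 + \<alpha> / DIM('a))) * ennreal (real n powr (-1 - \<alpha> / DIM('a))) = 1"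
    using n by (simp flip: ennreal_mult' powr_add)
  ultimately show ?thesis
    by (simp add: mult.assoc[symmetric])
qed

lemma kernel_limit:
  assumes \<alpha>: "\<alpha> \<ge> 0"
  shows "(\<lambda>n. ennreal (real n powr (1 + \<alpha> / DIM('a))) * (\<integral>\<^sup>+x. (\<integral>\<^sup>+y. ennreal (dist x y powr \<alpha> * G n (zp x y)) \<partial>mu) \<partial>mu))
    \<longlonglongrightarrow> (\<integral>\<^sup>+u. ennreal (norm u powr \<alpha>) * J_lim u \<partial>lborel)"
proof (rule LIMSEQ_imp_Suc)
  \<comment> \<open>The index is shifted to \<open>Suc n\<close> because substitution and domination
    require a positive number of points.\<close>
  have "(\<lambda>n. \<integral>\<^sup>+u. ennreal (norm u powr \<alpha>) * J (Suc n) u \<partial>lborel) \<longlonglongrightarrow> (\<integral>\<^sup>+u. ennreal (norm u powr \<alpha>) * J_lim u \<partial>lborel)"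
  proof (rule nn_integral_dominated_convergence[where w="\<lambda>u. ennreal (norm u powr \<alpha>) * ennreal (exp 1 * b * exp (- (\<kappa> / 5) * norm u ^ DIM('a)))"])
    show "AE u in lborel. ennreal (norm u powr \<alpha>) * J (Suc n) u \<le> ennreal (norm u powr \<alpha>) * ennreal (exp 1 * b * exp (- (\<kappa> / 5) * norm u ^ DIM('a)))" for n
      by (intro AE_I2 mult_left_mono J_le) auto
    show "AE u in lborel. (\<lambda>n. ennreal (norm u powr \<alpha>) * J (Suc n) u) \<longlonglongrightarrow> ennreal (norm u powr \<alpha>) * J_lim u"
      by (intro AE_I2 ennreal_tendsto_cmult LIMSEQ_Suc[OF J_tendsto]) auto
    have "(\<integral>\<^sup>+u. ennreal (norm u powr \<alpha>) * ennreal (exp 1 * b * exp (- (\<kappa> / 5) * norm u ^ DIM('a))) \<partial>(lborel :: 'a measure))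
      = ennreal (exp 1 * b) * (\<integral>\<^sup>+u. ennreal (norm u powr \<alpha> * exp (- (\<kappa> / 5) * norm u ^ DIM('a))) \<partial>(lborel :: 'a measure))"
      using b_pos by (subst nn_integral_cmult[symmetric]) (auto intro!: nn_integral_cong simp: mult_ac simp flip: ennreal_mult')
    also have "\<dots> < \<infinity>"
      unfolding nn_integral_powr_exp_norm[OF \<alpha> divide_pos_pos[OF kappa_pos zero_less_numeral]]
      by (simp add: ennreal_mult_less_top)
    finally show "(\<integral>\<^sup>+u. ennreal (norm u powr \<alpha>) * ennreal (exp 1 * b * exp (- (\<kappa> / 5) * norm u ^ DIM('a))) \<partial>(lborel :: 'a measure)) < \<infinity>" .
  qed measurable
  then show "(\<lambda>n. ennreal (real (Suc n) powr (1 + \<alpha> / DIM('a))) * (\<integral>\<^sup>+x. (\<integral>\<^sup>+y. ennreal (dist x y powr \<alpha> * G (Suc n) (zp x y)) \<partial>mu) \<partial>mu))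
    \<longlonglongrightarrow> (\<integral>\<^sup>+u. ennreal (norm u powr \<alpha>) * J_lim u \<partial>lborel)"
    by (simp only: nn_integral_kernel_eq[OF zero_less_Suc])
qed

text \<open>For fixed x the integral over u is a Gamma integral with rate s * f(x), s being the
  volume of the region. It contributes f(x)^(-1-\<alpha>/d), and the prefactor f(x)^2 makes this
  f(x)^(1-\<alpha>/d).\<close>

lemma kernel_limit_eq:
  assumes \<alpha>: "\<alpha> \<ge> 0"
  shows "(\<integral>\<^sup>+u. ennreal (norm u powr \<alpha>) * J_lim u \<partial>lborel)
    = ennreal (Ball_Volume.unit_ball_vol (real DIM('a)) * zone_vol TYPE('a) t powr (-1 - \<alpha> / DIM('a)) * Gamma (1 + \<alpha> / DIM('a)))
      * (\<integral>\<^sup>+x. ennreal (f x powr (1 - \<alpha> / DIM('a))) \<partial>lborel)"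
proof -
  let ?s = "zone_vol TYPE('a) t"
  let ?e = "\<lambda>x u. ennreal (norm u powr \<alpha>) * ennreal ((f x)\<^sup>2 * exp (- (?s * norm (u::'a) ^ DIM('a) * f x)))"
  let ?C = "Ball_Volume.unit_ball_vol (real DIM('a)) * ?s powr (-1 - \<alpha> / DIM('a)) * Gamma (1 + \<alpha> / DIM('a))"
  have s: "?s > 0" by (rule zone_vol_pos)
  have "1 + \<alpha> / DIM('a) > 0" using \<alpha> by (simp add: add_pos_nonneg)
  then have C: "?C \<ge> 0" by (auto intro!: mult_nonneg_nonneg less_imp_le[OF Gamma_real_pos])
  have "(\<integral>\<^sup>+u. ennreal (norm u powr \<alpha>) * J_lim u \<partial>lborel) = (\<integral>\<^sup>+u. (\<integral>\<^sup>+x. ?e x u \<partial>lborel) \<partial>lborel)"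
    unfolding J_lim_def by (intro nn_integral_cong nn_integral_cmult[symmetric]) measurable
  also have "\<dots> = (\<integral>\<^sup>+x. (\<integral>\<^sup>+u. ?e x u \<partial>lborel) \<partial>lborel)"
    by (rule lborel_pair.Fubini'[symmetric]) measurable
  also have "\<dots> = (\<integral>\<^sup>+x. ennreal ?C * ennreal (f x powr (1 - \<alpha> / DIM('a))) \<partial>lborel)"
  proof (intro nn_integral_cong)
    fix x
    \<comment> \<open>Where f vanishes both sides are 0, since 0 \<open>powr\<close> any exponent is
      0; the right-hand integral thus extends over the support only.\<close>
    show "(\<integral>\<^sup>+u. ?e x u \<partial>lborel) = ennreal ?C * ennreal (f x powr (1 - \<alpha> / DIM('a)))"
    proof (cases "f x = 0")
      case False
      then have fx: "f x > 0" using f_nonneg[of x] by simp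
      have "(\<integral>\<^sup>+u. ?e x u \<partial>lborel) = (\<integral>\<^sup>+u. ennreal ((f x)\<^sup>2) * ennreal (norm u powr \<alpha> * exp (- (?s * f x) * norm u ^ DIM('a))) \<partial>(lborel :: 'a measure))"
        by (intro nn_integral_cong) (simp add: mult_ac flip: ennreal_mult')
      also have "\<dots> = ennreal ((f x)\<^sup>2) * ennreal (Ball_Volume.unit_ball_vol (real DIM('a)) * ((?s * f x) powr (-1 - \<alpha> / DIM('a)) * Gamma (1 + \<alpha> / DIM('a))))"
        using nn_integral_powr_exp_norm[OF \<alpha> mult_pos_pos[OF s fx], where 'a='a] by (simp add: nn_integral_cmult)
      also have "\<dots> = ennreal (?C * ((f x)\<^sup>2 * f x powr (-1 - \<alpha> / DIM('a))))"
        using s fx by (simp add: powr_mult mult_ac flip: ennreal_mult')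
      also have "(f x)\<^sup>2 * f x powr (-1 - \<alpha> / DIM('a)) = f x powr (1 - \<alpha> / DIM('a))"
        using fx by (simp flip: powr_add powr_numeral)
      finally show ?thesis
        using C by (simp add: ennreal_mult')
    qed simp
  qed
  also have "\<dots> = ennreal ?C * (\<integral>\<^sup>+x. ennreal (f x powr (1 - \<alpha> / DIM('a))) \<partial>lborel)"
    by (rule nn_integral_cmult) measurable
  finally show ?thesis .
qed

end

subsection \<open>Mean-square convergence\<close>

text \<open>Changing the number of points by k costs at most k/m uniformly in p, because x * exp(-x)
  \<le> 1.\<close>

lemma exp_minus_diff_le:
  fixes m k p :: real
  assumes "m > 0" "k \<ge> 0" "0 \<le> p"
  shows "exp (- (m * p)) - exp (- ((m + k) * p)) \<le> k / m"
proof -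
  have "exp (- ((m + k) * p)) = exp (- (m * p)) * exp (- (k * p))"
    by (simp add: mult_exp_exp distrib_right)
  then have "exp (- (m * p)) - exp (- ((m + k) * p)) = exp (- (m * p)) * (1 - exp (- (k * p)))"
    by (simp add: right_diff_distrib)
  also have "\<dots> \<le> exp (- (m * p)) * (k * p)"
    using exp_ge_add_one_self[of "- (k * p)"] by (intro mult_left_mono) auto
  also have "\<dots> = k / m * (m * p * exp (- (m * p)))"
    using assms by simp
  also have "\<dots> \<le> k / m * 1"
  proof (rule mult_left_mono)
    have "m * p \<le> exp (m * p)"
      using exp_ge_add_one_self[of "m * p"] by linarith
    then show "m * p * exp (- (m * p)) \<le> 1"
      by (simp add: exp_minus field_simps)
  qed (use assms in auto)
  finally show ?thesis by simp
qed

text \<open>The lower estimate is 1 - p \<le> exp(-p). For the upper one, 1 - p \<ge> exp(-p) (1 -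
  p^2), Bernoulli's inequality bounds the error by m p^2 exp(-m p), and y^2 exp(-y) \<le> 2 with y =
  m p finishes.\<close>

lemma exp_minus_power_diff_le:
  fixes p :: real
  assumes "m > 0" "0 \<le> p" "p \<le> 1"
  shows "0 \<le> exp (- (real m * p)) - (1 - p) ^ m" "exp (- (real m * p)) - (1 - p) ^ m \<le> 2 / real m"
proof -
  have em: "exp (- (real m * p)) = exp (- p) ^ m"
    using exp_of_nat_mult[of m "- p"] by simp
  have "(1 - p) ^ m \<le> exp (- p) ^ m"
    using assms exp_ge_add_one_self[of "- p"] by (intro power_mono) auto
  then show "0 \<le> exp (- (real m * p)) - (1 - p) ^ m"
    by (simp add: em)
  have "(1 + p) * (1 - p) \<le> exp p * (1 - p)"
    using assms exp_ge_add_one_self[of p] by (intro mult_right_mono) auto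
  then have "exp (- p) * (1 - p\<^sup>2) \<le> 1 - p"
    by (simp add: exp_minus field_simps power2_eq_square)
  then have "(exp (- p) * (1 - p\<^sup>2)) ^ m \<le> (1 - p) ^ m"
    using assms by (intro power_mono) (auto simp: power_le_one)
  moreover have "1 - real m * p\<^sup>2 \<le> (1 - p\<^sup>2) ^ m"
    using Bernoulli_inequality[of "- p\<^sup>2" m] assms by (simp add: power_le_one)
  then have "exp (- p) ^ m * (1 - real m * p\<^sup>2) \<le> (exp (- p) * (1 - p\<^sup>2)) ^ m"
    by (simp add: power_mult_distrib)
  ultimately have "exp (- p) ^ m * (1 - real m * p\<^sup>2) \<le> (1 - p) ^ m"
    by linarith
  then have "exp (- (real m * p)) - (1 - p) ^ m \<le> real m * p\<^sup>2 * exp (- (real m * p))"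
    unfolding em by (simp add: right_diff_distrib mult_ac)
  also have "\<dots> = (real m * p)\<^sup>2 * exp (- (real m * p)) / real m"
    using assms by (simp add: power2_eq_square)
  also have "\<dots> \<le> 2 / real m"
  proof (rule divide_right_mono)
    have "1 + real m * p + (real m * p)\<^sup>2 / 2 \<le> exp (real m * p)"
      using assms by (intro exp_lower_Taylor_quadratic) auto
    then have "(real m * p)\<^sup>2 \<le> 2 * exp (real m * p)"
      using assms mult_nonneg_nonneg[of "real m" p] by linarith
    then show "(real m * p)\<^sup>2 * exp (- (real m * p)) \<le> 2"
      by (simp add: exp_minus field_simps)
  qed (use assms in auto)
  finally show "exp (- (real m * p)) - (1 - p) ^ m \<le> 2 / real m" .
qed

context nn_density
begin

text \<open>4 / (n - 4) is the price of replacing n - 4 by n in the exponent. For n \<le> 4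
  truncated subtraction would turn this quotient into 0, so the trivial bound 1 for two numbers in
  [0, 1] stands in.\<close>

definition eps4 :: "nat \<Rightarrow> real" where
  "eps4 n = (if n \<le> 4 then 1 else 4 / real (n - 4))"

lemma eps4_tendsto: "eps4 \<longlonglongrightarrow> 0"
proof -
  have "(\<lambda>n. 4 / real (n + 1)) \<longlonglongrightarrow> 0"
    by real_asymp
  then have "(\<lambda>n. eps4 (n + 5)) \<longlonglongrightarrow> 0"
    by (simp add: eps4_def)
  then show ?thesis by (rule LIMSEQ_offset)
qed

text \<open>For n \<ge> 5 the inequality n - 4 \<ge> n / 5 suffices. For smaller n the truncated n -
  k may be 0, and the summand 1 compensates because n p / 5 is below 1.\<close>

lemma linear_exponent_le:
  assumes "0 \<le> p" "p \<le> 1" "k \<le> 4"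
  shows "- (real (n - k) * p) \<le> 1 - real n / 5 * p"
proof (cases "n \<ge> 5")
  case True
  have "(real n - 5) * p \<ge> 0" using True assms by (intro mult_nonneg_nonneg) auto
  moreover have "real (n - k) * p \<ge> real (n - 4) * p" using assms by (intro mult_right_mono) auto
  moreover have "real (n - 4) * p = real n * p - 4 * p" using True by (simp add: of_nat_diff algebra_simps)
  ultimately show ?thesis using assms(1,2) by (simp add: algebra_simps)
next
  case False
  then have "real n / 5 * p \<le> 1 * 1" using assms by (intro mult_mono) auto
  moreover have "0 \<le> real (n - k) * p" using assms by auto
  ultimately show ?thesis by linarith
qed

text \<open>The kernel of \<open>I\<close>, arising in the second moment, where at least n - 4
  points remain besides the endpoints.\<close>

lemma nn_kernel_exp: "nn_kernel f P b \<kappa> t (\<lambda>n p. exp (- real (n - 4) * p)) eps4"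
proof unfold_locales
  fix n p assume p: "0 \<le> p" "p \<le> (1::real)"
  show "exp (- real (n - 4) * p) \<le> exp (1 - real n / 5 * p)"
    using linear_exponent_le[OF p, of 4 n] by simp
  show "\<bar>exp (- real (n - 4) * p) - exp (- (real n * p))\<bar> \<le> eps4 n"
  proof (cases "n \<le> 4")
    case True
    have "exp (- (real n * p)) \<le> 1" "0 \<le> exp (- (real n * p))" using p by simp_all
    then show ?thesis using True unfolding eps4_def by simp
  next
    case False
    have "exp (- (real n * p)) \<le> exp (- (real (n - 4) * p))"
      using p by (simp add: mult_right_mono)
    moreover have "exp (- (real (n - 4) * p)) - exp (- (real n * p)) \<le> 4 / real (n - 4)"
      using False exp_minus_diff_le[of "real (n - 4)" 4 p] p by (simp add: of_nat_diff)
    ultimately have "\<bar>exp (- (real (n - 4) * p)) - exp (- (real n * p))\<bar> \<le> 4 / real (n - 4)"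
      by linarith
    then show ?thesis
      unfolding eps4_def mult_minus_left by (simp only: False if_False)
  qed
qed (auto simp: eps4_tendsto)

text \<open>The exact emptiness probability given one pair, which is the kernel of the mean.\<close>

lemma nn_kernel_power: "nn_kernel f P b \<kappa> t (\<lambda>n p. (1 - p) ^ (n - 2)) eps4"
proof unfold_locales
  fix n p assume p: "0 \<le> p" "p \<le> (1::real)"
  show "0 \<le> (1 - p) ^ (n - 2)" using p by simp
  have "(1 - p) ^ (n - 2) \<le> exp (- p) ^ (n - 2)"
    using p exp_ge_add_one_self[of "- p"] by (intro power_mono) auto
  also have "\<dots> = exp (- (real (n - 2) * p))"
    using exp_of_nat_mult[of "n - 2" "- p"] by simp
  also have "\<dots> \<le> exp (1 - real n / 5 * p)"
    using linear_exponent_le[OF p, of 2 n] by simp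
  finally show "(1 - p) ^ (n - 2) \<le> exp (1 - real n / 5 * p)" .
  show "\<bar>(1 - p) ^ (n - 2) - exp (- (real n * p))\<bar> \<le> eps4 n"
  proof (cases "n \<le> 4")
    case True
    have "exp (- (real n * p)) \<le> 1" "0 \<le> exp (- (real n * p))" using p by simp_all
    moreover have "(1 - p) ^ (n - 2) \<le> 1" "0 \<le> (1 - p) ^ (n - 2)" using p by (simp_all add: power_le_one)
    ultimately have "\<bar>(1 - p) ^ (n - 2) - exp (- (real n * p))\<bar> \<le> 1" by linarith
    then show ?thesis using True by (simp add: eps4_def)
  next
    case False
    have "exp (- (real n * p)) \<le> exp (- (real (n - 2) * p))"
      using p by (simp add: mult_right_mono)
    moreover have "exp (- (real (n - 2) * p)) - exp (- (real n * p)) \<le> 2 / real (n - 2)"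
      using False exp_minus_diff_le[of "real (n - 2)" 2 p] p by (simp add: of_nat_diff)
    moreover note exp_minus_power_diff_le[of "n - 2" p]
    moreover have "2 / real (n - 2) \<le> 4 / real (n - 4)"
      using False by (intro frac_le) auto
    ultimately have "\<bar>(1 - p) ^ (n - 2) - exp (- (real n * p))\<bar> \<le> 4 / real (n - 4)"
      using False p by linarith
    then show ?thesis
      using False by (simp add: eps4_def)
  qed
qed (auto simp: eps4_tendsto)

text \<open>A probability is at most 1, so \<open>zp_ge\<close> forces \<kappa> r^d \<le> 1 for
  every distance r between sample points. This bound makes all moments finite for each n.\<close>

lemma total_AE_bound:
  assumes \<alpha>: "\<alpha> \<ge> 0"
  shows "AE w in PM n. \<bar>total \<alpha> n w\<bar> \<le> real (card (offdiag n)) * (1 / \<kappa>) powr (\<alpha> / DIM('a))"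
  using AE_PM_P[of n]
proof eventually_elim
  case (elim w)
  have "pterm \<alpha> n i j w \<le> (1 / \<kappa>) powr (\<alpha> / DIM('a))" if "(i, j) \<in> offdiag n" for i j
  proof -
    have "w i \<in> P" "w j \<in> P" using that elim by (auto simp: offdiag_def)
    then have "\<kappa> * dist (w i) (w j) ^ DIM('a) \<le> 1"
      using zp_ge[of "w i" "w j"] zp_le_1[of "w i" "w j"] by linarith
    then have "dist (w i) (w j) ^ DIM('a) \<le> 1 / \<kappa>"
      using kappa_pos by (simp add: field_simps)
    then have "(dist (w i) (w j) ^ DIM('a)) powr (\<alpha> / DIM('a)) \<le> (1 / \<kappa>) powr (\<alpha> / DIM('a))"
      using \<alpha> by (intro powr_mono2) auto
    moreover have "(dist (w i) (w j) ^ DIM('a)) powr (\<alpha> / DIM('a)) = dist (w i) (w j) powr \<alpha>"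
      by (cases "w i = w j") (simp_all add: powr_powr flip: powr_realpow)
    moreover have "pterm \<alpha> n i j w \<le> dist (w i) (w j) powr \<alpha> * 1"
      unfolding pterm_def by (intro mult_left_mono prod_le_1) (auto simp: indicator_def)
    ultimately show ?thesis by simp
  qed
  then have "total \<alpha> n w \<le> (\<Sum>(i, j)\<in>offdiag n. (1 / \<kappa>) powr (\<alpha> / DIM('a)))"
    unfolding total_def by (intro sum_mono) auto
  moreover have "0 \<le> total \<alpha> n w"
    unfolding total_def by (intro sum_nonneg) (auto simp: pterm_nonneg)
  ultimately show ?case by (simp add: case_prod_beta')
qed

lemma integrable_total:
  assumes \<alpha>: "\<alpha> \<ge> 0"
  shows "integrable (PM n) (total \<alpha> n)" "integrable (PM n) (\<lambda>w. (total \<alpha> n w)\<^sup>2)"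
proof -
  interpret PM: prob_space "PM n" by (rule prob_space_PiM_iid)
  let ?B = "real (card (offdiag n)) * (1 / \<kappa>) powr (\<alpha> / DIM('a))"
  show "integrable (PM n) (total \<alpha> n)"
    using total_AE_bound[OF \<alpha>, of n] by (intro PM.integrable_const_bound[where B="?B"]) auto
  show "integrable (PM n) (\<lambda>w. (total \<alpha> n w)\<^sup>2)"
  proof (rule PM.integrable_const_bound[where B="?B\<^sup>2"])
    show "AE w in PM n. norm ((total \<alpha> n w)\<^sup>2) \<le> ?B\<^sup>2"
      using total_AE_bound[OF \<alpha>, of n]
    proof eventually_elim
      case (elim w)
      then have "\<bar>total \<alpha> n w\<bar>\<^sup>2 \<le> ?B\<^sup>2" by (intro power_mono) auto
      then show ?case by simp
    qed
  qed measurable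
qed

lemma total_nonneg: "0 \<le> total \<alpha> n w"
  unfolding total_def by (intro sum_nonneg) (auto simp: pterm_nonneg)

lemma expectation_total:
  assumes \<alpha>: "\<alpha> \<ge> 0"
  shows "ennreal (\<integral>w. total \<alpha> n w \<partial>PM n) = ennreal (real n * (real n - 1)) *
    (\<integral>\<^sup>+x. (\<integral>\<^sup>+y. ennreal (dist x y powr \<alpha> * (1 - zp x y) ^ (n - 2)) \<partial>mu) \<partial>mu)" (is "_ = _ * ?I")
proof -
  have "ennreal (\<integral>w. total \<alpha> n w \<partial>PM n) = (\<integral>\<^sup>+w. ennreal (total \<alpha> n w) \<partial>PM n)"
    using integrable_total(1)[OF \<alpha>] by (intro nn_integral_eq_integral[symmetric]) (auto simp: total_nonneg)
  also have "\<dots> = (\<integral>\<^sup>+w. (\<Sum>p\<in>offdiag n. ennreal (pterm \<alpha> n (fst p) (snd p) w)) \<partial>PM n)"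
    by (simp add: total_def case_prod_beta' pterm_nonneg)
  also have "\<dots> = (\<Sum>p\<in>offdiag n. \<integral>\<^sup>+w. ennreal (pterm \<alpha> n (fst p) (snd p) w) \<partial>PM n)"
  proof (rule nn_integral_sum)
    fix p assume "p \<in> offdiag n"
    then have [measurable]: "pterm \<alpha> n (fst p) (snd p) \<in> borel_measurable (PM n)"
      by (intro pterm_measurable) (auto simp: offdiag_def)
    show "(\<lambda>w. ennreal (pterm \<alpha> n (fst p) (snd p) w)) \<in> borel_measurable (PM n)"
      by measurable
  qed
  also have "\<dots> = (\<Sum>p\<in>offdiag n. ?I)"
    by (intro sum.cong refl pterm_expectation) (auto simp: offdiag_def)
  also have "\<dots> = ennreal (real (card (offdiag n))) * ?I"
    by (simp add: ennreal_of_nat_eq_real_of_nat)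
  finally show ?thesis by (simp add: card_offdiag)
qed

text \<open>With Y the normalised sum, E (Y - C)^2 = E Y^2 - 2 C E Y + C^2. The mean tends to C and
  the second moment is bounded by a sequence tending to C^2, so the resulting upper bound tends to
  C^2 - 2 C^2 + C^2 = 0.\<close>

theorem total_L2_limit:
  fixes \<alpha> :: real
  assumes \<alpha>: "\<alpha> \<ge> 0" and X: "(\<integral>\<^sup>+x. ennreal (f x powr (1 - \<alpha> / DIM('a))) \<partial>lborel) = ennreal X" "X \<ge> 0"
  defines "C \<equiv> Ball_Volume.unit_ball_vol (real DIM('a)) * zone_vol TYPE('a) t powr (-1 - \<alpha> / DIM('a)) * Gamma (1 + \<alpha> / DIM('a)) * X"
  shows "(\<lambda>n. \<integral>w. (real n powr ((\<alpha> - DIM('a)) / DIM('a)) * total \<alpha> n w - C)\<^sup>2 \<partial>PM n) \<longlonglongrightarrow> 0"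
proof -
  interpret K1: nn_kernel f P b \<kappa> t "\<lambda>n p. (1 - p) ^ (n - 2)" eps4 by (rule nn_kernel_power)
  interpret K2: nn_kernel f P b \<kappa> t "\<lambda>n p. exp (- real (n - 4) * p)" eps4 by (rule nn_kernel_exp)
  let ?N = "\<lambda>n. real n powr ((\<alpha> - DIM('a)) / DIM('a))"
  let ?M = "\<lambda>n. real n powr (1 + \<alpha> / DIM('a))"
  let ?I = "\<lambda>n. \<integral>\<^sup>+x. (\<integral>\<^sup>+y. ennreal (dist x y powr \<alpha> * (1 - zp x y) ^ (n - 2)) \<partial>mu) \<partial>mu"
  have "1 + \<alpha> / DIM('a) > 0" using \<alpha> by (simp add: add_pos_nonneg)
  then have C0: "C \<ge> 0" unfolding C_def using X(2) by (auto intro!: mult_nonneg_nonneg less_imp_le[OF Gamma_real_pos])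
  have J1: "(\<integral>\<^sup>+u. ennreal (norm u powr \<alpha>) * K1.J_lim u \<partial>lborel) = ennreal C"
    unfolding K1.kernel_limit_eq[OF \<alpha>] X(1) C_def using X(2) by (simp flip: ennreal_mult'')
  have J2: "(\<integral>\<^sup>+u. ennreal (norm u powr \<alpha>) * K2.J_lim u \<partial>lborel) = ennreal C"
    unfolding K2.kernel_limit_eq[OF \<alpha>] X(1) C_def using X(2) by (simp flip: ennreal_mult'')
  \<comment> \<open>The normalisation of the sum times n^2, the order of the number of pairs, is the
    scale of the double integral.\<close>
  have NM: "?N n * real n ^ 2 = ?M n" if "n > 0" for n
  proof -
    have "?N n * real n ^ 2 = real n powr ((\<alpha> - DIM('a)) / DIM('a)) * real n powr 2"
      using that by (simp add: powr_numeral)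
    also have "\<dots> = ?M n"
      unfolding powr_add[symmetric] by (simp add: diff_divide_distrib)
    finally show ?thesis .
  qed
  have E1: "(\<lambda>n. ?N n * (\<integral>w. total \<alpha> n w \<partial>PM n)) \<longlonglongrightarrow> C"
  proof -
    \<comment> \<open>The factor (n - 1) / n corrects n^2 to the exact number n (n - 1) of ordered
      pairs.\<close>
    have "(\<lambda>n. ennreal ((real n - 1) / real n) * (ennreal (?M n) * ?I n)) \<longlonglongrightarrow> ennreal 1 * ennreal C"
    proof (intro tendsto_mult_ennreal tendsto_ennrealI)
      show "(\<lambda>n. (real n - 1) / real n) \<longlonglongrightarrow> 1" by real_asymp
      show "(\<lambda>n. ennreal (?M n) * ?I n) \<longlonglongrightarrow> ennreal C"
        using K1.kernel_limit[OF \<alpha>] unfolding J1 by simp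
    qed auto
    moreover have "eventually (\<lambda>n. ennreal ((real n - 1) / real n) * (ennreal (?M n) * ?I n) = ennreal (?N n * (\<integral>w. total \<alpha> n w \<partial>PM n))) sequentially"
      using eventually_gt_at_top[of "0::nat"]
    proof eventually_elim
      case (elim n)
      have "(real n - 1) / real n * ?M n = ?N n * (real n * (real n - 1))"
        using elim by (simp add: NM[symmetric] power2_eq_square)
      then have "ennreal ((real n - 1) / real n * ?M n) * ?I n = ennreal (?N n * (real n * (real n - 1))) * ?I n"
        by simp
      moreover have "ennreal ((real n - 1) / real n * ?M n) = ennreal ((real n - 1) / real n) * ennreal (?M n)"
        by (rule ennreal_mult'') simp
      moreover have "ennreal (?N n * (real n * (real n - 1))) = ennreal (?N n) * ennreal (real n * (real n - 1))"
        by (rule ennreal_mult') simp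
      moreover have "ennreal (?N n * (\<integral>w. total \<alpha> n w \<partial>PM n)) = ennreal (?N n) * ennreal (\<integral>w. total \<alpha> n w \<partial>PM n)"
        by (rule ennreal_mult') simp
      ultimately show ?case
        unfolding expectation_total[OF \<alpha>] by (simp only: mult.assoc)
    qed
    ultimately have "(\<lambda>n. ennreal (?N n * (\<integral>w. total \<alpha> n w \<partial>PM n))) \<longlonglongrightarrow> ennreal C"
      by (auto intro: Lim_transform_eventually)
    then show ?thesis
      by (rule tendsto_ennrealD) (auto simp: C0 total_nonneg intro!: always_eventually mult_nonneg_nonneg integral_nonneg_AE)
  qed
  define i where "i n = enn2real (I \<alpha> n)" for n
  have E2: "(\<lambda>n. (?M n * i n)\<^sup>2 + K_sq \<alpha> / real n) \<longlonglongrightarrow> C\<^sup>2 + 0"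
  proof (intro tendsto_add tendsto_power)
    have "(\<lambda>n. ennreal (?M n) * I \<alpha> n) \<longlonglongrightarrow> ennreal C"
      using K2.kernel_limit[OF \<alpha>] unfolding J2 I_def Q_def .
    moreover have "eventually (\<lambda>n. ennreal (?M n) * I \<alpha> n = ennreal (?M n * i n)) sequentially"
      using eventually_ge_at_top[of 5]
    proof eventually_elim
      case (elim n)
      have "I \<alpha> n < \<infinity>" using I_le[OF elim \<alpha>] by (simp add: order_le_less_trans)
      then show ?case by (simp add: i_def ennreal_mult')
    qed
    ultimately have "(\<lambda>n. ennreal (?M n * i n)) \<longlonglongrightarrow> ennreal C"
      by (rule Lim_transform_eventually)
    then show "(\<lambda>n. ?M n * i n) \<longlonglongrightarrow> C"
      by (rule tendsto_ennrealD) (auto simp: C0 i_def intro!: always_eventually mult_nonneg_nonneg)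
    show "(\<lambda>n. K_sq \<alpha> / real n) \<longlonglongrightarrow> 0"
      by real_asymp
  qed
  have second: "(?N n)\<^sup>2 * (\<integral>w. (total \<alpha> n w)\<^sup>2 \<partial>PM n) \<le> (?M n * i n)\<^sup>2 + K_sq \<alpha> / real n" if n: "n \<ge> 5" for n
  proof -
    have K_sq: "K_sq \<alpha> \<ge> 0"
      unfolding K_sq_def K_near_def using K_nonneg[of \<alpha>] K_nonneg[of "2 * \<alpha>"] K_nonneg[of "\<alpha> + DIM('a)"] \<alpha> b_pos
      by (intro add_nonneg_nonneg mult_nonneg_nonneg) auto
    have "ennreal (\<integral>w. (total \<alpha> n w)\<^sup>2 \<partial>PM n) = (\<integral>\<^sup>+w. ennreal ((total \<alpha> n w)\<^sup>2) \<partial>PM n)"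
      using integrable_total(2)[OF \<alpha>] by (intro nn_integral_eq_integral[symmetric]) auto
    also have "\<dots> \<le> ennreal (real n ^ 4 * (i n)\<^sup>2 + K_sq \<alpha> * real n powr (1 - 2 * \<alpha> / DIM('a)))"
      using total_square_le[OF n \<alpha>] by (simp add: i_def)
    finally have "(\<integral>w. (total \<alpha> n w)\<^sup>2 \<partial>PM n) \<le> real n ^ 4 * (i n)\<^sup>2 + K_sq \<alpha> * real n powr (1 - 2 * \<alpha> / DIM('a))"
      using K_sq by (subst (asm) ennreal_le_iff) (auto intro!: add_nonneg_nonneg mult_nonneg_nonneg)
    then have "(?N n)\<^sup>2 * (\<integral>w. (total \<alpha> n w)\<^sup>2 \<partial>PM n)
      \<le> (?N n)\<^sup>2 * (real n ^ 4 * (i n)\<^sup>2 + K_sq \<alpha> * real n powr (1 - 2 * \<alpha> / DIM('a)))"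
      by (intro mult_left_mono) auto
    also have "\<dots> = (?N n * real n ^ 2 * i n)\<^sup>2 + K_sq \<alpha> * ((?N n)\<^sup>2 * real n powr (1 - 2 * \<alpha> / DIM('a)))"
      by (simp add: power_mult_distrib algebra_simps)
    also have "(?N n)\<^sup>2 * real n powr (1 - 2 * \<alpha> / DIM('a)) = real n powr (2 * ((\<alpha> - DIM('a)) / DIM('a)) + (1 - 2 * \<alpha> / DIM('a)))"
      unfolding power2_eq_square powr_add[symmetric] by simp
    \<comment> \<open>The net exponent -1 turns all overlap contributions into K_sq / n.\<close>
    also have "2 * ((\<alpha> - DIM('a)) / DIM('a)) + (1 - 2 * \<alpha> / DIM('a)) = (-1 :: real)"
      by (simp add: diff_divide_distrib)
    finally show ?thesis
      using n by (simp add: NM powr_minus_divide)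
  qed
  have eq: "(\<integral>w. (?N n * total \<alpha> n w - C)\<^sup>2 \<partial>PM n)
    = (?N n)\<^sup>2 * (\<integral>w. (total \<alpha> n w)\<^sup>2 \<partial>PM n) - 2 * C * (?N n * (\<integral>w. total \<alpha> n w \<partial>PM n)) + C\<^sup>2" for n
  proof -
    interpret PM: prob_space "PM n" by (rule prob_space_PiM_iid)
    have "(\<integral>w. (?N n * total \<alpha> n w - C)\<^sup>2 \<partial>PM n)
      = (\<integral>w. (?N n)\<^sup>2 * (total \<alpha> n w)\<^sup>2 - 2 * C * ?N n * total \<alpha> n w + C\<^sup>2 \<partial>PM n)"
      by (intro Bochner_Integration.integral_cong) (auto simp: power2_eq_square algebra_simps)
    also have "\<dots> = (?N n)\<^sup>2 * (\<integral>w. (total \<alpha> n w)\<^sup>2 \<partial>PM n) - 2 * C * ?N n * (\<integral>w. total \<alpha> n w \<partial>PM n) + C\<^sup>2"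
      using integrable_total[OF \<alpha>, of n] by (simp add: PM.prob_space)
    finally show ?thesis by (simp add: mult.assoc)
  qed
  have "(\<lambda>n. ((?M n * i n)\<^sup>2 + K_sq \<alpha> / real n) - 2 * C * (?N n * (\<integral>w. total \<alpha> n w \<partial>PM n)) + C\<^sup>2)
    \<longlonglongrightarrow> (C\<^sup>2 + 0) - 2 * C * C + C\<^sup>2"
    by (intro tendsto_intros E1 E2)
  then have lim: "(\<lambda>n. ((?M n * i n)\<^sup>2 + K_sq \<alpha> / real n) - 2 * C * (?N n * (\<integral>w. total \<alpha> n w \<partial>PM n)) + C\<^sup>2) \<longlonglongrightarrow> 0"
    by (simp add: power2_eq_square)
  show ?thesis
  proof (rule tendsto_sandwich[OF _ _ tendsto_const lim])
    show "eventually (\<lambda>n. 0 \<le> (\<integral>w. (?N n * total \<alpha> n w - C)\<^sup>2 \<partial>PM n)) sequentially"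
      by (intro always_eventually allI integral_nonneg_AE) auto
    show "eventually (\<lambda>n. (\<integral>w. (?N n * total \<alpha> n w - C)\<^sup>2 \<partial>PM n)
      \<le> ((?M n * i n)\<^sup>2 + K_sq \<alpha> / real n) - 2 * C * (?N n * (\<integral>w. total \<alpha> n w \<partial>PM n)) + C\<^sup>2) sequentially"
      using eventually_ge_at_top[of 5] by eventually_elim (use second in \<open>auto simp: eq\<close>)
  qed
qed

end

subsection \<open>The weight of the nearest-neighbour graph\<close>

text \<open>A point of the sample is represented by the least index at which it occurs. This makes the
  length of the graph an explicit function of the sample, also when points coincide, and hence
  measurable.\<close>

definition first_occ :: "(nat \<Rightarrow> 'a::metric_space) \<Rightarrow> nat \<Rightarrow> bool" where
  "first_occ w i \<longleftrightarrow> (\<forall>k\<in>{..<i}. 0 < dist (w k) (w i))"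

text \<open>Distinctness of points is written as a positive distance, so the condition is built from
  order comparisons of measurable real functions and still agrees with \<open>nn_of\<close> when
  sample points coincide.\<close>

definition nn_idx :: "nat \<Rightarrow> (nat \<Rightarrow> 'a::metric_space) \<Rightarrow> nat \<Rightarrow> nat \<Rightarrow> bool" where
  "nn_idx n w i j \<longleftrightarrow> 0 < dist (w j) (w i) \<and>
    (\<forall>k\<in>{..<n}. 0 < dist (w k) (w i) \<longrightarrow> dist (w i) (w j) \<le> dist (w i) (w k))"

lemma nn_of_image_iff:
  "i < n \<Longrightarrow> j < n \<Longrightarrow> nn_of (w ` {..<n}) (w i) (w j) \<longleftrightarrow> nn_idx n w i j"
  by (auto simp: nn_of_def nn_idx_def)

lemma first_occ_exists:
  assumes "x \<in> w ` {..<n}"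
  obtains i where "i < n" "first_occ w i" "w i = x"
proof -
  define i where "i = (LEAST i. w i = x)"
  obtain k where k: "k < n" "w k = x" using assms by auto
  have wi: "w i = x" unfolding i_def using k(2) by (rule LeastI)
  have "i \<le> k" unfolding i_def using k(2) by (rule Least_le)
  moreover have "w l \<noteq> x" if "l < i" for l
    using that unfolding i_def by (rule not_less_Least)
  then have "first_occ w i"
    unfolding first_occ_def wi by simp
  ultimately show thesis using that[of i] k(1) wi by simp
qed

lemma inj_on_first_occ: "inj_on w {i. first_occ w i}"
proof (rule inj_onI)
  fix i j assume ij: "i \<in> {i. first_occ w i}" "j \<in> {i. first_occ w i}" "w i = w j"
  then have "\<not> i < j" "\<not> j < i"
    unfolding first_occ_def by auto
  then show "i = j" by simp
qed

text \<open>Indices of first occurrence are in bijection with the points of the sample, so ordered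
  adjacent pairs of points can be reindexed by pairs of such indices. The result is a finite sum
  over a fixed index range.\<close>

lemma NN_weight_image:
  "NN_weight \<alpha> (w ` {..<n}) = (\<Sum>i<n. \<Sum>j<n.
    if first_occ w i \<and> first_occ w j \<and> (nn_idx n w i j \<or> nn_idx n w j i) then dist (w i) (w j) powr \<alpha> else 0) / 2"
proof -
  let ?X = "w ` {..<n}"
  let ?c = "\<lambda>i j. first_occ w i \<and> first_occ w j \<and> (nn_idx n w i j \<or> nn_idx n w j i)"
  define S where "S = {p \<in> {..<n} \<times> {..<n}. ?c (fst p) (snd p)}"
  have adj: "nn_adj ?X (w i) (w j) \<longleftrightarrow> nn_idx n w i j \<or> nn_idx n w j i" if "i < n" "j < n" for i j
    unfolding nn_adj_def using nn_of_image_iff that by metis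
  have "{(u, v). nn_adj ?X u v} = (\<lambda>p. (w (fst p), w (snd p))) ` S"
  proof (intro set_eqI iffI)
    fix q assume "q \<in> {(u, v). nn_adj ?X u v}"
    then obtain u v where q: "q = (u, v)" "nn_adj ?X u v" by auto
    then have "u \<in> ?X" "v \<in> ?X" by (auto simp: nn_adj_def nn_of_def)
    obtain i where i: "i < n" "first_occ w i" "w i = u" using first_occ_exists[OF \<open>u \<in> ?X\<close>] .
    obtain j where j: "j < n" "first_occ w j" "w j = v" using first_occ_exists[OF \<open>v \<in> ?X\<close>] .
    have "(i, j) \<in> S" using i j q adj[of i j] by (auto simp: S_def)
    then show "q \<in> (\<lambda>p. (w (fst p), w (snd p))) ` S"
      using i j q by (auto intro!: image_eqI[of _ _ "(i, j)"])
  qed (auto simp: S_def adj)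
  moreover have "inj_on (\<lambda>p. (w (fst p), w (snd p))) S"
    using inj_on_first_occ[of w] by (auto simp: inj_on_def S_def)
  ultimately have "(\<Sum>(u, v)\<in>{(u, v). nn_adj ?X u v}. dist u v powr \<alpha>) = (\<Sum>p\<in>S. dist (w (fst p)) (w (snd p)) powr \<alpha>)"
    by (simp add: sum.reindex)
  also have "\<dots> = (\<Sum>p\<in>{..<n} \<times> {..<n}. if ?c (fst p) (snd p) then dist (w (fst p)) (w (snd p)) powr \<alpha> else 0)"
    unfolding S_def by (rule sum.inter_filter) auto
  also have "\<dots> = (\<Sum>i<n. \<Sum>j<n. if ?c i j then dist (w i) (w j) powr \<alpha> else 0)"
    by (simp add: sum.cartesian_product case_prod_beta')
  finally show ?thesis unfolding NN_weight_def by simp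
qed

lemma measurable_NN_weight:
  fixes M :: "'a::euclidean_space measure" and n :: nat
  assumes M: "sets M = sets borel"
  shows "(\<lambda>w. NN_weight \<alpha> (w ` {..<n})) \<in> borel_measurable (PiM {..<n} (\<lambda>_. M))"
proof -
  let ?P = "PiM {..<n} (\<lambda>_. M)"
  have comp: "(\<lambda>w. w i) \<in> borel_measurable ?P" if "i < n" for i
    using measurable_component_singleton[of i "{..<n}" "\<lambda>_. M"] that
    by (simp add: measurable_cong_sets[OF refl M])
  have dist: "(\<lambda>w. dist (w i) (w j)) \<in> borel_measurable ?P" if "i < n" "j < n" for i j
    using that by (intro borel_measurable_dist comp)
  have less: "Measurable.pred ?P (\<lambda>w. 0 < g w)" if [measurable]: "g \<in> borel_measurable ?P" for g :: "_ \<Rightarrow> real"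
    by measurable
  have imp: "Measurable.pred ?P (\<lambda>w. 0 < g w \<longrightarrow> h w \<le> h' w)"
    if [measurable]: "g \<in> borel_measurable ?P" "h \<in> borel_measurable ?P" "h' \<in> borel_measurable ?P"
    for g h h' :: "_ \<Rightarrow> real"
    unfolding linorder_not_less[symmetric] by measurable
  have if_else: "(\<lambda>w. if A w \<and> B w \<and> (C w \<or> D w) then g w powr \<alpha> else 0) \<in> borel_measurable ?P"
    if [measurable]: "g \<in> borel_measurable ?P" "Measurable.pred ?P A" "Measurable.pred ?P B" "Measurable.pred ?P C" "Measurable.pred ?P D"
    for g :: "_ \<Rightarrow> real" and A B C D
    by measurable
  have first: "Measurable.pred ?P (\<lambda>w. first_occ w i)" if "i < n" for i
    unfolding first_occ_def
  proof (rule pred_intros_finite)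
    fix k assume "k \<in> {..<i}"
    then show "Measurable.pred ?P (\<lambda>w. 0 < dist (w k) (w i))"
      using that by (intro less dist) auto
  qed auto
  have idx: "Measurable.pred ?P (\<lambda>w. nn_idx n w i j)" if ij: "i < n" "j < n" for i j
  proof -
    have "Measurable.pred ?P (\<lambda>w. \<forall>k\<in>{..<n}. 0 < dist (w k) (w i) \<longrightarrow> dist (w i) (w j) \<le> dist (w i) (w k))"
      using ij by (intro pred_intros_finite imp dist) auto
    then show ?thesis
      unfolding nn_idx_def using ij by (intro pred_intros_logic less dist)
  qed
  have "(\<lambda>w. if first_occ w i \<and> first_occ w j \<and> (nn_idx n w i j \<or> nn_idx n w j i) then dist (w i) (w j) powr \<alpha> else 0)
    \<in> borel_measurable ?P" if ij: "i < n" "j < n" for i j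
    by (intro if_else dist first idx ij)
  then show ?thesis
    unfolding NN_weight_image by (intro borel_measurable_divide borel_measurable_sum) auto
qed

text \<open>Restates \<open>total\<close> with t as an explicit argument outside the locale, so that
  the sums for t = 0 and t = 1 can occur in one deterministic identity.\<close>

definition zone_sum :: "real \<Rightarrow> real \<Rightarrow> nat \<Rightarrow> (nat \<Rightarrow> 'a::euclidean_space) \<Rightarrow> real" where
  "zone_sum t \<alpha> n w = (\<Sum>(i, j)\<in>offdiag n.
    dist (w i) (w j) powr \<alpha> * (\<Prod>m\<in>{..<n} - {i, j}. indicator (- zone t (w i) (w j)) (w m)))"

lemma prod_indicator: "finite A \<Longrightarrow> (\<Prod>m\<in>A. indicator (- Z) (w m) :: real) = of_bool (\<forall>m\<in>A. w m \<notin> Z)"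
  by (induction A rule: finite_induct) (auto simp: indicator_def)

text \<open>Inclusion-exclusion for "j is nearest to i" or "i is nearest to j". The two single sums
  agree by exchanging i and j and both equal the sum for t = 0; the joint condition gives t = 1.
  Halving the ordered sum leaves the stated combination.\<close>

lemma NN_weight_eq_zone_sums:
  fixes w :: "nat \<Rightarrow> 'a::euclidean_space"
  assumes inj: "inj_on w {..<n}"
  shows "NN_weight \<alpha> (w ` {..<n}) = zone_sum 0 \<alpha> n w - zone_sum 1 \<alpha> n w / 2"
proof -
  let ?d = "\<lambda>i j. dist (w i) (w j) powr \<alpha>"
  let ?nn = "\<lambda>i j. nn_idx n w i j"
  have first: "first_occ w i" if "i < n" for i
    using inj that by (auto simp: first_occ_def inj_on_def)
  have ne: "w i = w j \<longleftrightarrow> i = j" if "i < n" "j < n" for i j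
    using inj that by (auto simp: inj_on_def)
  have nn: "?nn i j \<longleftrightarrow> (\<forall>m\<in>{..<n} - {i, j}. w m \<notin> ball (w i) (dist (w i) (w j)))" if "(i, j) \<in> offdiag n" for i j
    using that ne by (auto simp: nn_idx_def offdiag_def not_less)
  have nn_off: "(i, j) \<in> offdiag n" if "?nn i j" "i < n" "j < n" for i j
    using that by (auto simp: nn_idx_def offdiag_def)
  have swap: "(\<Sum>p\<in>offdiag n. of_bool (?nn (snd p) (fst p)) * ?d (fst p) (snd p)) = (\<Sum>p\<in>offdiag n. of_bool (?nn (fst p) (snd p)) * ?d (fst p) (snd p))"
    by (rule sum.reindex_bij_witness[where i="\<lambda>p. (snd p, fst p)" and j="\<lambda>p. (snd p, fst p)"])
      (auto simp: offdiag_def dist_commute)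
  have "zone_sum 0 \<alpha> n w = (\<Sum>p\<in>offdiag n. of_bool (?nn (fst p) (snd p)) * ?d (fst p) (snd p))"
    unfolding zone_sum_def
    by (intro sum.cong refl) (auto simp: prod_indicator zone_0 nn split: prod.splits)
  moreover have "zone_sum 1 \<alpha> n w = (\<Sum>p\<in>offdiag n. of_bool (?nn (fst p) (snd p) \<and> ?nn (snd p) (fst p)) * ?d (fst p) (snd p))"
    unfolding zone_sum_def
  proof (intro sum.cong refl)
    fix p assume p: "p \<in> offdiag n"
    obtain i j where ij: "p = (i, j)" by (cases p)
    have "(j, i) \<in> offdiag n" using p ij by (auto simp: offdiag_def)
    then have "?nn i j \<and> ?nn j i \<longleftrightarrow> (\<forall>m\<in>{..<n} - {i, j}. w m \<notin> zone 1 (w i) (w j))"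
      using nn[of i j] nn[of j i] p ij by (auto simp: zone_1 dist_commute)
    then show "(case p of (i, j) \<Rightarrow> ?d i j * (\<Prod>m\<in>{..<n} - {i, j}. indicator (- zone 1 (w i) (w j)) (w m)))
      = of_bool (?nn (fst p) (snd p) \<and> ?nn (snd p) (fst p)) * ?d (fst p) (snd p)"
      by (simp add: ij prod_indicator)
  qed
  moreover have "NN_weight \<alpha> (w ` {..<n}) = (\<Sum>p\<in>offdiag n. of_bool (?nn (fst p) (snd p) \<or> ?nn (snd p) (fst p)) * ?d (fst p) (snd p)) / 2"
  proof -
    have "NN_weight \<alpha> (w ` {..<n}) = (\<Sum>i<n. \<Sum>j<n. of_bool (?nn i j \<or> ?nn j i) * ?d i j) / 2"
      unfolding NN_weight_image by (intro arg_cong2[where f="(/)"] refl sum.cong) (auto simp: first)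
    also have "\<dots> = (\<Sum>p\<in>{..<n} \<times> {..<n}. of_bool (?nn (fst p) (snd p) \<or> ?nn (snd p) (fst p)) * ?d (fst p) (snd p)) / 2"
      by (simp add: sum.cartesian_product case_prod_beta')
    also have "(\<Sum>p\<in>{..<n} \<times> {..<n}. of_bool (?nn (fst p) (snd p) \<or> ?nn (snd p) (fst p)) * ?d (fst p) (snd p))
      = (\<Sum>p\<in>offdiag n. of_bool (?nn (fst p) (snd p) \<or> ?nn (snd p) (fst p)) * ?d (fst p) (snd p))"
      by (rule sum.mono_neutral_right) (use nn_off in \<open>auto simp: offdiag_def nn_idx_def\<close>)
    finally show ?thesis .
  qed
  moreover have "(\<Sum>p\<in>offdiag n. of_bool (?nn (fst p) (snd p) \<or> ?nn (snd p) (fst p)) * ?d (fst p) (snd p))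
    = (\<Sum>p\<in>offdiag n. of_bool (?nn (fst p) (snd p)) * ?d (fst p) (snd p)) + (\<Sum>p\<in>offdiag n. of_bool (?nn (snd p) (fst p)) * ?d (fst p) (snd p))
      - (\<Sum>p\<in>offdiag n. of_bool (?nn (fst p) (snd p) \<and> ?nn (snd p) (fst p)) * ?d (fst p) (snd p))"
    by (simp only: sum.distrib[symmetric] sum_subtractf[symmetric]) (auto intro!: sum.cong)
  ultimately show ?thesis
    unfolding swap by (simp add: field_simps)
qed

context nn_density
begin

lemma total_eq_zone_sum: "total \<alpha> n w = zone_sum t \<alpha> n w"
  by (simp add: total_def pterm_def zone_sum_def)

lemma AE_PM_inj: "AE w in PM n. inj_on w {..<n}"
proof -
  have pair: "AE w in PM n. w i \<noteq> w j" if ij: "i < n" "j < n" "i \<noteq> j" for i j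
  proof -
    note [measurable] = component_borel[OF ij(1)] component_borel[OF ij(2)]
    have null: "(\<integral>\<^sup>+y. (if x = y then 1 else 0) \<partial>mu) = 0" for x
    proof -
      have "AE y in lborel. y \<noteq> x" by (rule AE_lborel_singleton)
      then have "AE y in mu. y \<noteq> x"
        unfolding mu_def by (subst AE_density) (auto elim: eventually_mono)
      then have "(\<integral>\<^sup>+y. (if x = y then 1 else 0) \<partial>mu) = (\<integral>\<^sup>+y. 0 \<partial>mu)"
        by (intro nn_integral_cong_AE) (auto elim!: eventually_mono)
      then show ?thesis by simp
    qed
    have "(\<integral>\<^sup>+w. (if w i = w j then 1 else 0) \<partial>PM n) = (\<integral>\<^sup>+x. (\<integral>\<^sup>+y. (if x = y then 1 else 0) \<partial>mu) \<partial>mu)"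
      by (rule nn_integral_PM_pair[OF ij, of "\<lambda>x y. if x = y then 1 else 0"]) measurable
    then have "(\<integral>\<^sup>+w. (if w i = w j then 1 else 0) \<partial>PM n) = 0"
      by (simp add: null)
    then have "AE w in PM n. (if w i = w j then 1 else 0 :: ennreal) = 0"
      by (subst (asm) nn_integral_0_iff_AE) measurable
    then show ?thesis by (auto elim!: eventually_mono split: if_splits)
  qed
  have "AE w in PM n. \<forall>p\<in>offdiag n. w (fst p) \<noteq> w (snd p)"
    by (rule AE_finite_allI[OF finite_offdiag]) (auto simp: offdiag_def pair)
  then show ?thesis
    by eventually_elim (auto simp: inj_on_def offdiag_def)
qed

end

text \<open>The bound f \<ge> a on P and total mass 1 force P to have finite volume, and convexity
  then makes it bounded; the lower bound on ball masses follows by shrinking P towards the centre of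
  the ball. The locale is instantiated for t = 0 and t = 1 over the same measure.\<close>

lemma NN_weight_L2_limit:
  fixes f :: "'a::euclidean_space \<Rightarrow> real" and P :: "'a set" and a b \<alpha> :: real
  assumes \<alpha>: "\<alpha> \<ge> 0" and f_meas [measurable]: "f \<in> borel_measurable borel" and f_nonneg: "\<And>x. f x \<ge> 0"
    and f_prob: "(\<integral>\<^sup>+x. ennreal (f x) \<partial>lborel) = 1"
    and P: "closed P" "convex P" and f_zero: "\<And>x. x \<notin> P \<Longrightarrow> f x = 0"
    and a: "0 < a" and ab: "\<And>x. x \<in> P \<Longrightarrow> a \<le> f x" "\<And>x. x \<in> P \<Longrightarrow> f x \<le> b"
  shows "L2_conv_const (\<lambda>n. iid_sample n (density lborel (\<lambda>x. ennreal (f x))))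
          (\<lambda>n \<omega>. real n powr ((\<alpha> - DIM('a)) / DIM('a)) * NN_weight \<alpha> (\<omega> ` {..<n}))
          (Gamma (1 + \<alpha> / DIM('a)) *
             (Defs.unit_ball_vol DIM('a) powr (- \<alpha> / DIM('a))
              - 1/2 * Defs.unit_ball_vol DIM('a) * two_ball_vol TYPE('a) powr (-1 - \<alpha> / DIM('a))) *
             (\<integral>x\<in>P. f x powr ((DIM('a) - \<alpha>) / DIM('a)) \<partial>lborel))"
    (is "L2_conv_const _ ?Y ?c")
proof -
  have [measurable]: "P \<in> sets borel" using P by auto
  have P_pos: "emeasure lborel P \<noteq> 0"
  proof
    assume "emeasure lborel P = 0"
    then have "AE x in lborel. x \<notin> P" by (intro AE_not_in) (auto simp: null_sets_def)
    then have "(\<integral>\<^sup>+x. ennreal (f x) \<partial>lborel) = (\<integral>\<^sup>+x. 0 \<partial>(lborel :: 'a measure))"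
      by (intro nn_integral_cong_AE) (auto elim!: eventually_mono simp: f_zero)
    then show False using f_prob by simp
  qed
  then have "P \<noteq> {}" by auto
  then obtain x0 where x0: "x0 \<in> P" by auto
  have b: "b > 0" using ab[OF x0] a by simp
  have P_fin: "emeasure lborel P < \<infinity>"
  proof -
    have "ennreal a * emeasure lborel P = (\<integral>\<^sup>+x. ennreal a * indicator P x \<partial>lborel)"
      by (simp add: nn_integral_cmult_indicator)
    also have "\<dots> \<le> (\<integral>\<^sup>+x. ennreal (f x) \<partial>lborel)"
      using ab by (intro nn_integral_mono) (auto simp: ennreal_leI split: split_indicator)
    finally have "ennreal a * emeasure lborel P < \<infinity>"
      by (simp add: f_prob order_le_less_trans[OF _ ennreal_one_less_top])
    then show ?thesis
      using a by (auto simp: ennreal_mult_less_top)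
  qed
  obtain R where R: "R > 0" "\<And>x. x \<in> P \<Longrightarrow> P \<subseteq> ball x R"
  proof -
    have "bounded P" by (rule bounded_convex_finite_measure[OF P(2,1) P_pos P_fin])
    then obtain r where r: "\<And>x y. x \<in> P \<Longrightarrow> y \<in> P \<Longrightarrow> dist x y \<le> r"
      by (metis bounded_two_points)
    have "r \<ge> 0" using r[OF x0 x0] by simp
    then show ?thesis
      using r by (intro that[of "r + 1"]) (fastforce simp: less_eq_real_def)+
  qed
  define V where "V = measure lborel P"
  have V: "emeasure lborel P = ennreal V" "V > 0"
    using P_fin P_pos by (auto simp: V_def emeasure_eq_ennreal_measure less_top zero_less_measure_iff)
  \<comment> \<open>The homothety of ratio r / R leaves volume V (r / R)^d inside the ball, and the
    density there is at least a.\<close>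
  define \<kappa> where "\<kappa> = a * V / R ^ DIM('a)"
  have kappa: "\<kappa> > 0" using a V R by (simp add: \<kappa>_def)
  have ball_ge: "\<kappa> * dist x y ^ DIM('a) \<le> measure (density lborel (\<lambda>x. ennreal (f x))) (ball x (dist x y))"
    if xy: "x \<in> P" "y \<in> P" for x y
  proof -
    let ?D = "density lborel (\<lambda>x. ennreal (f x))"
    have "dist x y \<le> R" using R(2)[OF xy(1)] xy(2) by auto
    then have le: "ennreal ((dist x y / R) ^ DIM('a)) * emeasure lborel P \<le> emeasure lborel (P \<inter> ball x (dist x y))"
      using P xy R by (intro emeasure_convex_Int_ball_ge) auto
    have "ennreal (\<kappa> * dist x y ^ DIM('a)) = ennreal a * (ennreal ((dist x y / R) ^ DIM('a)) * emeasure lborel P)"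
      using a V R by (simp add: \<kappa>_def power_divide flip: ennreal_mult')
    also have "\<dots> \<le> ennreal a * emeasure lborel (P \<inter> ball x (dist x y))"
      by (intro mult_left_mono le) auto
    also have "\<dots> = (\<integral>\<^sup>+z. ennreal a * indicator (P \<inter> ball x (dist x y)) z \<partial>lborel)"
      by (simp add: nn_integral_cmult_indicator)
    also have "\<dots> \<le> (\<integral>\<^sup>+z. ennreal (f z) * indicator (ball x (dist x y)) z \<partial>lborel)"
      using ab by (intro nn_integral_mono) (auto simp: ennreal_leI split: split_indicator)
    also have "\<dots> = emeasure ?D (ball x (dist x y))"
      by (simp add: emeasure_density)
    also have "\<dots> = ennreal (measure ?D (ball x (dist x y)))"
    proof -
      have "emeasure ?D (ball x (dist x y)) \<le> emeasure ?D UNIV" by (intro emeasure_mono) auto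
      also have "\<dots> = 1" by (simp add: emeasure_density f_prob)
      finally have "emeasure ?D (ball x (dist x y)) \<noteq> \<infinity>" by (auto simp: top_unique)
      then show ?thesis by (simp add: emeasure_eq_ennreal_measure)
    qed
    finally show ?thesis
      by (simp add: ennreal_le_iff)
  qed
  have f_le: "f x \<le> b" for x
    using ab(2)[of x] f_zero[of x] b by (cases "x \<in> P") auto
  interpret D0: nn_density f P b \<kappa> 0
    by unfold_locales (use f_nonneg f_le f_zero f_prob kappa ball_ge in auto)
  interpret D1: nn_density f P b \<kappa> 1
    by unfold_locales (use f_nonneg f_le f_zero f_prob kappa ball_ge in auto)
  define X where "X = (\<integral>x\<in>P. f x powr ((DIM('a) - \<alpha>) / DIM('a)) \<partial>lborel)"
  let ?e = "1 - \<alpha> / DIM('a)"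
  have e: "(DIM('a) - \<alpha>) / DIM('a) = ?e" by (simp add: diff_divide_distrib)
  \<comment> \<open>Outside P the density is 0 and 0 \<open>powr\<close> anything is 0, so
    restricting the integral to P changes nothing.\<close>
  have ind: "f x powr ?e = indicator P x *\<^sub>R f x powr ?e" for x
    using f_zero[of x] by (auto simp: indicator_def)
  have X_int: "integrable lborel (\<lambda>x. f x powr ?e)"
  proof (rule Bochner_Integration.integrable_bound)
    show "integrable lborel (\<lambda>x. (a powr ?e + b powr ?e) * indicator P x :: real)"
      using P_fin by (intro integrable_mult_right) (simp add: integrable_indicator_iff)
    \<comment> \<open>The exponent may have either sign, so the power is bounded by its value at b
      or at a; the sum covers both.\<close>
    have "f x powr ?e \<le> a powr ?e + b powr ?e" if "x \<in> P" for x
    proof (cases "?e \<ge> 0")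
      case True
      then have "f x powr ?e \<le> b powr ?e" using f_nonneg f_le by (intro powr_mono2) auto
      then show ?thesis by (simp add: add_increasing)
    next
      case False
      then have "f x powr ?e \<le> a powr ?e" using ab(1)[OF that] a by (intro powr_mono2') auto
      then show ?thesis by (simp add: add_increasing2)
    qed
    then show "AE x in lborel. norm (f x powr ?e) \<le> norm ((a powr ?e + b powr ?e) * indicator P x :: real)"
      by (intro AE_I2) (auto simp: indicator_def f_zero)
  qed measurable
  have X_eq: "X = (\<integral>x. f x powr ?e \<partial>lborel)"
    unfolding X_def e set_lebesgue_integral_def by (intro Bochner_Integration.integral_cong refl) (rule ind[symmetric])
  have X: "(\<integral>\<^sup>+x. ennreal (f x powr ?e) \<partial>lborel) = ennreal X" "X \<ge> 0"
    unfolding X_eq using X_int by (auto intro!: nn_integral_eq_integral integral_nonneg_AE)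
  let ?v = "Ball_Volume.unit_ball_vol (real DIM('a))"
  define C0 where "C0 = ?v * zone_vol TYPE('a) 0 powr (-1 - \<alpha> / DIM('a)) * Gamma (1 + \<alpha> / DIM('a)) * X"
  define C1 where "C1 = ?v * zone_vol TYPE('a) 1 powr (-1 - \<alpha> / DIM('a)) * Gamma (1 + \<alpha> / DIM('a)) * X"
  have c: "?c = C0 - C1 / 2"
  proof -
    have "?v * ?v powr (-1 - \<alpha> / DIM('a)) = ?v powr 1 * ?v powr (-1 - \<alpha> / DIM('a))" by simp
    also have "\<dots> = ?v powr (- \<alpha> / DIM('a))" unfolding powr_add[symmetric] by simp
    finally show ?thesis
      unfolding C0_def C1_def zone_vol_0 zone_vol_1 Defs_unit_ball_vol_eq X_def[symmetric]
      by (simp add: algebra_simps)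
  qed
  let ?N = "\<lambda>n. real n powr ((\<alpha> - DIM('a)) / DIM('a))"
  let ?M = "\<lambda>n. PiM {..<n} (\<lambda>_. D0.mu)"
  define Z0 where "Z0 n w = ?N n * D0.total \<alpha> n w - C0" for n w
  define Z1 where "Z1 n w = ?N n * D1.total \<alpha> n w - C1" for n w
  have M: "iid_sample n (density lborel (\<lambda>x. ennreal (f x))) = ?M n" for n
    by (simp add: iid_sample_def D0.mu_def)
  \<comment> \<open>The identity with the region sums holds only for distinct points, hence almost
    surely; measurability of the graph weight itself has to come from its explicit form.\<close>
  have Y_meas: "(\<lambda>w. (?Y n w - ?c)\<^sup>2) \<in> borel_measurable (?M n)" for n
  proof -
    have [measurable]: "(\<lambda>w. NN_weight \<alpha> (w ` {..<n})) \<in> borel_measurable (?M n)"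
      by (rule measurable_NN_weight) simp
    show ?thesis by measurable
  qed
  have Y_le: "AE w in ?M n. (?Y n w - ?c)\<^sup>2 \<le> 2 * (Z0 n w)\<^sup>2 + (Z1 n w)\<^sup>2" for n
    using D0.AE_PM_inj[of n]
  proof eventually_elim
    case (elim w)
    have "?Y n w - ?c = Z0 n w - Z1 n w / 2"
      unfolding NN_weight_eq_zone_sums[OF elim] c Z0_def Z1_def D0.total_eq_zone_sum D1.total_eq_zone_sum
      by (simp add: right_diff_distrib diff_divide_distrib)
    moreover have "(x - y / 2)\<^sup>2 \<le> 2 * x\<^sup>2 + y\<^sup>2" for x y :: real
    proof -
      have "2 * x\<^sup>2 + y\<^sup>2 - (x - y / 2)\<^sup>2 = (x + y / 2)\<^sup>2 + y\<^sup>2 / 2"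
        by (simp add: power2_eq_square field_simps)
      also have "\<dots> \<ge> 0" by simp
      finally show ?thesis by simp
    qed
    ultimately show ?case by simp
  qed
  have int0: "integrable (?M n) (\<lambda>w. (Z0 n w)\<^sup>2)" for n
  proof -
    interpret prob_space "?M n" by (rule D0.prob_space_PiM_iid)
    show ?thesis
      using D0.integrable_total[OF \<alpha>, of n] by (simp add: Z0_def power2_diff power_mult_distrib)
  qed
  have int1: "integrable (?M n) (\<lambda>w. (Z1 n w)\<^sup>2)" for n
  proof -
    interpret prob_space "?M n" by (rule D0.prob_space_PiM_iid)
    show ?thesis
      using D1.integrable_total[OF \<alpha>, of n] by (simp add: Z1_def power2_diff power_mult_distrib)
  qed
  have int: "integrable (?M n) (\<lambda>w. 2 * (Z0 n w)\<^sup>2 + (Z1 n w)\<^sup>2)" for n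
    using int0 int1 by simp
  have intY: "integrable (?M n) (\<lambda>w. (?Y n w - ?c)\<^sup>2)" for n
    by (rule Bochner_Integration.integrable_bound[OF int Y_meas])
      (use Y_le[of n] in \<open>auto elim!: eventually_mono\<close>)
  have "(\<lambda>n. 2 * (\<integral>w. (Z0 n w)\<^sup>2 \<partial>?M n) + (\<integral>w. (Z1 n w)\<^sup>2 \<partial>?M n)) \<longlonglongrightarrow> 2 * 0 + 0"
    unfolding Z0_def Z1_def C0_def C1_def
    by (intro tendsto_intros D0.total_L2_limit[OF \<alpha> X] D1.total_L2_limit[OF \<alpha> X])
  then have lim: "(\<lambda>n. \<integral>w. 2 * (Z0 n w)\<^sup>2 + (Z1 n w)\<^sup>2 \<partial>?M n) \<longlonglongrightarrow> 0"
    using int0 int1 by simp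
  have "(\<lambda>n. \<integral>w. (?Y n w - ?c)\<^sup>2 \<partial>?M n) \<longlonglongrightarrow> 0"
  proof (rule tendsto_sandwich[OF _ _ tendsto_const lim])
    show "eventually (\<lambda>n. 0 \<le> (\<integral>w. (?Y n w - ?c)\<^sup>2 \<partial>?M n)) sequentially"
      by (intro always_eventually allI integral_nonneg_AE) auto
    show "eventually (\<lambda>n. (\<integral>w. (?Y n w - ?c)\<^sup>2 \<partial>?M n) \<le> (\<integral>w. 2 * (Z0 n w)\<^sup>2 + (Z1 n w)\<^sup>2 \<partial>?M n)) sequentially"
      by (intro always_eventually allI integral_mono_AE intY int Y_le)
  qed
  then show ?thesis
    unfolding L2_conv_const_def M using intY by blast
qed

section \<open>Uniform samples on the unit cube and the explicit constants\<close>

lemma NN_weight_uniform_box_L2_limit: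
  fixes v :: "'a::euclidean_space" and \<alpha> :: real
  assumes v: "\<And>b. b \<in> Basis \<Longrightarrow> v \<bullet> b = 1" and \<alpha>: "\<alpha> \<ge> 0"
  shows "L2_conv_const (\<lambda>n. iid_sample n (uniform_measure lborel (box 0 v)))
          (\<lambda>n \<omega>. real n powr ((\<alpha> - DIM('a)) / DIM('a)) * NN_weight \<alpha> (\<omega> ` {..<n}))
          (Gamma (1 + \<alpha> / DIM('a)) *
             (Defs.unit_ball_vol DIM('a) powr (- \<alpha> / DIM('a))
              - 1/2 * Defs.unit_ball_vol DIM('a) * two_ball_vol TYPE('a) powr (-1 - \<alpha> / DIM('a))))"
proof -
  \<comment> \<open>The general result asks for a closed support, so the density is taken on the
    closed cube; it induces the same measure because the boundary is null.\<close>
  define f :: "'a \<Rightarrow> real" where "f = indicator (cbox 0 v)"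
  have vol: "emeasure lborel (box 0 v) = 1" "emeasure lborel (cbox 0 v) = 1"
    by (simp_all add: emeasure_lborel_box_eq emeasure_lborel_cbox_eq v)
  have "emeasure lborel (cbox 0 v - box 0 v) = 0"
    using box_subset_cbox[of 0 v] by (subst emeasure_Diff) (auto simp: vol)
  then have "AE x in lborel. x \<notin> cbox 0 v - box 0 v"
    by (intro AE_not_in) (auto simp: null_sets_def)
  then have ae: "AE x in lborel. indicator (box 0 v) x / 1 = ennreal (f x)"
  proof eventually_elim
    case (elim x)
    then show ?case
      using box_subset_cbox[of 0 v] by (auto simp: f_def indicator_def)
  qed
  have unif: "uniform_measure lborel (box 0 v) = density lborel (\<lambda>x. ennreal (f x))"
    unfolding uniform_measure_def vol
    by (intro density_cong ae) (simp_all add: f_def borel_measurable_indicator)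
  have "L2_conv_const (\<lambda>n. iid_sample n (density lborel (\<lambda>x. ennreal (f x))))
          (\<lambda>n \<omega>. real n powr ((\<alpha> - DIM('a)) / DIM('a)) * NN_weight \<alpha> (\<omega> ` {..<n}))
          (Gamma (1 + \<alpha> / DIM('a)) *
             (Defs.unit_ball_vol DIM('a) powr (- \<alpha> / DIM('a))
              - 1/2 * Defs.unit_ball_vol DIM('a) * two_ball_vol TYPE('a) powr (-1 - \<alpha> / DIM('a))) *
             (\<integral>x\<in>cbox 0 v. f x powr ((DIM('a) - \<alpha>) / DIM('a)) \<partial>lborel))"
    by (rule NN_weight_L2_limit[where a=1 and b=1]) (auto simp: f_def \<alpha> ennreal_indicator vol)
  moreover have "(\<integral>x\<in>cbox 0 v. f x powr ((DIM('a) - \<alpha>) / DIM('a)) \<partial>lborel) = 1"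
  proof -
    have "(\<integral>x\<in>cbox 0 v. f x powr ((DIM('a) - \<alpha>) / DIM('a)) \<partial>lborel) = (\<integral>x. indicator (cbox 0 v) x \<partial>lborel)"
      unfolding set_lebesgue_integral_def by (intro Bochner_Integration.integral_cong) (auto simp: f_def indicator_def)
    then show ?thesis by (simp add: measure_def vol)
  qed
  ultimately show ?thesis
    unfolding unif by simp
qed

lemma inner_one_Basis_vec: "b \<in> Basis \<Longrightarrow> (1 :: real^'n) \<bullet> b = 1"
  by (auto simp: Basis_vec_def inner_axis)

lemma NN_weight_unit_square_L2_limit:
  assumes "\<alpha> \<ge> 0"
  shows "L2_conv_const (\<lambda>n. iid_sample n (uniform_measure lborel (box 0 (1::real^2))))
        (\<lambda>n \<omega>. real n powr ((\<alpha> - 2) / 2) * NN_weight \<alpha> (\<omega> ` {..<n}))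
        (Gamma (1 + \<alpha> / 2) *
           (pi powr (- \<alpha> / 2) - pi / 2 * (6 / (8 * pi + 3 * sqrt 3)) powr (1 + \<alpha> / 2)))"
proof -
  have "((8 * pi + 3 * sqrt 3) / 6) powr (-1 - \<alpha> / 2) = (6 / (8 * pi + 3 * sqrt 3)) powr (1 + \<alpha> / 2)"
  proof -
    have "((8 * pi + 3 * sqrt 3) / 6) powr (-1 - \<alpha> / 2) = ((8 * pi + 3 * sqrt 3) / 6) powr (- (1 + \<alpha> / 2))"
      by (simp add: algebra_simps)
    also have "\<dots> = inverse ((8 * pi + 3 * sqrt 3) / 6) powr (1 + \<alpha> / 2)"
      unfolding powr_minus by (rule inverse_powr[symmetric])
    finally show ?thesis by simp
  qed
  then show ?thesis
    using NN_weight_uniform_box_L2_limit[of "1 :: real^2", OF inner_one_Basis_vec assms]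
    by (simp add: Defs_unit_ball_vol_eq unit_ball_vol_2 two_ball_vol_real2)
qed

lemma Gamma_three_halves: "Gamma (3 / 2 :: real) = sqrt pi / 2"
proof -
  have "(1 / 2 :: real) \<notin> \<int>\<^sub>\<le>\<^sub>0" by (auto dest: nonpos_Ints_nonpos)
  then show ?thesis
    using Gamma_plus1[of "1 / 2 :: real"] by (simp add: Gamma_one_half_real)
qed

theorem theorem3:
  shows
  "(\<forall>(f :: 'a::euclidean_space \<Rightarrow> real) (P :: 'a set) (\<alpha>::real).
      \<alpha> \<ge> 0 \<and>
      f \<in> borel_measurable lborel \<and> (\<forall>x. f x \<ge> 0) \<and>
      (\<integral>\<^sup>+ x. ennreal (f x) \<partial>lborel) = 1 \<and>
      polyhedron P \<and> convex P \<and> (\<forall>x. x \<notin> P \<longrightarrow> f x = 0) \<and>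
      (\<exists>a b. 0 < a \<and> (\<forall>x\<in>P. a \<le> f x \<and> f x \<le> b))
    \<longrightarrow> L2_conv_const (\<lambda>n. iid_sample n (density lborel (\<lambda>x. ennreal (f x))))
          (\<lambda>n \<omega>. real n powr ((\<alpha> - DIM('a)) / DIM('a)) * NN_weight \<alpha> (\<omega> ` {..<n}))
          (Gamma (1 + \<alpha> / DIM('a)) *
             (unit_ball_vol DIM('a) powr (- \<alpha> / DIM('a))
              - 1/2 * unit_ball_vol DIM('a) * two_ball_vol TYPE('a) powr (-1 - \<alpha> / DIM('a))) *
             (\<integral>x\<in>P. f x powr ((DIM('a) - \<alpha>) / DIM('a)) \<partial>lborel)))
   \<and>
   (\<forall>\<alpha>::real. \<alpha> \<ge> 0 \<longrightarrow>
      L2_conv_const (\<lambda>n. iid_sample n (uniform_measure lborel (box 0 (1::real^2))))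
        (\<lambda>n \<omega>. real n powr ((\<alpha> - 2) / 2) * NN_weight \<alpha> (\<omega> ` {..<n}))
        (Gamma (1 + \<alpha> / 2) *
           (pi powr (- \<alpha> / 2) - pi / 2 * (6 / (8 * pi + 3 * sqrt 3)) powr (1 + \<alpha> / 2))))
   \<and>
   L2_conv_const (\<lambda>n. iid_sample n (uniform_measure lborel (box 0 (1::real^2))))
     (\<lambda>n \<omega>. real n powr (- 1 / 2) * NN_weight 1 (\<omega> ` {..<n}))
     (1 / 2 - 1 / 4 * (6 * pi / (8 * pi + 3 * sqrt 3)) powr (3 / 2))
   \<and>
   L2_conv_const (\<lambda>n. iid_sample n (uniform_measure lborel (box 0 (1::real))))
     (\<lambda>n \<omega>. NN_weight 1 (\<omega> ` {..<n}))
     (7 / 18)"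
proof (intro conjI allI impI)
  fix f :: "'a \<Rightarrow> real" and P :: "'a set" and \<alpha> :: real
  assume *: "\<alpha> \<ge> 0 \<and> f \<in> borel_measurable lborel \<and> (\<forall>x. f x \<ge> 0) \<and>
      (\<integral>\<^sup>+ x. ennreal (f x) \<partial>lborel) = 1 \<and>
      polyhedron P \<and> convex P \<and> (\<forall>x. x \<notin> P \<longrightarrow> f x = 0) \<and>
      (\<exists>a b. 0 < a \<and> (\<forall>x\<in>P. a \<le> f x \<and> f x \<le> b))"
  then obtain a b where ab: "0 < a" "\<And>x. x \<in> P \<Longrightarrow> a \<le> f x" "\<And>x. x \<in> P \<Longrightarrow> f x \<le> b" by blast
  show "L2_conv_const (\<lambda>n. iid_sample n (density lborel (\<lambda>x. ennreal (f x))))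
          (\<lambda>n \<omega>. real n powr ((\<alpha> - DIM('a)) / DIM('a)) * NN_weight \<alpha> (\<omega> ` {..<n}))
          (Gamma (1 + \<alpha> / DIM('a)) *
             (unit_ball_vol DIM('a) powr (- \<alpha> / DIM('a))
              - 1/2 * unit_ball_vol DIM('a) * two_ball_vol TYPE('a) powr (-1 - \<alpha> / DIM('a))) *
             (\<integral>x\<in>P. f x powr ((DIM('a) - \<alpha>) / DIM('a)) \<partial>lborel))"
    by (rule NN_weight_L2_limit[OF _ _ _ _ _ _ _ ab]) (use * polyhedron_imp_closed in auto)
next
  fix \<alpha> :: real assume "\<alpha> \<ge> 0"
  then show "L2_conv_const (\<lambda>n. iid_sample n (uniform_measure lborel (box 0 (1::real^2))))
        (\<lambda>n \<omega>. real n powr ((\<alpha> - 2) / 2) * NN_weight \<alpha> (\<omega> ` {..<n}))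
        (Gamma (1 + \<alpha> / 2) *
           (pi powr (- \<alpha> / 2) - pi / 2 * (6 / (8 * pi + 3 * sqrt 3)) powr (1 + \<alpha> / 2)))"
    by (rule NN_weight_unit_square_L2_limit)
next
  let ?w = "6 / (8 * pi + 3 * sqrt 3)"
  have "Gamma (1 + 1 / 2) * (pi powr (- 1 / 2) - pi / 2 * ?w powr (1 + 1 / 2))
    = 1 / 2 - 1 / 4 * (6 * pi / (8 * pi + 3 * sqrt 3)) powr (3 / 2)"
  proof -
    have "sqrt pi * pi powr (- 1 / 2) = 1"
      unfolding powr_half_sqrt[OF pi_ge_zero, symmetric] powr_add[symmetric] by simp
    moreover have "sqrt pi * pi = pi powr (3 / 2)"
    proof -
      have "sqrt pi * pi = pi powr (1 / 2) * pi powr 1" by (simp add: powr_half_sqrt)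
      then show ?thesis unfolding powr_add[symmetric] by simp
    qed
    moreover have "(6 * pi / (8 * pi + 3 * sqrt 3)) powr (3 / 2) = pi powr (3 / 2) * ?w powr (3 / 2)"
      by (subst powr_mult[symmetric]) (simp_all add: mult.commute add_nonneg_nonneg)
    ultimately show ?thesis
      by (simp add: Gamma_three_halves algebra_simps)
  qed
  then show "L2_conv_const (\<lambda>n. iid_sample n (uniform_measure lborel (box 0 (1::real^2))))
     (\<lambda>n \<omega>. real n powr (- 1 / 2) * NN_weight 1 (\<omega> ` {..<n}))
     (1 / 2 - 1 / 4 * (6 * pi / (8 * pi + 3 * sqrt 3)) powr (3 / 2))"
    using NN_weight_unit_square_L2_limit[of 1] by simp
next
  have N: "(if n = 0 then 0 else 1) * NN_weight 1 (\<omega> ` {..<n}) = NN_weight 1 (\<omega> ` {..<n})"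
    for n and \<omega> :: "nat \<Rightarrow> real"
    by (cases "n = 0") (simp_all add: NN_weight_def nn_adj_def nn_of_def)
  \<comment> \<open>With v = 2, omega = 3 and Gamma(2) = 1 the constant is 1/2 - 1/9 = 7/18.\<close>
  show "L2_conv_const (\<lambda>n. iid_sample n (uniform_measure lborel (box 0 (1::real))))
     (\<lambda>n \<omega>. NN_weight 1 (\<omega> ` {..<n}))
     (7 / 18)"
    using NN_weight_uniform_box_L2_limit[of "1::real" 1] Gamma_fact[of 1, where 'a=real]
    by (simp add: Defs_unit_ball_vol_eq two_ball_vol_real powr_minus_divide N)
qed

end
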